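(* Let $k\ge 0$ be an integer, let $p$ be an odd prime, and let $j$ be an integer with $2\le j\le p-1$. The set of all points of $\mathcal{M}_p$ for which the marked critical point is strictly $(k,1)$-preperiodic and has ramification index exactly $j$ is an irreducible quasi-affine variety of dimension $p-j$.
   Context: For a polynomial $g\in\mathbb{C}[z]$, $g^0=\mathrm{id}$ and $g^m=g\circ g^{m-1}$. For integers $k\ge 0$, $n\ge 1$, a point $x\in\mathbb{C}$ is strictly $(k,n)$-preperiodic under $g$ if $g^{k+n}(x)=g^k(x)$ and $g^{l+m}(x)\ne g^l(x)$ for all integers $0\le l\le k$, $1\le m\le n$ with $(l,m)\neq(k,n)$. The ramification index of $\alpha$ under $f$ is the multiplicity of $\alpha$ as a root of $f(z)-f(\alpha)$; it is invariant under affine conjugation of pairs $(f,\alpha)$. Let $d>2$. $\mathcal{M}_d$ is the set of equivalence classes of pairs $(f,\alpha)$, where $f\in\mathbb{C}[z]$ has degree $d$ and $\alpha\in\mathbb{C}$ satisfies $f'(\alpha)=0$ (the marked critical point), and $(f,\alpha)\sim(g,\gamma)$ iff there is $h(z)=az+b$, $a\in\mathbb{C}\setminus\{0\}$, $b\in\mathbb{C}$, with $g=h\circ f\circ h^{-1}$ and $h(\alpha)=\gamma$. Its structure of $(d-1)$-dimensional affine variety is the following. Let $V=\{(\alpha_1,\dots,\alpha_{d-1},\beta)\in\mathbb{C}^d:\sum_{i=1}^{d-1}\alpha_i=0\}$. For a point of $V$ put $$f_{\bar\alpha,\beta}(z)=z^d+\sum_{i=2}^{d-1}(-1)^i\frac{d}{d-i}s_i(\bar\alpha)z^{d-i}-\alpha_1^d-\sum_{i=2}^{d-1}(-1)^i\frac{d}{d-i}s_i(\bar\alpha)\alpha_1^{d-i}+\beta,$$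 where $s_i(\bar\alpha)$ is the $i$-th elementary symmetric polynomial in $\alpha_1,\dots,\alpha_{d-1}$; this is the monic polynomial with critical points $\alpha_1,\dots,\alpha_{d-1}$ (with multiplicity) and $f(\alpha_1)=\beta$. The map $V\to\mathcal{M}_d$ sending a point to the class of $(f_{\bar\alpha,\beta},\alpha_1)$ is surjective, and its fibres are the orbits of the finite group $G\subset GL_d(\mathbb{C})$ generated by the permutation matrices fixing the first and last coordinates and by the scalar matrices $\zeta I$ with $\zeta^{d-1}=1$. Thus $\mathcal{M}_d$ is identified with the affine variety $V/G$; its Zariski topology is the quotient topology of the Zariski topology on $V$. A quasi-affine variety in $\mathcal{M}_d$ is a locally closed subset. *)

theory Defs
  imports
    "HOL-Analysis.Abstract_Topology"
    "HOL-Library.FuncSet"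
    "HOL-Library.Extended_Nat"
    "HOL-Computational_Algebra.Polynomial"
    "HOL-Computational_Algebra.Primes"
begin

section \<open>Irreducibility, locally closed sets and dimension in a topological space\<close>

definition irreducible_space :: "'a topology \<Rightarrow> bool" where
  "irreducible_space X \<longleftrightarrow> topspace X \<noteq> {} \<and>
     (\<forall>A B. closedin X A \<longrightarrow> closedin X B \<longrightarrow> A \<union> B = topspace X \<longrightarrow>
        A = topspace X \<or> B = topspace X)"

definition irreduciblein :: "'a topology \<Rightarrow> 'a set \<Rightarrow> bool" where
  "irreduciblein X S \<longleftrightarrow> S \<subseteq> topspace X \<and> irreducible_space (subtopology X S)"

definition locally_closedin :: "'a topology \<Rightarrow> 'a set \<Rightarrow> bool" where
  "locally_closedin X S \<longleftrightarrow> (\<exists>U C. openin X U \<and> closedin X C \<and> S = U \<inter> C)"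

text \<open>
  The supremum of the lengths \<open>n\<close> of chains \<open>Z 0 \<subset> Z 1 \<subset> \<dots> \<subset> Z n\<close> of irreducible closed
  subsets of the space. The empty space gets dimension \<open>0\<close>, but irreducible spaces
  are nonempty by definition.
\<close>

definition krull_dim :: "'a topology \<Rightarrow> enat" where
  "krull_dim X = Sup {enat n | n. \<exists>Z :: nat \<Rightarrow> 'a set.
      (\<forall>i\<le>n. closedin X (Z i) \<and> irreduciblein X (Z i)) \<and> (\<forall>i<n. Z i \<subset> Z (Suc i))}"


section \<open>The Zariski topology on affine space\<close>

text \<open>
  Affine space with coordinates indexed by \<open>I\<close> is the set \<open>I \<rightarrow>\<^sub>E UNIV\<close> of functions on \<open>I\<close>
  (with the value \<open>undefined\<close> outside \<open>I\<close>).
\<close>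

inductive_set poly_funs :: "'i set \<Rightarrow> (('i \<Rightarrow> 'a::comm_ring_1) \<Rightarrow> 'a) set" for I where
  const: "(\<lambda>x. c) \<in> poly_funs I"
| coord: "i \<in> I \<Longrightarrow> (\<lambda>x. x i) \<in> poly_funs I"
| add: "f \<in> poly_funs I \<Longrightarrow> g \<in> poly_funs I \<Longrightarrow> (\<lambda>x. f x + g x) \<in> poly_funs I"
| mult: "f \<in> poly_funs I \<Longrightarrow> g \<in> poly_funs I \<Longrightarrow> (\<lambda>x. f x * g x) \<in> poly_funs I"

definition zero_locus :: "'i set \<Rightarrow> (('i \<Rightarrow> 'a::idom) \<Rightarrow> 'a) set \<Rightarrow> ('i \<Rightarrow> 'a) set" where
  "zero_locus I F = {x \<in> I \<rightarrow>\<^sub>E UNIV. \<forall>f\<in>F. f x = 0}"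

definition zariski :: "'i set \<Rightarrow> ('i \<Rightarrow> 'a::idom) topology" where
  "zariski I = topology (\<lambda>U. \<exists>F \<subseteq> poly_funs I. U = (I \<rightarrow>\<^sub>E UNIV) - zero_locus I F)"

lemma istopology_zariski:
  "istopology (\<lambda>U :: ('i \<Rightarrow> 'a::idom) set.
     \<exists>F \<subseteq> poly_funs I. U = (I \<rightarrow>\<^sub>E UNIV) - zero_locus I F)"
proof -
  have inter: "\<exists>F \<subseteq> poly_funs I. S \<inter> T = (I \<rightarrow>\<^sub>E UNIV) - zero_locus I F"
    if F: "F \<subseteq> poly_funs I" and S: "S = (I \<rightarrow>\<^sub>E UNIV) - zero_locus I F"
      and G: "G \<subseteq> poly_funs I" and T: "T = (I \<rightarrow>\<^sub>E UNIV) - zero_locus I G"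
    for S T :: "('i \<Rightarrow> 'a) set" and F G
  proof (intro exI conjI)
    show "{(\<lambda>x. f x * g x) | f g. f \<in> F \<and> g \<in> G} \<subseteq> poly_funs I"
      using F G by (auto intro!: poly_funs.mult)
    show "S \<inter> T = (I \<rightarrow>\<^sub>E UNIV) - zero_locus I {(\<lambda>x. f x * g x) | f g. f \<in> F \<and> g \<in> G}"
      (is "_ = _ - zero_locus I ?H")
    proof (intro set_eqI iffI)
      fix x
      assume "x \<in> S \<inter> T"
      then obtain f g where "x \<in> I \<rightarrow>\<^sub>E UNIV" "f \<in> F" "f x \<noteq> 0" "g \<in> G" "g x \<noteq> 0"
        unfolding S T zero_locus_def by blast
      moreover from this have "(\<lambda>x. f x * g x) \<in> ?H" "f x * g x \<noteq> 0"
        by auto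
      ultimately show "x \<in> (I \<rightarrow>\<^sub>E UNIV) - zero_locus I ?H"
        unfolding zero_locus_def by (auto simp del: mult_eq_0_iff)
    next
      fix x
      assume "x \<in> (I \<rightarrow>\<^sub>E UNIV) - zero_locus I ?H"
      then obtain h where x: "x \<in> I \<rightarrow>\<^sub>E UNIV" and h: "h \<in> ?H" "h x \<noteq> 0"
        unfolding zero_locus_def by blast
      from h(1) obtain f g where fg: "h = (\<lambda>x. f x * g x)" "f \<in> F" "g \<in> G"
        by blast
      with h(2) have "f x \<noteq> 0" "g x \<noteq> 0"
        by auto
      with x fg(2,3) show "x \<in> S \<inter> T"
        unfolding S T zero_locus_def by blast
    qed
  qed
  have union: "\<exists>F \<subseteq> poly_funs I. \<Union>K = (I \<rightarrow>\<^sub>E UNIV) - zero_locus I F"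
    if K: "\<forall>S\<in>K. \<exists>F \<subseteq> poly_funs I. S = (I \<rightarrow>\<^sub>E UNIV) - zero_locus I F"
    for K :: "('i \<Rightarrow> 'a) set set"
  proof -
    obtain F where F: "\<And>S. S \<in> K \<Longrightarrow> F S \<subseteq> poly_funs I"
        "\<And>S. S \<in> K \<Longrightarrow> S = (I \<rightarrow>\<^sub>E UNIV) - zero_locus I (F S)"
      using K by metis
    have "\<Union>K = (\<Union>S\<in>K. (I \<rightarrow>\<^sub>E UNIV) - zero_locus I (F S))"
      using F(2) by auto
    also have "\<dots> = (I \<rightarrow>\<^sub>E UNIV) - zero_locus I (\<Union>S\<in>K. F S)"
      unfolding zero_locus_def by auto
    finally show ?thesis
      using F(1) by (intro exI[of _ "\<Union>S\<in>K. F S"]) auto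
  qed
  show ?thesis
    unfolding istopology_def
  proof (intro conjI allI impI)
    fix S T :: "('i \<Rightarrow> 'a) set"
    assume "\<exists>F \<subseteq> poly_funs I. S = (I \<rightarrow>\<^sub>E UNIV) - zero_locus I F"
      and "\<exists>F \<subseteq> poly_funs I. T = (I \<rightarrow>\<^sub>E UNIV) - zero_locus I F"
    then show "\<exists>F \<subseteq> poly_funs I. S \<inter> T = (I \<rightarrow>\<^sub>E UNIV) - zero_locus I F"
      by (elim exE conjE) (rule inter)
  qed (rule union)
qed

lemma openin_zariski:
  fixes U :: "('i \<Rightarrow> 'a::idom) set"
  shows "openin (zariski I) U \<longleftrightarrow> (\<exists>F \<subseteq> poly_funs I. U = (I \<rightarrow>\<^sub>E UNIV) - zero_locus I F)"
  unfolding zariski_def topology_inverse'[OF istopology_zariski] ..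

lemma topspace_zariski:
  fixes I :: "'i set"
  shows "topspace (zariski I) = (I \<rightarrow>\<^sub>E (UNIV :: 'a::idom set))"
proof -
  have "openin (zariski I) (I \<rightarrow>\<^sub>E (UNIV :: 'a set))"
    unfolding openin_zariski
    by (intro exI[of _ "{\<lambda>x. 1}"]) (auto intro: poly_funs.const simp: zero_locus_def)
  moreover have "U \<subseteq> I \<rightarrow>\<^sub>E UNIV" if "openin (zariski I) U" for U :: "('i \<Rightarrow> 'a) set"
    using that unfolding openin_zariski by blast
  ultimately show ?thesis
    by (meson openin_subset openin_topspace subset_antisym)
qed

lemma closedin_zariski:
  fixes C :: "('i \<Rightarrow> 'a::idom) set"
  shows "closedin (zariski I) C \<longleftrightarrow> (\<exists>F \<subseteq> poly_funs I. C = zero_locus I F)"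
proof -
  have sub: "zero_locus I F \<subseteq> I \<rightarrow>\<^sub>E UNIV" for F :: "(('i \<Rightarrow> 'a) \<Rightarrow> 'a) set"
    by (auto simp: zero_locus_def)
  show ?thesis
    unfolding closedin_def topspace_zariski openin_zariski
    using sub by (metis double_diff order_refl)
qed


section \<open>Quotient topologies\<close>

definition quotient_topology :: "'a topology \<Rightarrow> ('a \<Rightarrow> 'b) \<Rightarrow> 'b set \<Rightarrow> 'b topology" where
  "quotient_topology X q Y =
     topology (\<lambda>U. U \<subseteq> Y \<and> openin X {x \<in> topspace X. q x \<in> U})"

lemma openin_quotient_topology:
  "openin (quotient_topology X q Y) U \<longleftrightarrow> U \<subseteq> Y \<and> openin X {x \<in> topspace X. q x \<in> U}"
proof -
  have "istopology (\<lambda>U. U \<subseteq> Y \<and> openin X {x \<in> topspace X. q x \<in> U})"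
    unfolding istopology_def
  proof (intro conjI allI impI)
    fix S T
    assume "S \<subseteq> Y \<and> openin X {x \<in> topspace X. q x \<in> S}"
      and "T \<subseteq> Y \<and> openin X {x \<in> topspace X. q x \<in> T}"
    moreover have "{x \<in> topspace X. q x \<in> S \<inter> T} =
        {x \<in> topspace X. q x \<in> S} \<inter> {x \<in> topspace X. q x \<in> T}"
      by auto
    ultimately show "S \<inter> T \<subseteq> Y" and "openin X {x \<in> topspace X. q x \<in> S \<inter> T}"
      by auto
  next
    fix K
    assume K: "\<forall>S\<in>K. S \<subseteq> Y \<and> openin X {x \<in> topspace X. q x \<in> S}"
    then show "\<Union>K \<subseteq> Y" by blast
    have "{x \<in> topspace X. q x \<in> \<Union>K} = (\<Union>S\<in>K. {x \<in> topspace X. q x \<in> S})"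
      by auto
    then show "openin X {x \<in> topspace X. q x \<in> \<Union>K}"
      using K by auto
  qed
  then show ?thesis
    unfolding quotient_topology_def by (simp add: topology_inverse')
qed

lemma topspace_quotient_topology:
  assumes "q ` topspace X \<subseteq> Y"
  shows "topspace (quotient_topology X q Y) = Y"
proof -
  have "{x \<in> topspace X. q x \<in> Y} = topspace X"
    using assms by auto
  then have "openin (quotient_topology X q Y) Y"
    by (simp add: openin_quotient_topology)
  then show ?thesis
    by (metis openin_quotient_topology openin_subset openin_topspace subset_antisym)
qed


section \<open>Polynomials with a marked critical point\<close>

definition strictly_preperiodic :: "('a \<Rightarrow> 'a) \<Rightarrow> nat \<Rightarrow> nat \<Rightarrow> 'a \<Rightarrow> bool" where
  "strictly_preperiodic g k n x \<longleftrightarrow> (g ^^ (k + n)) x = (g ^^ k) x \<and>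
     (\<forall>l\<in>{0..k}. \<forall>m\<in>{1..n}. (l, m) \<noteq> (k, n) \<longrightarrow> (g ^^ (l + m)) x \<noteq> (g ^^ l) x)"

definition ramification_index :: "complex poly \<Rightarrow> complex \<Rightarrow> nat" where
  "ramification_index f \<alpha> = order \<alpha> (f - [:poly f \<alpha>:])"

definition marked_pairs :: "nat \<Rightarrow> (complex poly \<times> complex) set" where
  "marked_pairs d = {(f, \<alpha>). degree f = d \<and> poly (pderiv f) \<alpha> = 0}"

text \<open>Here \<open>[:b, a:]\<close> is \<open>h(z) = a z + b\<close> and \<open>[:- b / a, 1 / a:]\<close> is its inverse.\<close>

definition affine_conj :: "nat \<Rightarrow> ((complex poly \<times> complex) \<times> (complex poly \<times> complex)) set" where
  "affine_conj d = {((f, \<alpha>), (g, \<gamma>)).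
     (f, \<alpha>) \<in> marked_pairs d \<and> (g, \<gamma>) \<in> marked_pairs d \<and>
     (\<exists>a b. a \<noteq> 0 \<and> g = [:b, a:] \<circ>\<^sub>p f \<circ>\<^sub>p [:- b / a, 1 / a:] \<and> poly [:b, a:] \<alpha> = \<gamma>)}"

definition moduli_space :: "nat \<Rightarrow> (complex poly \<times> complex) set set" where
  "moduli_space d = marked_pairs d // affine_conj d"

definition moduli_class :: "nat \<Rightarrow> complex poly \<times> complex \<Rightarrow> (complex poly \<times> complex) set" where
  "moduli_class d x = affine_conj d `` {x}"


section \<open>The variety structure on the moduli space\<close>

text \<open>
  A point \<open>(\<alpha>\<^sub>1, \<dots>, \<alpha>\<^sub>d\<^sub>-\<^sub>1, \<beta>)\<close> is encoded as a function \<open>v\<close> on \<open>{1..d}\<close> with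
  \<open>v i = \<alpha>\<^sub>i\<close> for \<open>i < d\<close> and \<open>v d = \<beta>\<close>.
\<close>

definition param_space :: "nat \<Rightarrow> (nat \<Rightarrow> complex) set" where
  "param_space d = {v \<in> {1..d} \<rightarrow>\<^sub>E UNIV. (\<Sum>i=1..d-1. v i) = 0}"

definition elem_sym :: "'i set \<Rightarrow> nat \<Rightarrow> ('i \<Rightarrow> 'a::comm_ring_1) \<Rightarrow> 'a" where
  "elem_sym I i x = (\<Sum>S | S \<subseteq> I \<and> card S = i. \<Prod>l\<in>S. x l)"

definition param_poly :: "nat \<Rightarrow> (nat \<Rightarrow> complex) \<Rightarrow> complex poly" where
  "param_poly d v =
     (let c = (\<lambda>i. (-1) ^ i * (of_nat d / of_nat (d - i)) * elem_sym {1..d-1} i v)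
      in monom 1 d + (\<Sum>i=2..d-1. monom (c i) (d - i))
         + [:- (v 1 ^ d) - (\<Sum>i=2..d-1. c i * v 1 ^ (d - i)) + v d:])"

definition param_map :: "nat \<Rightarrow> (nat \<Rightarrow> complex) \<Rightarrow> (complex poly \<times> complex) set" where
  "param_map d v = moduli_class d (param_poly d v, v 1)"

text \<open>
  The parameter map is surjective onto the moduli space, and its fibres are the orbits of the
  finite group \<open>G\<close> generated by the permutations of \<open>\<alpha>\<^sub>2, \<dots>, \<alpha>\<^sub>d\<^sub>-\<^sub>1\<close> and the scalars \<open>\<zeta>\<close> with
  \<open>\<zeta>\<^sup>d\<^sup>-\<^sup>1 = 1\<close>. Hence this is the quotient topology on the affine variety \<open>V / G\<close>, where \<open>V\<close> is
  the parameter space.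
\<close>

definition moduli_topology :: "nat \<Rightarrow> (complex poly \<times> complex) set topology" where
  "moduli_topology d =
     quotient_topology (subtopology (zariski {1..d}) (param_space d)) (param_map d) (moduli_space d)"

text \<open>
  Both conditions are invariant under affine conjugation, so it does not matter which
  representative of a class is used.
\<close>

definition preperiodic_locus :: "nat \<Rightarrow> nat \<Rightarrow> nat \<Rightarrow> nat \<Rightarrow> (complex poly \<times> complex) set set" where
  "preperiodic_locus d k n j = {c \<in> moduli_space d. \<exists>(f, \<alpha>) \<in> c.
     strictly_preperiodic (poly f) k n \<alpha> \<and> ramification_index f \<alpha> = j}"

end

theory Submission
  imports Defs
    "HOL-Computational_Algebra.Polynomial_Factorial"
    "HOL-Computational_Algebra.Field_as_Ring"
    "HOL-Computational_Algebra.Fundamental_Theorem_Algebra"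
    "HOL-Combinatorics.Permutations"
begin

text \<open>
  Translate the marked critical point to \<open>0\<close>. A polynomial of degree \<open>p\<close> whose marked critical point has
  multiplicity \<open>j - 1\<close> becomes \<open>F(z) = b + (\<Sum>i=j..p. c\<^sub>i * z ^ i)\<close> with \<open>c\<^sub>p = 1\<close>, where the \<open>c\<^sub>i\<close> are polynomials in
  the remaining critical points \<open>x\<^sub>j, \<dots>, x\<^sub>p\<^sub>-\<^sub>1\<close>. So \<open>(x, b)\<close> are coordinates on a linear subspace of the
  parameter space, of dimension \<open>p - j + 1\<close>. Let \<open>z\<^sub>l = F\<^sup>l(0)\<close>. For \<open>k \<ge> 1\<close> the difference \<open>z\<^sub>k\<^sub>+\<^sub>1 - z\<^sub>k\<close>
  factors as \<open>(z\<^sub>k - z\<^sub>k\<^sub>-\<^sub>1) * b ^ (j - 1) * G\<close> (lemma \<open>orb_step\<close>), and the locus is the image of the set of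
  all \<open>(x, b)\<close> with \<open>G = 0\<close>, \<open>z\<^sub>k \<noteq> z\<^sub>k\<^sub>-\<^sub>1\<close> and all \<open>x\<^sub>l \<noteq> 0\<close> (\<open>preperiodic_locus_eq\<close>); for \<open>k = 0\<close> the equation
  is \<open>b = 0\<close>. The polynomial \<open>G\<close> is monic in \<open>b\<close>.

  \<^emph>\<open>Irreducibility.\<close> Here the primality of the degree enters. Let \<open>x\<^sub>j = N * t\<close> and let the other \<open>x\<^sub>l\<close> be
  integers \<open>N * l\<close>, where \<open>N = (p - 1)!\<close>. Then \<open>G\<close> has integer coefficients and \<open>p\<close> divides every \<open>c\<^sub>i\<close> with
  \<open>i < p\<close>, so that \<open>F \<equiv> z ^ p + b\<close> and \<open>G\<close> is a power of \<open>b\<close> modulo \<open>p\<close>. The value of \<open>G\<close> at \<open>b = 0\<close> is \<open>c\<^sub>j\<close> or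
  \<open>j * c\<^sub>j\<close>, a multiple \<open>c * t\<close> of \<open>t\<close> with \<open>p\<close> dividing \<open>c\<close> exactly once. By Eisenstein \<open>G\<close> is irreducible over
  \<open>\<int>[t]\<close> (\<open>prep_irreducible_int\<close>). The curve \<open>G = 0\<close> has the origin as a rational point with
  \<open>\<partial>G / \<partial>t \<noteq> 0\<close>, and an irreducible curve with a smooth rational point remains irreducible over \<open>\<complex>\<close>
  (\<open>absolutely_irreducible\<close>). This uses \<open>j < p\<close>: in the unicritical case no variable \<open>t\<close> is left.

  To pass from this curve to all \<open>x\<close>, let the other \<open>x\<^sub>l\<close> be polynomials in a further variable \<open>r\<close> that
  take the values above at \<open>r = 0\<close>. Since \<open>G\<close> is monic and irreducible at \<open>r = 0\<close>, it is irreducible in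
  \<open>\<complex>[r, t, b]\<close>, hence prime, and a polynomial that vanishes on the surface \<open>G = 0\<close> is a multiple of \<open>G\<close>
  (\<open>prime_monic_nullstellensatz\<close>). Any two points lie on one such surface, and therefore a product
  of two polynomials vanishes on the whole set only if one factor does (\<open>slice_irreducible\<close>).

  \<^emph>\<open>Dimension.\<close> Polynomials on the parameter space that are invariant under the finite group separate the
  closed subsets of the moduli space. Choosing, for a chain of irreducible closed sets, an invariant
  polynomial that vanishes on each member but not on the next produces algebraically independent
  functions (\<open>chain_independent\<close>), whereas any \<open>p - j + 1\<close> functions are dependent on \<open>G = 0\<close>, because \<open>b\<close> is
  integral over the \<open>p - j\<close> variables \<open>x\<^sub>l\<close> (\<open>stratum_alg_dependent\<close>). Conversely, fixing more and more of
  the \<open>x\<^sub>l\<close> at pairwise inequivalent values gives a chain of length \<open>p - j\<close> (\<open>krull_dim_locus_ge\<close>).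
\<close>

section \<open>Ring maps and evaluation of polynomials\<close>

locale ring_map =
  fixes h :: "'a::comm_ring_1 \<Rightarrow> 'b::comm_ring_1"
  assumes zero [simp]: "h 0 = 0" and one [simp]: "h 1 = 1"
    and add [simp]: "h (x + y) = h x + h y" and mult [simp]: "h (x * y) = h x * h y"
begin

lemma uminus [simp]: "h (- x) = - h x"
  using add[of x "- x"] by (simp add: eq_neg_iff_add_eq_0 add.commute)

lemma diff [simp]: "h (x - y) = h x - h y"
  using add[of x "- y"] by simp

lemma power [simp]: "h (x ^ n) = h x ^ n"
  by (induction n) auto

lemma sum [simp]: "h (\<Sum>i\<in>A. f i) = (\<Sum>i\<in>A. h (f i))"
  by (induction A rule: infinite_finite_induct) auto

lemma prod [simp]: "h (\<Prod>i\<in>A. f i) = (\<Prod>i\<in>A. h (f i))"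
  by (induction A rule: infinite_finite_induct) auto

lemma of_nat [simp]: "h (of_nat n) = of_nat n"
  by (induction n) auto

lemma map_poly_ring_map: "ring_map (map_poly h)"
proof
  show add: "map_poly h (p + q) = map_poly h p + map_poly h q" for p q
    by (intro poly_eqI) (simp add: coeff_map_poly)
  show "map_poly h (p * q) = map_poly h p * map_poly h q" for p q
    by (intro poly_eqI) (simp add: coeff_map_poly coeff_mult)
qed auto

end

text \<open>
  Evaluation at \<open>x\<close> of a polynomial whose coefficients are first mapped by \<open>h\<close>. Iterated, it evaluates
  nested polynomials such as elements of \<open>\<complex>[r][t][b]\<close>.
\<close>

definition heval :: "('a::comm_ring_1 \<Rightarrow> 'b::comm_ring_1) \<Rightarrow> 'b \<Rightarrow> 'a poly \<Rightarrow> 'b" where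
  "heval h x P = poly (map_poly h P) x"

lemma ring_map_comp: "ring_map g \<Longrightarrow> ring_map h \<Longrightarrow> ring_map (\<lambda>x. g (h x))"
  by (simp add: ring_map_def)

lemma ring_map_poly: "ring_map (\<lambda>P. poly P x)"
  by unfold_locales auto

lemma ring_map_pcompose: "ring_map (\<lambda>P. pcompose P q)"
  by unfold_locales (auto simp: pcompose_add pcompose_mult pcompose_1)

lemma ring_map_const: "ring_map (\<lambda>a. [:a:])"
  by unfold_locales (auto simp: pCons_one)

lemma ring_map_heval: "ring_map h \<Longrightarrow> ring_map (heval h x)"
  unfolding heval_def
  using ring_map_comp[OF ring_map_poly[of x] ring_map.map_poly_ring_map] by blast

lemma heval_pCons [simp]: "ring_map h \<Longrightarrow> heval h x (pCons a P) = h a + x * heval h x P"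
  by (simp add: heval_def map_poly_pCons ring_map.zero)

lemma heval_0 [simp]: "heval h x 0 = 0"
  by (simp add: heval_def)

lemma ring_map_of_int: "ring_map (of_int :: int \<Rightarrow> 'a::comm_ring_1)"
  by unfold_locales auto

lemma ring_map_of_rat: "ring_map (of_rat :: rat \<Rightarrow> 'a::field_char_0)"
  by unfold_locales (auto simp: of_rat_add of_rat_mult)

text \<open>
  The factors of a monic polynomial have unit leading coefficients, so specialising the coefficients
  keeps their degrees and turns a proper factorisation into a proper one.
\<close>

lemma irreducible_monic_specialise:
  fixes G :: "'a::idom poly" and h :: "'a \<Rightarrow> 'b::idom"
  assumes "ring_map h" "lead_coeff G = 1" "irreducible (map_poly h G)"
  shows "irreducible G"
proof (rule irreducibleI)
  interpret ring_map h by fact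
  interpret M: ring_map "map_poly h" by (rule map_poly_ring_map)
  have unit: "A dvd 1" if AB: "G = A * B" and u: "map_poly h A dvd 1" for A B
  proof -
    have lc: "lead_coeff A * lead_coeff B = 1"
      using AB assms(2) by (metis lead_coeff_mult)
    then have "h (lead_coeff A) * h (lead_coeff B) = 1"
      by (metis mult one)
    then have "h (lead_coeff A) \<noteq> 0" by auto
    then have "degree (map_poly h A) = degree A"
      by (simp add: map_poly_degree_eq)
    moreover have "degree (map_poly h A) = 0"
      using u by (auto simp: is_unit_poly_iff)
    ultimately obtain a where a: "A = [:a:]"
      by (metis degree_eq_zeroE)
    with lc show ?thesis
      by (metis dvd_triv_left is_unit_const_poly_iff lead_coeff_pCons(2))
  qed
  show "G \<noteq> 0" using assms(2) by auto
  show "\<not> G dvd 1"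
    using assms(3) M.mult M.one
    by (metis dvd_def irreducible_not_unit)
  fix A B assume AB: "G = A * B"
  then have "map_poly h G = map_poly h A * map_poly h B" by simp
  with assms(3) have "map_poly h A dvd 1 \<or> map_poly h B dvd 1"
    using irreducibleD by blast
  then show "A dvd 1 \<or> B dvd 1"
    using unit[of A B] unit[of B A] AB by (auto simp: mult.commute)
qed

section \<open>Prime polynomials\<close>

text \<open>
  Over the fraction field this is the Bezout identity for coprime polynomials, with denominators cleared.
  A nonzero element \<open>P\<close> of least degree of the ideal generated by \<open>G\<close> and \<open>S\<close> divides a constant multiple
  of \<open>G\<close>; as \<open>G\<close> is prime and \<open>deg P < deg G\<close>, this forces \<open>deg P = 0\<close>.
\<close>

lemma prime_elem_bezout:
  fixes G S :: "'a::idom poly"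
  assumes G: "prime_elem G" and S: "S \<noteq> 0" "degree S < degree G"
  shows "\<exists>U V r. r \<noteq> 0 \<and> U * G + V * S = [:r:]"
proof -
  define I where "I = {U * G + V * S | U V. True}"
  have I_sub: "P - Q \<in> I" if PQ: "P \<in> I" "Q \<in> I" for P Q
  proof -
    obtain U V U' V' where "P = U * G + V * S" "Q = U' * G + V' * S"
      using PQ unfolding I_def by blast
    then have "P - Q = (U - U') * G + (V - V') * S" by (simp add: algebra_simps)
    then show ?thesis unfolding I_def by blast
  qed
  have I_mult: "C * P \<in> I" if PQ: "P \<in> I" for P C
  proof -
    obtain U V where "P = U * G + V * S"
      using PQ unfolding I_def by blast
    then have "C * P = (C * U) * G + (C * V) * S" by (simp add: algebra_simps)
    then show ?thesis unfolding I_def by blast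
  qed
  have "G = 1 * G + 0 * S" "S = 0 * G + 1 * S" by auto
  then have GI: "G \<in> I" and SI: "S \<in> I" unfolding I_def by blast+
  define P where "P = (ARG_MIN degree P. P \<in> I \<and> P \<noteq> 0)"
  have P: "P \<in> I" "P \<noteq> 0" and min: "\<And>Q. Q \<in> I \<Longrightarrow> Q \<noteq> 0 \<Longrightarrow> degree P \<le> degree Q"
    using arg_min_nat_lemma[of "\<lambda>P. P \<in> I \<and> P \<noteq> 0" S degree] SI S(1)
    unfolding P_def by auto
  obtain a Q R where a: "a \<noteq> 0" and eq: "smult a G = P * Q + R" and R: "R = 0 \<or> degree R < degree P"
    using pseudo_mod[OF P(2), of G] by metis
  have "R = [:a:] * G - Q * P" using eq by simp
  then have "R \<in> I" by (simp only: I_sub[OF I_mult[OF GI] I_mult[OF P(1)]])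
  with R min[of R] have "R = 0" by fastforce
  with eq have eq: "smult a G = P * Q" by simp
  have "degree P = 0"
  proof (rule ccontr)
    assume dP: "degree P \<noteq> 0"
    have "G dvd P * Q" by (metis eq dvd_smult dvd_refl)
    with G have "G dvd P \<or> G dvd Q" by (simp add: prime_elem_dvd_mult_iff)
    moreover have "degree P < degree G" using min[OF SI S(1)] S(2) by simp
    moreover have "Q \<noteq> 0" using eq a G by auto
    moreover have "degree G = degree P + degree Q"
      using eq a P(2) \<open>Q \<noteq> 0\<close> by (metis degree_mult_eq degree_smult_eq)
    ultimately show False
      using dP P(2) dvd_imp_degree_le[of G P] dvd_imp_degree_le[of G Q] by auto
  qed
  then obtain r where "P = [:r:]" by (metis degree_eq_zeroE)
  with P have "r \<noteq> 0" "[:r:] \<in> I" by auto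
  then show ?thesis unfolding I_def mem_Collect_eq by metis
qed

text \<open>
  A Nullstellensatz for hypersurfaces that are finite over their base. The maps in \<open>E\<close> are the points of
  the base. The remainder \<open>S\<close> of \<open>P\<close> modulo \<open>G\<close> vanishes where \<open>G\<close> does; if it were not zero, a Bezout
  relation \<open>U * G + V * S = r\<close> would make \<open>r\<close> vanish at every point, since \<open>G\<close> has a root over each.
\<close>

lemma prime_monic_nullstellensatz:
  fixes G P :: "'a::idom poly" and E :: "('a \<Rightarrow> complex) set"
  assumes G: "prime_elem G" "lead_coeff G = 1" "degree G > 0"
    and E: "\<And>h. h \<in> E \<Longrightarrow> ring_map h" "\<And>r. r \<noteq> 0 \<Longrightarrow> \<exists>h\<in>E. h r \<noteq> 0"
    and van: "\<And>h b. h \<in> E \<Longrightarrow> heval h b G = 0 \<Longrightarrow> heval h b P = 0"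
  shows "G dvd P"
proof (rule ccontr)
  assume ndvd: "\<not> G dvd P"
  obtain Q S where QS: "pseudo_divmod P G = (Q, S)" by fastforce
  have G0: "G \<noteq> 0" using G by auto
  have eq: "P = G * Q + S" and S: "S = 0 \<or> degree S < degree G"
    using pseudo_divmod[OF G0 QS] G(2) by auto
  have "S \<noteq> 0" using ndvd eq by auto
  with prime_elem_bezout[OF G(1), of S] S obtain U V r where r: "r \<noteq> 0"
    and bez: "U * G + V * S = [:r:]" by auto
  obtain h where h: "h \<in> E" "h r \<noteq> 0" using E(2)[OF r] by blast
  interpret ring_map h by (rule E(1)) fact
  have "degree (map_poly h G) = degree G"
    using G(2) by (intro map_poly_degree_eq) simp
  then have "\<not> constant (poly (map_poly h G))"
    using G(3) by (simp add: constant_degree)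
  then obtain b where b: "poly (map_poly h G) b = 0"
    using fundamental_theorem_of_algebra by blast
  interpret ev: ring_map "heval h b" by (intro ring_map_heval ring_map_axioms)
  have Gb: "heval h b G = 0" using b by (simp add: heval_def)
  then have "heval h b S = 0"
    using van[OF h(1)] eq by (metis add_0 ev.add ev.mult mult_zero_left)
  with Gb have "heval h b [:r:] = 0"
    by (metis bez add_0 ev.add ev.mult mult_zero_right)
  then show False using h(2) ring_map_axioms by simp
qed

text \<open>
  Modulo the prime \<open>q\<close> the product is a monomial, so its factors are monomials. Used both for the
  Eisenstein criterion and to pass from the orbit difference to its factor \<open>G\<close>.
\<close>

lemma prime_dvd_lower_coeffs:
  fixes A B :: "'a::idom poly"
  assumes q: "prime_elem q" and lc: "\<not> q dvd lead_coeff A" "\<not> q dvd lead_coeff B"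
    and low: "\<And>n. n < degree A + degree B \<Longrightarrow> q dvd coeff (A * B) n"
  shows "\<forall>i<degree A. q dvd coeff A i"
proof -
  define i where "i = (LEAST i. \<not> q dvd coeff A i)"
  define l where "l = (LEAST l. \<not> q dvd coeff B l)"
  have i: "\<not> q dvd coeff A i" "\<And>n. n < i \<Longrightarrow> q dvd coeff A n" "i \<le> degree A"
    unfolding i_def using LeastI[of "\<lambda>i. \<not> q dvd coeff A i", OF lc(1)] not_less_Least
      Least_le[of "\<lambda>i. \<not> q dvd coeff A i", OF lc(1)] by auto
  have l: "\<not> q dvd coeff B l" "\<And>n. n < l \<Longrightarrow> q dvd coeff B n" "l \<le> degree B"
    unfolding l_def using LeastI[of "\<lambda>i. \<not> q dvd coeff B i", OF lc(2)] not_less_Least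
      Least_le[of "\<lambda>i. \<not> q dvd coeff B i", OF lc(2)] by auto
  have "coeff (A * B) (i + l) = coeff A i * coeff B l
      + (\<Sum>n\<in>{..i + l} - {i}. coeff A n * coeff B (i + l - n))"
    unfolding coeff_mult by (subst sum.remove[of _ i]) auto
  moreover have "q dvd (\<Sum>n\<in>{..i + l} - {i}. coeff A n * coeff B (i + l - n))"
  proof (rule dvd_sum)
    fix n assume n: "n \<in> {..i + l} - {i}"
    show "q dvd coeff A n * coeff B (i + l - n)"
    proof (cases "n < i")
      case False
      then have "i + l - n < l" using n by auto
      then show ?thesis using l(2) by simp
    qed (use i(2) in simp)
  qed
  moreover have "\<not> q dvd coeff A i * coeff B l"
    using i(1) l(1) q by (simp add: prime_elem_dvd_mult_iff)
  ultimately have "\<not> q dvd coeff (A * B) (i + l)"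
    by (simp only: dvd_add_left_iff not_False_eq_True)
  with low[of "i + l"] have "i + l \<ge> degree A + degree B" by (meson not_le)
  with i(3) l(3) have "i = degree A" by simp
  with i(2) show ?thesis by blast
qed

lemma eisenstein_monic:
  fixes G :: "'a::idom poly"
  assumes q: "prime_elem q" and G: "lead_coeff G = 1" "degree G > 0"
    and low: "\<And>n. n < degree G \<Longrightarrow> q dvd coeff G n" and c: "\<not> q ^ 2 dvd coeff G 0"
  shows "irreducible G"
proof (rule irreducibleI)
  show "G \<noteq> 0" using G by auto
  show "\<not> G dvd 1" using G(2) by (auto simp: is_unit_poly_iff)
  fix A B assume AB: "G = A * B"
  then have lc: "lead_coeff A * lead_coeff B = 1" using G(1) by (metis lead_coeff_mult)
  have unit: "lead_coeff A dvd 1" "lead_coeff B dvd 1"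
    using dvd_triv_left[of "lead_coeff A" "lead_coeff B"]
      dvd_triv_right[of "lead_coeff B" "lead_coeff A"] lc by simp_all
  then have nd: "\<not> q dvd lead_coeff A" "\<not> q dvd lead_coeff B"
    using q by (meson dvd_trans prime_elem_not_unit)+
  have "A \<noteq> 0" "B \<noteq> 0" using AB G by auto
  then have deg: "degree G = degree A + degree B" using AB by (simp add: degree_mult_eq)
  have lowA: "\<forall>i<degree A. q dvd coeff A i"
    using prime_dvd_lower_coeffs[OF q nd] low AB deg by auto
  have lowB: "\<forall>i<degree B. q dvd coeff B i"
    using prime_dvd_lower_coeffs[OF q nd(2,1)] low AB deg by (auto simp: mult.commute add.commute)
  have "degree A = 0 \<or> degree B = 0"
  proof (rule ccontr)
    assume "\<not> ?thesis"
    then have "q dvd coeff A 0" "q dvd coeff B 0" using lowA lowB by auto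
    then have "q ^ 2 dvd coeff A 0 * coeff B 0" unfolding power2_eq_square by (rule mult_dvd_mono)
    with c AB show False by (simp add: coeff_mult)
  qed
  then show "A dvd 1 \<or> B dvd 1"
    using unit by (metis degree_eq_zeroE is_unit_const_poly_iff lead_coeff_pCons(2))
qed

lemma monic_factors_of_reducible:
  fixes G :: "'a::idom poly"
  assumes G: "lead_coeff G = 1" "degree G > 0" and red: "\<not> irreducible G"
  obtains A B where "G = A * B" "lead_coeff A = 1" "lead_coeff B = 1"
    "0 < degree A" "0 < degree B"
proof -
  have "G \<noteq> 0" "\<not> G dvd 1" using G by (auto simp: is_unit_poly_iff)
  with red obtain A B where AB: "G = A * B" "\<not> A dvd 1" "\<not> B dvd 1"
    by (auto simp: irreducible_def)
  have lc: "lead_coeff A * lead_coeff B = 1" using G(1) AB by (metis lead_coeff_mult)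
  have unit: "lead_coeff A dvd 1" "lead_coeff B dvd 1"
    using dvd_triv_left[of "lead_coeff A" "lead_coeff B"]
      dvd_triv_right[of "lead_coeff B" "lead_coeff A"] lc by simp_all
  have nz: "A \<noteq> 0" "B \<noteq> 0" using lc by auto
  show ?thesis
  proof
    show "G = smult (lead_coeff B) A * smult (lead_coeff A) B"
      using AB lc by (simp add: mult.commute)
    show "lead_coeff (smult (lead_coeff B) A) = 1" "lead_coeff (smult (lead_coeff A) B) = 1"
      using lc nz by (simp_all add: mult.commute)
    have "degree A \<noteq> 0" "degree B \<noteq> 0"
      using AB unit by (metis degree_eq_zeroE is_unit_const_poly_iff lead_coeff_pCons(2))+
    then show "0 < degree (smult (lead_coeff B) A)" "0 < degree (smult (lead_coeff A) B)"
      using nz by auto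
  qed
qed

section \<open>Descent from the complex numbers to the rationals\<close>

text \<open>
  A linear projection from the complex numbers onto the rationals. Applied to the coefficients of a
  polynomial, it preserves rational linear relations between them; it serves as a substitute for
  taking Galois conjugates.
\<close>

lemma rational_projection:
  "\<exists>\<pi> :: complex \<Rightarrow> rat. \<pi> 1 = 1 \<and> (\<forall>x y. \<pi> (x + y) = \<pi> x + \<pi> y) \<and>
     (\<forall>q x. \<pi> (of_rat q * x) = q * \<pi> x)"
proof -
  interpret vector_space_pair "\<lambda>(q::rat) (z::complex). of_rat q * z" "\<lambda>(q::rat) (x::rat). q * x"
    by unfold_locales (auto simp: algebra_simps of_rat_add of_rat_mult)
  have "vs1.independent {1}" by (simp add: vs1.dependent_single)
  from linear_independent_extend[OF this, of "\<lambda>_. 1"]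
  obtain g where "Vector_Spaces.linear (\<lambda>(q::rat) (z::complex). of_rat q * z) (\<lambda>(q::rat) (x::rat). q * x) g" "g 1 = 1"
    by auto
  then interpret lin: Vector_Spaces.linear "\<lambda>(q::rat) (z::complex). of_rat q * z" "\<lambda>(q::rat) (x::rat). q * x" g
    by blast
  show ?thesis using \<open>g 1 = 1\<close> lin.add lin.scale by blast
qed

text \<open>
  Substitution of \<open>\<phi>\<close> for the inner variable \<open>t\<close>; the outer variable becomes the variable of \<open>\<phi>\<close>. If
  \<open>G(t, b) = 0\<close> is a plane curve, this is \<open>G(\<phi>(b), b)\<close>.
\<close>

definition subst2 :: "'a::comm_ring_1 poly \<Rightarrow> 'a poly poly \<Rightarrow> 'a poly" where
  "subst2 \<phi> = heval (\<lambda>c. pcompose c \<phi>) [:0, 1:]"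

lemma ring_map_subst2: "ring_map (subst2 \<phi>)"
  unfolding subst2_def by (intro ring_map_heval ring_map_pcompose)

lemma subst2_0 [simp]: "subst2 \<phi> 0 = 0"
  by (simp add: subst2_def)

lemma subst2_pCons [simp]: "subst2 \<phi> (pCons a P) = pcompose a \<phi> + [:0, 1:] * subst2 \<phi> P"
  unfolding subst2_def by (intro heval_pCons ring_map_pcompose)

lemma poly_subst2_0: "poly \<phi> 0 = 0 \<Longrightarrow> poly (subst2 \<phi> P) 0 = poly (coeff P 0) 0"
  by (cases P) (simp add: poly_pcompose)

lemma pcompose_diff_dvd: "(\<phi> - \<psi>) dvd (pcompose a \<phi> - pcompose a \<psi> :: 'a::comm_ring_1 poly)"
proof (induction a)
  case (pCons a P)
  have "pcompose (pCons a P) \<phi> - pcompose (pCons a P) \<psi>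
      = \<phi> * (pcompose P \<phi> - pcompose P \<psi>) + (\<phi> - \<psi>) * pcompose P \<psi>"
    by (simp add: pcompose_pCons algebra_simps)
  then show ?case using pCons.IH by simp
qed simp

lemma subst2_diff_dvd: "(\<phi> - \<psi>) dvd (subst2 \<phi> P - subst2 \<psi> P)"
proof (induction P)
  case (pCons a P)
  have "subst2 \<phi> (pCons a P) - subst2 \<psi> (pCons a P)
      = (pcompose a \<phi> - pcompose a \<psi>) + [:0, 1:] * (subst2 \<phi> P - subst2 \<psi> P)"
    by (simp add: algebra_simps)
  then show ?case using pCons.IH by (simp only: dvd_add dvd_mult pcompose_diff_dvd)
qed simp

lemma (in ring_map) map_poly_pcompose:
  "map_poly h (pcompose a \<phi>) = pcompose (map_poly h a) (map_poly h \<phi>)"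
proof (induction a)
  case (pCons a P)
  interpret M: ring_map "map_poly h" by (rule map_poly_ring_map)
  show ?case using pCons by (simp add: pcompose_pCons map_poly_pCons)
qed simp

lemma (in ring_map) map_poly_subst2:
  "map_poly h (subst2 \<phi> P) = subst2 (map_poly h \<phi>) (map_poly (map_poly h) P)"
proof (induction P)
  case (pCons a P)
  interpret M: ring_map "map_poly h" by (rule map_poly_ring_map)
  have "map_poly h [:0, 1:] = [:0, 1:]" by (simp add: map_poly_pCons)
  then show ?case using pCons by (simp add: map_poly_pCons map_poly_pcompose del: mult_pCons_left)
qed simp

text \<open>
  Successive approximations to the power series solution \<open>t = \<phi>(b)\<close> of \<open>c * t + b * P(t, b) = 0\<close>, obtained
  by iterating \<open>\<phi> \<mapsto> - b * P(\<phi>, b) / c\<close>, which is a contraction for the \<open>b\<close>-adic distance.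
\<close>

primrec branch :: "'a::field \<Rightarrow> 'a poly poly \<Rightarrow> nat \<Rightarrow> 'a poly" where
  "branch c P 0 = 0"
| "branch c P (Suc n) = smult (- inverse c) ([:0, 1:] * subst2 (branch c P n) P)"

lemma poly_branch_0 [simp]: "poly (branch c P n) 0 = 0"
  by (cases n) auto

lemma branch_step: "[:0, 1:] ^ Suc n dvd branch c P (Suc n) - branch c P n"
proof (induction n)
  case (Suc n)
  have "branch c P (Suc (Suc n)) - branch c P (Suc n)
      = smult (- inverse c) ([:0, 1:] * (subst2 (branch c P (Suc n)) P - subst2 (branch c P n) P))"
    by (simp only: branch.simps(2) smult_diff_right right_diff_distrib)
  moreover have "[:0, 1:] ^ Suc n dvd subst2 (branch c P (Suc n)) P - subst2 (branch c P n) P"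
    using Suc subst2_diff_dvd dvd_trans by blast
  then have "[:0, 1:] ^ Suc (Suc n) dvd
      [:0, 1:] * (subst2 (branch c P (Suc n)) P - subst2 (branch c P n) P)"
    by (subst power_Suc) (intro mult_dvd_mono dvd_refl)
  ultimately show ?case using dvd_smult by metis
next
  case 0
  have "[:0, 1:] dvd smult (- inverse c) ([:0, 1:] * subst2 0 P)"
    by (intro dvd_smult dvd_triv_left)
  then show ?case by (simp del: mult_pCons_left)
qed

lemma branch_root:
  assumes "c \<noteq> 0"
  shows "[:0, 1:] ^ Suc n dvd subst2 (branch c P n) (pCons [:0, c:] P)"
proof -
  have "subst2 (branch c P n) (pCons [:0, c:] P) = smult (- c) (branch c P (Suc n) - branch c P n)"
    using assms by (simp add: pcompose_pCons smult_diff_right)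
  then show ?thesis using branch_step dvd_smult by metis
qed

lemma X_power_dvd_mult_cancel:
  fixes A B :: "'a::idom poly"
  assumes "[:0, 1:] ^ n dvd A * B" "poly A 0 \<noteq> 0"
  shows "[:0, 1:] ^ n dvd B"
proof (cases "B = 0")
  case False
  have A: "A \<noteq> 0" using assms(2) by auto
  then have "n \<le> order 0 (A * B)"
    using assms(1) False order_divides[of 0 n "A * B"] by simp
  also have "order 0 (A * B) = order 0 B"
    using A False assms(2) by (simp add: order_mult order_0I)
  finally show ?thesis using order_divides[of 0 n B] by simp
qed simp

lemma order_power_eq: "(p :: 'a::idom poly) \<noteq> 0 \<Longrightarrow> order a (p ^ m) = m * order a p"
  by (induction m) (auto simp: order_mult)

lemma clear_denominators_rat_poly:
  "\<exists>N P'. N \<noteq> 0 \<and> map_poly of_int P' = smult (of_int N) (P :: rat poly)"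
proof (induction P)
  case 0
  have "map_poly of_int 0 = smult (of_int 1) (0 :: rat poly)" by simp
  then show ?case using one_neq_zero by blast
next
  case (pCons a P)
  then obtain N P' where N: "N \<noteq> 0" "map_poly of_int P' = smult (of_int N) P" by blast
  obtain x y where a: "a = of_int x / of_int y" "y \<noteq> 0"
    using quotient_of_div[of a "fst (quotient_of a)" "snd (quotient_of a)"] quotient_of_denom_pos'[of a]
    by (metis less_irrefl prod.collapse)
  have "map_poly of_int (pCons (N * x) (smult y P')) = smult (of_int (N * y)) (pCons a P)"
    using N(2) a by (simp add: map_poly_pCons map_poly_smult mult.commute)
  moreover have "N * y \<noteq> 0" using N a by simp
  ultimately show ?case by blast
qed

lemma clear_denominators:
  "\<exists>N P'. N \<noteq> 0 \<and> map_poly (map_poly of_int) P' = smult [:of_int N:] (P :: rat poly poly)"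
proof (induction P)
  case 0
  have "map_poly (map_poly of_int) 0 = smult [:of_int 1:] (0 :: rat poly poly)" by simp
  then show ?case using one_neq_zero by blast
next
  case (pCons a P)
  then obtain N P' where N: "N \<noteq> 0" "map_poly (map_poly of_int) P' = smult [:of_int N:] P" by blast
  obtain y a' where a: "y \<noteq> 0" "map_poly of_int a' = smult (of_int y) a"
    using clear_denominators_rat_poly by blast
  interpret i: ring_map "of_int :: int \<Rightarrow> rat" by (rule ring_map_of_int)
  interpret ip: ring_map "map_poly (of_int :: int \<Rightarrow> rat)" by (rule i.map_poly_ring_map)
  have "map_poly (map_poly of_int) (pCons (smult N a') (smult [:y:] P')) = smult [:of_int (N * y):] (pCons a P)"
    using N(2) a by (simp add: map_poly_pCons map_poly_smult mult.commute)
  moreover have "N * y \<noteq> 0" using N a by simp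
  ultimately show ?case by blast
qed

text \<open>
  Near the origin the curve \<open>G = 0\<close> is the graph of a power series \<open>t = \<phi>(b)\<close> with rational coefficients.
  Suppose \<open>G = A * B\<close> over \<open>\<complex>\<close> with \<open>A\<close> nonzero at the origin. Then \<open>B\<close> vanishes along \<open>\<phi>\<close>. This is a system
  of rational linear conditions on the coefficients of \<open>B\<close>, so the image of \<open>B\<close> under a rational projection
  vanishes along \<open>\<phi>\<close> as well; it is monic of smaller degree than \<open>G\<close> in \<open>b\<close> and rational. A Bezout
  relation with the prime \<open>G\<close> then gives a nonzero polynomial \<open>r(t)\<close> with \<open>r(\<phi>(b)) = 0\<close>, but \<open>\<phi>\<close> is not
  constant. Truncating \<open>\<phi>\<close> at high order avoids power series.
\<close>

lemma absolutely_irreducible: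
  fixes G :: "int poly poly"
  assumes G: "prime_elem G" "lead_coeff G = 1" "degree G > 0"
    and c: "coeff G 0 = [:0, c:]" "c \<noteq> 0"
  shows "irreducible (map_poly (map_poly of_int) G :: complex poly poly)"
proof (rule ccontr)
  define GR :: "rat poly poly" where "GR = map_poly (map_poly of_int) G"
  define GC :: "complex poly poly" where "GC = map_poly (map_poly of_int) G"
  interpret ir: ring_map "of_int :: int \<Rightarrow> rat" by (rule ring_map_of_int)
  interpret irp: ring_map "map_poly (of_int :: int \<Rightarrow> rat)" by (rule ir.map_poly_ring_map)
  interpret irpp: ring_map "map_poly (map_poly (of_int :: int \<Rightarrow> rat))" by (rule irp.map_poly_ring_map)
  interpret rc: ring_map "of_rat :: rat \<Rightarrow> complex" by (rule ring_map_of_rat)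
  interpret rcp: ring_map "map_poly (of_rat :: rat \<Rightarrow> complex)" by (rule rc.map_poly_ring_map)
  have GC_GR: "GC = map_poly (map_poly of_rat) GR"
    unfolding GC_def GR_def by (simp add: map_poly_map_poly comp_def)
  obtain P where P: "GR = pCons [:0, of_int c:] P"
  proof -
    obtain P0 where "G = pCons [:0, c:] P0" using c by (metis pCons_cases coeff_pCons_0)
    then have "GR = pCons [:0, of_int c:] (map_poly (map_poly of_int) P0)"
      by (simp add: GR_def map_poly_pCons)
    then show ?thesis by (rule that)
  qed
  define \<phi> where "\<phi> = branch (of_int c) P"
  have \<phi>: "[:0, 1:] ^ Suc n dvd subst2 (\<phi> n) GR" for n
    unfolding \<phi>_def P using c by (intro branch_root) simp
  have \<phi>0: "poly (\<phi> n) 0 = 0" for n by (simp add: \<phi>_def)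
  have degR: "degree GR = degree G" "lead_coeff GR = 1"
    using G(2) unfolding GR_def by (simp_all add: map_poly_degree_eq coeff_map_poly)
  have degC: "degree GC = degree G" "lead_coeff GC = 1"
    using G(2) unfolding GC_def by (simp_all add: map_poly_degree_eq coeff_map_poly)
  have main: False if AB: "GC = A * B" "lead_coeff B = 1" "degree B < degree G"
    and A0: "poly (coeff A 0) 0 \<noteq> 0" for A B :: "complex poly poly"
  proof -
    have subB: "[:0, 1:] ^ Suc n dvd subst2 (map_poly of_rat (\<phi> n)) B" for n
    proof -
      interpret s: ring_map "subst2 (map_poly of_rat (\<phi> n) :: complex poly)" by (rule ring_map_subst2)
      have "map_poly of_rat ([:0, 1:] ^ Suc n) dvd (map_poly of_rat (subst2 (\<phi> n) GR) :: complex poly)"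
        using \<phi>[of n] by (metis dvd_def rcp.mult)
      then have "[:0, 1:] ^ Suc n dvd (map_poly of_rat (subst2 (\<phi> n) GR) :: complex poly)"
        by (simp only: rcp.power) (simp add: map_poly_pCons)
      also have "map_poly of_rat (subst2 (\<phi> n) GR) = subst2 (map_poly of_rat (\<phi> n)) GC"
        by (simp add: rc.map_poly_subst2 GC_GR)
      also have "\<dots> = subst2 (map_poly of_rat (\<phi> n)) A * subst2 (map_poly of_rat (\<phi> n)) B"
        by (simp add: AB(1))
      finally show ?thesis
      proof (rule X_power_dvd_mult_cancel)
        have "poly (map_poly of_rat (\<phi> n)) 0 = (0 :: complex)"
          using \<phi>0[of n] by (simp add: poly_0_coeff_0 coeff_map_poly)
        then show "poly (subst2 (map_poly of_rat (\<phi> n)) A) 0 \<noteq> 0"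
          using A0 by (simp add: poly_subst2_0)
      qed
    qed
    obtain \<pi> :: "complex \<Rightarrow> rat" where \<pi>1: "\<pi> 1 = 1" and \<pi>_add: "\<And>x y. \<pi> (x + y) = \<pi> x + \<pi> y"
      and \<pi>_scale: "\<And>q x. \<pi> (of_rat q * x) = q * \<pi> x"
      using rational_projection by blast
    have \<pi>0 [simp]: "\<pi> 0 = 0" using \<pi>_add[of 0 0] by simp
    have \<pi>_sum: "\<pi> (\<Sum>i\<in>S. f i) = (\<Sum>i\<in>S. \<pi> (f i))" for S :: "nat set" and f
      by (induction S rule: infinite_finite_induct) (auto simp: \<pi>_add)
    have m_add: "map_poly \<pi> (a + b) = map_poly \<pi> a + map_poly \<pi> b" for a b
      by (intro poly_eqI) (simp add: coeff_map_poly \<pi>_add)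
    have m_mult: "map_poly \<pi> (map_poly of_rat a * b) = a * map_poly \<pi> b" for a b
      by (intro poly_eqI) (simp add: coeff_map_poly coeff_mult \<pi>_sum \<pi>_scale)
    have m_X: "map_poly \<pi> ([:0, 1:] * b) = [:0, 1:] * map_poly \<pi> b" for b
      using m_mult[of "[:0, 1:]" b] by (simp add: map_poly_pCons)
    have m_comp: "map_poly \<pi> (pcompose a (map_poly of_rat \<psi>)) = pcompose (map_poly \<pi> a) \<psi>" for a \<psi>
    proof (induction a)
      case (pCons a P)
      then show ?case by (simp add: pcompose_pCons m_add m_mult map_poly_pCons)
    qed simp
    have m_subst: "map_poly \<pi> (subst2 (map_poly of_rat \<psi>) Q) = subst2 \<psi> (map_poly (map_poly \<pi>) Q)" for \<psi> Q
    proof (induction Q)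
      case (pCons a Q)
      then show ?case by (simp add: m_add m_X m_comp map_poly_pCons del: mult_pCons_left)
    qed simp
    define B1 where "B1 = map_poly (map_poly \<pi>) B"
    have subB1: "[:0, 1:] ^ n dvd subst2 (\<phi> n) B1" for n
    proof -
      have "[:0, 1:] ^ n dvd subst2 (map_poly of_rat (\<phi> n)) B"
        using subB[of n] by (metis dvd_trans le_imp_power_dvd le_SucI order_refl)
      then obtain Q where "subst2 (map_poly of_rat (\<phi> n)) B = [:0, 1:] ^ n * Q" by (rule dvdE)
      then have "subst2 (map_poly of_rat (\<phi> n)) B = map_poly of_rat ([:0, 1:] ^ n) * Q"
        by (simp add: map_poly_pCons)
      then have "subst2 (\<phi> n) B1 = [:0, 1:] ^ n * map_poly \<pi> Q"
        unfolding B1_def m_subst[symmetric] by (simp only: m_mult)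
      then show ?thesis by simp
    qed
    have B1: "coeff B1 (degree B) = 1" "degree B1 \<le> degree B"
      unfolding B1_def using AB(2) by (simp_all add: coeff_map_poly \<pi>1 map_poly_degree_leq)
    obtain N B2 where N: "N \<noteq> 0" and B2: "map_poly (map_poly of_int) B2 = smult [:of_int N:] B1"
      using clear_denominators by blast
    have "map_poly (map_poly of_int) B2 \<noteq> (0 :: rat poly poly)"
      using N B2 B1(1) by auto
    then have "B2 \<noteq> 0" by auto
    moreover have "degree B2 < degree G"
    proof -
      have "degree B2 = degree (map_poly (map_poly of_int) B2 :: rat poly poly)"
        by (rule degree_map_poly[symmetric]) (simp add: map_poly_eq_0_iff)
      also have "\<dots> \<le> degree B1" unfolding B2 by (rule degree_smult_le)
      finally show ?thesis using B1(2) AB(3) by simp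
    qed
    ultimately obtain U V r where r: "r \<noteq> 0" and bez: "U * G + V * B2 = [:r:]"
      using prime_elem_bezout[OF G(1)] by blast
    define rR :: "rat poly" where "rR = map_poly of_int r"
    have rR: "rR \<noteq> 0" using r by (simp add: rR_def map_poly_eq_0_iff)
    have sub_r: "[:0, 1:] ^ n dvd pcompose rR (\<phi> n)" for n
    proof -
      interpret s: ring_map "subst2 (\<phi> n)" by (rule ring_map_subst2)
      have "map_poly (map_poly of_int) U * GR + map_poly (map_poly of_int) V * smult [:of_int N:] B1 = [:rR:]"
        using arg_cong[OF bez, of "map_poly (map_poly (of_int :: int \<Rightarrow> rat))"] B2
        by (simp add: GR_def rR_def map_poly_pCons)
      then have eq: "[:rR:] = map_poly (map_poly of_int) U * GR
          + map_poly (map_poly of_int) V * [:[:of_int N:]:] * B1"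
        by simp
      have "subst2 (\<phi> n) [:rR:] = subst2 (\<phi> n) (map_poly (map_poly of_int) U) * subst2 (\<phi> n) GR
          + subst2 (\<phi> n) (map_poly (map_poly of_int) V * [:[:of_int N:]:]) * subst2 (\<phi> n) B1"
        by (simp only: eq s.add s.mult)
      moreover have "[:0, 1:] ^ n dvd subst2 (\<phi> n) GR"
        using \<phi>[of n] by (metis dvd_trans le_imp_power_dvd le_SucI order_refl)
      ultimately have "[:0, 1:] ^ n dvd subst2 (\<phi> n) [:rR:]"
        using subB1[of n] by (metis dvd_add dvd_mult)
      then show ?thesis by simp
    qed
    obtain r1 where r1: "rR = [:0, 1:] ^ order 0 rR * r1" "poly r1 0 \<noteq> 0"
      using order_decomp[OF rR, of 0] by (auto simp: poly_eq_0_iff_dvd)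
    define M where "M = degree G"
    define m where "m = order 0 rR"
    \<comment> \<open>The order of \<open>r(\<phi>(b))\<close> is at most \<open>m * M\<close>, so an approximation to this order is contradictory.\<close>
    define n where "n = Suc (m * M + M)"
    have "pcompose rR (\<phi> n) = \<phi> n ^ m * pcompose r1 (\<phi> n)"
    proof -
      interpret p: ring_map "\<lambda>P. pcompose P (\<phi> n)" by (rule ring_map_pcompose)
      have "pcompose rR (\<phi> n) = pcompose ([:0, 1:] ^ m * r1) (\<phi> n)"
        using r1(1) m_def by simp
      also have "\<dots> = pcompose [:0, 1:] (\<phi> n) ^ m * pcompose r1 (\<phi> n)"
        by (simp only: p.mult p.power)
      finally show ?thesis by (simp add: pcompose_pCons)
    qed
    then have "[:0, 1:] ^ n dvd pcompose r1 (\<phi> n) * \<phi> n ^ m"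
      using sub_r[of n] by (metis mult.commute)
    then have "[:0, 1:] ^ n dvd \<phi> n ^ m"
      by (rule X_power_dvd_mult_cancel) (simp only: poly_pcompose \<phi>0 r1(2) not_False_eq_True)
    moreover have ndvd: "\<not> [:0, 1:] ^ Suc M dvd \<phi> n"
    proof
      assume *: "[:0, 1:] ^ Suc M dvd \<phi> n"
      then have "[:0, 1:] ^ Suc M dvd subst2 (\<phi> n) GR - subst2 0 GR"
        using subst2_diff_dvd[of "\<phi> n" 0 GR] by (metis diff_zero dvd_trans)
      moreover have "[:0, 1:] ^ Suc M dvd subst2 (\<phi> n) GR"
        using \<phi>[of n] by (rule dvd_trans[rotated]) (intro le_imp_power_dvd, simp add: n_def)
      ultimately have dvd: "[:0, 1:] ^ Suc M dvd subst2 0 GR"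
        using dvd_diff[of "[:0, 1:] ^ Suc M" "subst2 (\<phi> n) GR" "subst2 (\<phi> n) GR - subst2 0 GR"] by simp
      have sub0: "subst2 0 Q = map_poly (\<lambda>a. poly a 0) Q" for Q :: "rat poly poly"
        by (induction Q) (simp_all add: map_poly_pCons pcompose_0' poly_0_coeff_0)
      have coeff: "coeff (subst2 0 GR) M = 1"
        using degR by (simp add: sub0 coeff_map_poly M_def)
      then have "subst2 0 GR \<noteq> 0" by auto
      then have "degree ([:0, 1::rat:] ^ Suc M) \<le> degree (subst2 0 GR)"
        by (rule dvd_imp_degree_le[OF dvd])
      moreover have "degree (subst2 0 GR) \<le> M"
        unfolding sub0 using map_poly_degree_leq[of "\<lambda>a. poly a 0" GR] degR M_def by simp
      ultimately show False by (simp add: degree_power_eq)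
    qed
    ultimately have dvd_n: "[:0, 1:] ^ n dvd \<phi> n ^ m" and ndvd: "\<not> [:0, 1:] ^ Suc M dvd \<phi> n"
      by blast+
    have nz: "\<phi> n \<noteq> 0" using ndvd by (metis dvd_0_right)
    then have "n \<le> order 0 (\<phi> n ^ m)"
      using order_divides[of 0 n "\<phi> n ^ m"] dvd_n by simp
    then have "n \<le> m * order 0 (\<phi> n)"
      by (simp only: order_power_eq[OF nz])
    moreover have "order 0 (\<phi> n) \<le> M"
      using ndvd order_divides[of 0 "Suc M" "\<phi> n"] nz by simp
    ultimately have "n \<le> m * M" by (meson le_trans mult_le_mono2)
    then show False by (simp add: n_def)
  qed
  assume "\<not> irreducible (map_poly (map_poly of_int) G :: complex poly poly)"
  then obtain A B where AB: "GC = A * B" "lead_coeff A = 1" "lead_coeff B = 1" "0 < degree A" "0 < degree B"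
    using monic_factors_of_reducible[of GC] degC G(3) unfolding GC_def by metis
  then have "A \<noteq> 0" "B \<noteq> 0" by auto
  then have deg: "degree G = degree A + degree B"
    using AB(1) degC by (metis degree_mult_eq)
  have "coeff A 0 * coeff B 0 = [:0, of_int c:]"
    using AB(1) c(1) by (metis GC_def coeff_map_poly coeff_mult_0 map_poly_pCons map_poly_0 of_int_0
        add.right_neutral pCons_0_0)
  then have "coeff (coeff A 0) 0 * coeff (coeff B 0) 1 + coeff (coeff A 0) 1 * coeff (coeff B 0) 0 = of_int c"
    using coeff_mult[of "coeff A 0" "coeff B 0" 1] by simp
  then have "coeff (coeff A 0) 0 \<noteq> 0 \<or> coeff (coeff B 0) 0 \<noteq> 0"
    using c(2) by auto
  then show False
    using main[of A B] main[of B A] AB deg by (auto simp: poly_0_coeff_0 mult.commute)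
qed

section \<open>The critical orbit\<close>

text \<open>
  The orbit of \<open>0\<close> under \<open>z \<mapsto> b + (\<Sum>i=j..p. cs i * z ^ i)\<close>. The ring is arbitrary because the orbit is
  needed over \<open>\<complex>\<close>, over \<open>\<int>[t][b]\<close> and over \<open>\<complex>[r][t][b]\<close>.
\<close>

primrec orb :: "nat \<Rightarrow> nat \<Rightarrow> (nat \<Rightarrow> 'a::comm_ring_1) \<Rightarrow> 'a \<Rightarrow> nat \<Rightarrow> 'a" where
  "orb j p cs b 0 = 0"
| "orb j p cs b (Suc l) = b + (\<Sum>i=j..p. cs i * orb j p cs b l ^ i)"

text \<open>
  The orbit divided by \<open>b\<close>, see \<open>orb_scaled\<close>.
\<close>

primrec scaled_orb :: "nat \<Rightarrow> nat \<Rightarrow> (nat \<Rightarrow> 'a::comm_ring_1) \<Rightarrow> 'a \<Rightarrow> nat \<Rightarrow> 'a" where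
  "scaled_orb j p cs b 0 = 0"
| "scaled_orb j p cs b (Suc l) = 1 + (\<Sum>i=j..p. cs i * b ^ (i - 1) * scaled_orb j p cs b l ^ i)"

text \<open>
  Nonzero exactly when none of the orbit points before the \<open>k\<close>-th is fixed; the value \<open>1\<close> for \<open>k = 0\<close> makes
  this condition empty there.
\<close>

definition gap :: "nat \<Rightarrow> nat \<Rightarrow> (nat \<Rightarrow> 'a::comm_ring_1) \<Rightarrow> 'a \<Rightarrow> nat \<Rightarrow> 'a" where
  "gap j p cs b k = (if k = 0 then 1 else orb j p cs b k - orb j p cs b (k - 1))"

text \<open>
  The equation of the locus: what remains of \<open>orb (k + 1) - orb k\<close> after division by \<open>gap k\<close> and by the
  power \<open>b ^ (j - 1)\<close>. The inner sum is \<open>(u ^ i - v ^ i) / (u - v)\<close> for \<open>u\<close>, \<open>v\<close> the scaled orbit points.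
\<close>

definition prep :: "nat \<Rightarrow> nat \<Rightarrow> (nat \<Rightarrow> 'a::comm_ring_1) \<Rightarrow> 'a \<Rightarrow> nat \<Rightarrow> 'a" where
  "prep j p cs b k = (if k = 0 then b else
     (\<Sum>i=j..p. cs i * b ^ (i - j) *
        (\<Sum>a<i. scaled_orb j p cs b k ^ a * scaled_orb j p cs b (k - 1) ^ (i - Suc a))))"

lemma orb_scaled: "1 \<le> j \<Longrightarrow> orb j p cs b l = b * scaled_orb j p cs b l"
proof (induction l)
  case (Suc l)
  have "cs i * (b * scaled_orb j p cs b l) ^ i = b * (cs i * b ^ (i - 1) * scaled_orb j p cs b l ^ i)"
    if "i \<in> {j..p}" for i
    using that Suc.prems by (cases i) (auto simp: power_mult_distrib algebra_simps)
  then show ?case using Suc by (simp add: distrib_left sum_distrib_left)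
qed simp

lemma orb_step:
  assumes "1 \<le> j" "1 \<le> k"
  shows "orb j p cs b (Suc k) - orb j p cs b k = prep j p cs b k * (gap j p cs b k * b ^ (j - 1))"
proof -
  let ?x = "\<lambda>l. orb j p cs b l" and ?y = "\<lambda>l. scaled_orb j p cs b l"
  obtain m where k: "k = Suc m" using assms(2) by (cases k) auto
  have tm: "cs i * ?x (Suc m) ^ i - cs i * ?x m ^ i
      = (cs i * b ^ (i - j) * (\<Sum>a<i. ?y (Suc m) ^ a * ?y m ^ (i - Suc a)))
        * ((?x (Suc m) - ?x m) * b ^ (j - 1))" if i: "i \<in> {j..p}" for i
  proof -
    have "?x (Suc m) ^ i - ?x m ^ i
        = (?x (Suc m) - ?x m) * (\<Sum>a<i. ?x m ^ (i - Suc a) * ?x (Suc m) ^ a)"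
      by (rule power_diff_sumr2)
    also have "(\<Sum>a<i. ?x m ^ (i - Suc a) * ?x (Suc m) ^ a)
        = (\<Sum>a<i. b ^ (i - j) * b ^ (j - 1) * (?y (Suc m) ^ a * ?y m ^ (i - Suc a)))"
    proof (rule sum.cong[OF refl])
      fix a assume a: "a \<in> {..<i}"
      have "b ^ (i - Suc a) * b ^ a = b ^ (i - j) * b ^ (j - 1)"
        unfolding power_add[symmetric] using a i assms(1) by (intro arg_cong[of _ _ "\<lambda>n. b ^ n"]) auto
      moreover have "?x m ^ (i - Suc a) * ?x (Suc m) ^ a
          = b ^ (i - Suc a) * b ^ a * (?y (Suc m) ^ a * ?y m ^ (i - Suc a))"
        unfolding orb_scaled[OF assms(1)] power_mult_distrib by (simp only: mult_ac)
      ultimately show "?x m ^ (i - Suc a) * ?x (Suc m) ^ a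
          = b ^ (i - j) * b ^ (j - 1) * (?y (Suc m) ^ a * ?y m ^ (i - Suc a))"
        by (simp only:)
    qed
    also have "\<dots> = b ^ (i - j) * b ^ (j - 1) * (\<Sum>a<i. ?y (Suc m) ^ a * ?y m ^ (i - Suc a))"
      by (simp only: sum_distrib_left)
    finally have "?x (Suc m) ^ i - ?x m ^ i = (?x (Suc m) - ?x m)
        * (b ^ (i - j) * b ^ (j - 1) * (\<Sum>a<i. ?y (Suc m) ^ a * ?y m ^ (i - Suc a)))" .
    then show ?thesis unfolding right_diff_distrib[symmetric] by (simp only: mult_ac)
  qed
  have "?x (Suc k) - ?x k = (\<Sum>i=j..p. cs i * ?x (Suc m) ^ i - cs i * ?x m ^ i)"
    unfolding k by (simp only: orb.simps sum_subtractf) simp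
  also have "\<dots> = (\<Sum>i=j..p. (cs i * b ^ (i - j) * (\<Sum>a<i. ?y (Suc m) ^ a * ?y m ^ (i - Suc a)))
        * ((?x (Suc m) - ?x m) * b ^ (j - 1)))"
    by (intro sum.cong refl tm)
  also have "\<dots> = prep j p cs b k * (gap j p cs b k * b ^ (j - 1))"
    by (simp add: k prep_def gap_def sum_distrib_right del: orb.simps scaled_orb.simps)
  finally show ?thesis .
qed

lemma orb_eq_iff_prep:
  fixes b :: "'a::idom"
  assumes "1 \<le> j" "gap j p cs b k \<noteq> 0"
  shows "orb j p cs b (Suc k) = orb j p cs b k \<longleftrightarrow> prep j p cs b k = 0"
proof (cases "k = 0")
  case True
  have "(\<Sum>i=j..p. cs i * 0 ^ i) = 0" using assms(1) by (intro sum.neutral) (auto simp: power_0_left)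
  then show ?thesis using True by (simp add: prep_def)
next
  case False
  then have "b \<noteq> 0" using assms by (auto simp: gap_def orb_scaled)
  then show ?thesis using orb_step[of j k p cs b] assms False by auto
qed

lemma strictly_preperiodic_iff_prep:
  fixes b :: "'a::idom"
  assumes j: "1 \<le> j" and orb: "\<And>l. (g ^^ l) x = a + orb j p cs b l"
  shows "strictly_preperiodic g k 1 x \<longleftrightarrow> prep j p cs b k = 0 \<and> gap j p cs b k \<noteq> 0"
proof -
  let ?x = "\<lambda>l. orb j p cs b l"
  have stay: "?x (Suc n) = ?x n" if "?x (Suc l) = ?x l" "l \<le> n" for l n
    using that(2,1) by (induction rule: dec_induct) auto
  have "strictly_preperiodic g k 1 x \<longleftrightarrow> ?x (Suc k) = ?x k \<and> (\<forall>l<k. ?x (Suc l) \<noteq> ?x l)"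
  proof -
    have "(\<forall>l\<in>{0..k}. \<forall>m\<in>{1..1}. (l, m) \<noteq> (k, 1) \<longrightarrow> (g ^^ (l + m)) x \<noteq> (g ^^ l) x)
        \<longleftrightarrow> (\<forall>l<k. (g ^^ (l + 1)) x \<noteq> (g ^^ l) x)"
      by (auto simp del: funpow.simps)
    then show ?thesis
      unfolding strictly_preperiodic_def orb by (simp del: orb.simps)
  qed
  also have "(\<forall>l<k. ?x (Suc l) \<noteq> ?x l) \<longleftrightarrow> gap j p cs b k \<noteq> 0"
  proof (cases k)
    case (Suc m)
    have "(\<forall>l<Suc m. ?x (Suc l) \<noteq> ?x l) \<longleftrightarrow> ?x (Suc m) \<noteq> ?x m"
      using stay less_Suc_eq_le by blast
    then show ?thesis by (simp add: gap_def Suc del: orb.simps)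
  qed (simp add: gap_def)
  also have "?x (Suc k) = ?x k \<and> gap j p cs b k \<noteq> 0 \<longleftrightarrow> prep j p cs b k = 0 \<and> gap j p cs b k \<noteq> 0"
    using orb_eq_iff_prep[OF j] by blast
  finally show ?thesis .
qed

context ring_map begin

lemma orb: "h (orb j p cs b l) = orb j p (\<lambda>i. h (cs i)) (h b) l"
  by (induction l) auto

lemma scaled_orb: "h (scaled_orb j p cs b l) = scaled_orb j p (\<lambda>i. h (cs i)) (h b) l"
  by (induction l) auto

lemma gap: "h (gap j p cs b k) = gap j p (\<lambda>i. h (cs i)) (h b) k"
  by (auto simp: gap_def orb)

lemma prep: "h (prep j p cs b k) = prep j p (\<lambda>i. h (cs i)) (h b) k"
  by (auto simp: prep_def scaled_orb)

end

lemma monic_add_lower: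
  assumes "lead_coeff A = 1" "degree B < degree A"
  shows "degree (A + B) = degree A" "lead_coeff (A + B) = 1"
  using assms by (simp_all add: degree_add_eq_left coeff_eq_0)

lemma orb_monic:
  fixes cs :: "nat \<Rightarrow> 'a::idom"
  assumes "1 \<le> j" "j \<le> p" "2 \<le> p" "cs p = 1"
  defines "x \<equiv> orb j p (\<lambda>i. [:cs i:]) [:0, 1:]"
  shows "degree (x (Suc l)) = p ^ l \<and> lead_coeff (x (Suc l)) = 1"
proof (induction l)
  case 0
  have "(\<Sum>i=j..p. [:cs i:] * 0 ^ i) = 0" using assms(1) by (intro sum.neutral) (auto simp: power_0_left)
  then show ?case by (simp add: x_def)
next
  case (Suc l)
  define y where "y = x (Suc l)"
  have y: "degree y = p ^ l" "lead_coeff y = 1" using Suc by (auto simp: y_def)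
  have yp: "degree (y ^ p) = p * p ^ l" "lead_coeff (y ^ p) = 1"
    using y lead_coeff_power[of y p] by (auto simp: degree_power_eq simp flip: leading_coeff_0_iff)
  have "x (Suc (Suc l)) = [:0, 1:] + (\<Sum>i=j..p. [:cs i:] * y ^ i)"
    unfolding x_def y_def by (rule orb.simps(2))
  also have "(\<Sum>i=j..p. [:cs i:] * y ^ i) = y ^ p + (\<Sum>i=j..<p. [:cs i:] * y ^ i)"
    using assms(2,4) by (simp add: sum.last_plus flip: atLeastLessThanSuc_atLeastAtMost)
  finally have eq: "x (Suc (Suc l)) = y ^ p + ([:0, 1:] + (\<Sum>i=j..<p. [:cs i:] * y ^ i))"
    by (simp add: algebra_simps)
  have pl: "p ^ l \<ge> 1" using assms(3) by simp
  have "degree ([:0, 1:] + (\<Sum>i=j..<p. [:cs i:] * y ^ i)) \<le> (p - 1) * p ^ l"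
  proof (intro degree_add_le degree_sum_le)
    show "degree [:0, 1 :: 'a:] \<le> (p - 1) * p ^ l"
      using assms(3) pl by (simp add: Suc_le_eq)
    fix i assume i: "i \<in> {j..<p}"
    have "degree ([:cs i:] * y ^ i) \<le> degree (y ^ i)" by simp
    also have "\<dots> \<le> i * p ^ l" using y degree_power_le[of y i] by (simp add: mult.commute)
    also have "\<dots> \<le> (p - 1) * p ^ l" using i by (intro mult_le_mono1) auto
    finally show "degree ([:cs i:] * y ^ i) \<le> (p - 1) * p ^ l" .
  qed simp
  also have "\<dots> < p * p ^ l" using assms(3) pl by simp
  finally have "degree ([:0, 1:] + (\<Sum>i=j..<p. [:cs i:] * y ^ i)) < degree (y ^ p)"
    using yp by simp
  from monic_add_lower[OF yp(2) this] show ?case using yp(1) by (simp add: eq)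
qed

text \<open>
  Degrees in \<open>b\<close>: the orbit points are monic of degree \<open>p ^ (l - 1)\<close>, hence so are their differences, and
  then also the cofactor in \<open>orb_step\<close>.
\<close>

lemma
  fixes cs :: "nat \<Rightarrow> 'a::idom"
  assumes "1 \<le> j" "j \<le> p" "2 \<le> p" "cs p = 1" "1 \<le> k"
  defines "X \<equiv> [:0, 1:]" and "P \<equiv> \<lambda>i. [:cs i:]"
  shows orb_diff_monic: "lead_coeff (orb j p P X (Suc k) - orb j p P X k) = 1"
      "degree (orb j p P X (Suc k) - orb j p P X k) = p ^ k"
    and gap_monic: "lead_coeff (gap j p P X k) = 1" "degree (gap j p P X k) = p ^ (k - 1)"
    and prep_monic: "lead_coeff (prep j p P X k) = 1"
      "degree (prep j p P X k) + (j - 1) + p ^ (k - 1) = p ^ k"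
proof -
  note om = orb_monic[of j p cs, OF assms(1-4), folded X_def P_def]
  have diff: "lead_coeff (orb j p P X (Suc l) - orb j p P X l) = 1 \<and>
      degree (orb j p P X (Suc l) - orb j p P X l) = p ^ l" for l
  proof (cases l)
    case 0
    then show ?thesis using om[of 0] unfolding 0 orb.simps(1) diff_zero by blast
  next
    case (Suc m)
    have "degree (- orb j p P X l) < degree (orb j p P X (Suc l))"
      using om[of m] om[of l] assms(3) by (simp add: Suc del: orb.simps)
    note sum = monic_add_lower[OF om[of l, THEN conjunct2] this, unfolded add_uminus_conv_diff]
    show ?thesis
      by (rule conjI, rule sum(2), rule trans[OF sum(1)], rule om[of l, THEN conjunct1])
  qed
  show d: "lead_coeff (orb j p P X (Suc k) - orb j p P X k) = 1"
      "degree (orb j p P X (Suc k) - orb j p P X k) = p ^ k"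
    by (rule diff[of k, THEN conjunct1], rule diff[of k, THEN conjunct2])
  have g: "lead_coeff (gap j p P X k) = 1 \<and> degree (gap j p P X k) = p ^ (k - 1)"
  proof -
    have eq: "gap j p P X k = orb j p P X (Suc (k - 1)) - orb j p P X (k - 1)"
      using assms(5) by (simp add: gap_def del: orb.simps)
    show ?thesis unfolding eq by (rule diff)
  qed
  show "lead_coeff (gap j p P X k) = 1" "degree (gap j p P X k) = p ^ (k - 1)"
    by (rule g[THEN conjunct1], rule g[THEN conjunct2])
  have Xm: "X ^ (j - 1) = monom 1 (j - 1)" unfolding X_def by (simp add: monom_altdef)
  have gx: "lead_coeff (gap j p P X k * X ^ (j - 1)) = 1"
    "degree (gap j p P X k * X ^ (j - 1)) = p ^ (k - 1) + (j - 1)"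
  proof -
    show lc: "lead_coeff (gap j p P X k * X ^ (j - 1)) = 1"
      unfolding lead_coeff_mult Xm lead_coeff_monom g[THEN conjunct1] by simp
    have "gap j p P X k \<noteq> 0" using g by auto
    then show "degree (gap j p P X k * X ^ (j - 1)) = p ^ (k - 1) + (j - 1)"
      using g unfolding Xm by (subst degree_mult_eq) (auto simp: degree_monom_eq)
  qed
  note st = orb_step[OF assms(1,5), of p P X]
  show "lead_coeff (prep j p P X k) = 1"
    using d(1) unfolding st lead_coeff_mult gx(1)[unfolded lead_coeff_mult] by simp
  then have "prep j p P X k \<noteq> 0" by auto
  moreover have "gap j p P X k * X ^ (j - 1) \<noteq> 0"
    using gx(1) leading_coeff_0_iff zero_neq_one by metis
  ultimately show "degree (prep j p P X k) + (j - 1) + p ^ (k - 1) = p ^ k"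
    using d(2) gx(2) unfolding st by (simp add: degree_mult_eq)
qed

section \<open>Reduction modulo the degree\<close>

text \<open>
  The Frobenius congruence: the inner binomial coefficients are divisible by \<open>p\<close>.
\<close>

lemma prime_dvd_power_diff_power:
  fixes x y :: "'a::comm_ring_1"
  assumes "prime p"
  shows "of_nat p dvd (x + y) ^ p - (x ^ p + y ^ p)"
proof -
  have p: "0 < p" using assms by (simp add: prime_gt_0_nat)
  have "(x + y) ^ p = (\<Sum>i\<le>p. of_nat (p choose i) * x ^ i * y ^ (p - i))"
    by (rule binomial_ring)
  also have "{..p} = insert 0 (insert p {0<..<p})" using p by auto
  also have "(\<Sum>i\<in>insert 0 (insert p {0<..<p}). of_nat (p choose i) * x ^ i * y ^ (p - i))
     = (x ^ p + y ^ p) + (\<Sum>i\<in>{0<..<p}. of_nat (p choose i) * x ^ i * y ^ (p - i))"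
    using p by (simp add: algebra_simps)
  finally have "(x + y) ^ p - (x ^ p + y ^ p) = (\<Sum>i\<in>{0<..<p}. of_nat (p choose i) * x ^ i * y ^ (p - i))"
    by simp
  moreover have "of_nat p dvd (of_nat (p choose i) :: 'a)" if "i \<in> {0<..<p}" for i
  proof -
    have "p dvd (p choose i)" using that assms by (intro dvd_choose_prime) auto
    then show ?thesis by (auto simp: dvd_def)
  qed
  ultimately show ?thesis by (auto intro!: dvd_sum dvd_mult2)
qed

text \<open>
  Modulo \<open>p\<close> the map is \<open>z \<mapsto> z ^ p + b\<close>, so each difference is the \<open>p\<close>-th power of the preceding one.
\<close>

lemma orb_diff_mod_prime:
  fixes cs :: "nat \<Rightarrow> 'a::comm_ring_1"
  assumes p: "prime p" and j: "1 \<le> j" "j \<le> p" and cs: "cs p = 1" "\<And>i. i \<in> {j..<p} \<Longrightarrow> of_nat p dvd cs i"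
  shows "of_nat p dvd orb j p cs b (Suc k) - orb j p cs b k - b ^ (p ^ k)"
proof (induction k)
  case 0
  have "(\<Sum>i=j..p. cs i * 0 ^ i) = 0" using j by (intro sum.neutral) (auto simp: power_0_left)
  then show ?case by simp
next
  case (Suc k)
  define x y where "x = orb j p cs b (Suc k)" and "y = orb j p cs b k"
  have split: "(\<Sum>i=j..p. cs i * z ^ i) = z ^ p + (\<Sum>i=j..<p. cs i * z ^ i)" for z
    using j cs(1) by (simp add: sum.last_plus flip: atLeastLessThanSuc_atLeastAtMost)
  have low: "of_nat p dvd (\<Sum>i=j..<p. cs i * z ^ i)" for z
    using cs(2) by (intro dvd_sum dvd_mult2)
  have eq: "orb j p cs b (Suc (Suc k)) - orb j p cs b (Suc k) - b ^ p ^ Suc k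
      = ((\<Sum>i=j..<p. cs i * x ^ i) - (\<Sum>i=j..<p. cs i * y ^ i))
        + (((x - y) + y) ^ p - ((x - y) ^ p + y ^ p)) + ((x - y) ^ p - (b ^ p ^ k) ^ p)"
  proof -
    have "orb j p cs b (Suc (Suc k)) = b + (\<Sum>i=j..p. cs i * x ^ i)"
      unfolding x_def by (rule orb.simps(2))
    moreover have "orb j p cs b (Suc k) = b + (\<Sum>i=j..p. cs i * y ^ i)"
      unfolding y_def by (rule orb.simps(2))
    ultimately show ?thesis
      by (simp add: split power_mult[symmetric] mult.commute)
  qed
  have "(x - y) - b ^ p ^ k dvd (x - y) ^ p - (b ^ p ^ k) ^ p"
    unfolding power_diff_sumr2[of "x - y" p "b ^ p ^ k"] by (rule dvd_triv_left)
  then have "of_nat p dvd (x - y) ^ p - (b ^ p ^ k) ^ p"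
    using Suc unfolding x_def y_def by (rule dvd_trans[rotated])
  then show ?case
    unfolding eq by (rule dvd_add[OF dvd_add[OF dvd_diff[OF low low] prime_dvd_power_diff_power[OF p]]])
qed

text \<open>
  At \<open>b = 0\<close> all scaled orbit points after the first are \<open>1\<close>, and only the term \<open>i = j\<close> survives. For \<open>k = 1\<close> the
  preceding point is \<open>0\<close> instead of \<open>1\<close>, which explains the case distinction.
\<close>

lemma prep_at_0:
  assumes "2 \<le> j" "j \<le> p" "1 \<le> k"
  shows "prep j p cs 0 k = cs j * of_nat (if k = 1 then 1 else j)"
proof -
  have y: "scaled_orb j p cs 0 (Suc l) = 1" for l
    using assms(1) by (auto intro!: sum.neutral simp: power_0_left)
  obtain m where k: "k = Suc m" using assms(3) by (cases k) auto
  have "prep j p cs 0 k = (\<Sum>i=j..p. cs i * 0 ^ (i - j) *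
      (\<Sum>a<i. scaled_orb j p cs 0 (Suc m) ^ a * scaled_orb j p cs 0 m ^ (i - Suc a)))"
    by (simp add: prep_def k)
  also have "\<dots> = (\<Sum>i\<in>{j}. cs i * 0 ^ (i - j) *
      (\<Sum>a<i. scaled_orb j p cs 0 (Suc m) ^ a * scaled_orb j p cs 0 m ^ (i - Suc a)))"
    using assms(2) by (intro sum.mono_neutral_right) (auto simp: power_0_left)
  also have "\<dots> = cs j * (\<Sum>a<j. scaled_orb j p cs 0 m ^ (j - Suc a))"
    by (simp add: y del: scaled_orb.simps)
  also have "(\<Sum>a<j. scaled_orb j p cs 0 m ^ (j - Suc a)) = of_nat (if k = 1 then 1 else j)"
  proof (cases m)
    case 0
    have "(\<Sum>a<j. (0::'a) ^ (j - Suc a)) = (\<Sum>a\<in>{j - 1}. 1)"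
      using assms(1) by (intro sum.mono_neutral_cong_right) (auto simp: power_0_left split: if_splits)
    then show ?thesis using 0 k by simp
  qed (simp add: k y del: scaled_orb.simps)
  finally show ?thesis .
qed

text \<open>
  The Eisenstein criterion at \<open>p\<close> over \<open>\<int>[t]\<close>. The lower coefficients are divisible by \<open>p\<close> because
  \<open>G\<close> divides a polynomial that is a power of \<open>b\<close> modulo \<open>p\<close>, and the constant coefficient is \<open>c * t\<close> or
  \<open>j * c * t\<close> with \<open>j\<close> prime to \<open>p\<close>.
\<close>

lemma prep_irreducible_int:
  fixes cs :: "nat \<Rightarrow> int poly" and c :: int
  assumes p: "prime p" and j: "2 \<le> j" "j < p" and k: "1 \<le> k"
    and cs: "cs p = 1" "\<And>i. i \<in> {j..<p} \<Longrightarrow> of_nat p dvd cs i" "cs j = [:0, c:]"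
    and c: "\<not> (int p)\<^sup>2 dvd c"
  defines "G \<equiv> prep j p (\<lambda>i. [:cs i:]) [:0, 1:] k"
  shows "irreducible G" "lead_coeff G = 1" "degree G > 0"
    "\<exists>c'. c' \<noteq> 0 \<and> coeff G 0 = [:0, c':]"
proof -
  have two_le_degree: "2 \<le> p" using p by (simp add: prime_ge_2_nat)
  have j': "1 \<le> j" "j \<le> p" using j by auto
  note monic = prep_monic[of j p cs k, OF j' two_le_degree cs(1) k, folded G_def]
  show lc: "lead_coeff G = 1" by (rule monic)
  have "p * p ^ (k - 1) = p ^ k" using k by (simp flip: power_Suc)
  moreover have "(p - 1) * p ^ (k - 1) \<ge> (p - 1) * 1" using two_le_degree by (intro mult_le_mono2) simp
  moreover have "p * p ^ (k - 1) = (p - 1) * p ^ (k - 1) + p ^ (k - 1)"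
    using two_le_degree by (simp add: algebra_simps flip: Suc_diff_1)
  ultimately show deg: "degree G > 0" using monic(2) j by linarith
  define e where "e = (if k = 1 then 1 else j)"
  interpret ev: ring_map "\<lambda>P. poly P (0 :: int poly)" by (rule ring_map_poly)
  have c0: "coeff G 0 = [:0, c * int e:]"
    using ev.prep[of j p "\<lambda>i. [:cs i:]" "[:0, 1:]" k] prep_at_0[OF j(1) j'(2) k, of cs] cs(3)
    by (simp add: G_def e_def poly_0_coeff_0 of_nat_poly)
  have e: "0 < e" "e < p" using j by (auto simp: e_def)
  have c_nz: "c \<noteq> 0" using c by auto
  with c0 e show "\<exists>c'. c' \<noteq> 0 \<and> coeff G 0 = [:0, c':]" by (intro exI[of _ "c * int e"]) simp
  let ?q = "of_nat p :: int poly"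
  have q: "prime_elem ?q"
    using p by (simp add: of_nat_poly prime_elem_const_poly_iff prime_imp_prime_elem)
  have "\<forall>i<degree G. ?q dvd coeff G i"
  proof (rule prime_dvd_lower_coeffs[OF q])
    define B where "B = gap j p (\<lambda>i. [:cs i:]) [:0, 1:] k * [:0, 1:] ^ (j - 1)"
    have GB: "orb j p (\<lambda>i. [:cs i:]) [:0, 1:] (Suc k) - orb j p (\<lambda>i. [:cs i:]) [:0, 1:] k = G * B"
      unfolding B_def G_def by (rule orb_step) (use j' k in auto)
    have "lead_coeff (G * B) = 1" "degree (G * B) = p ^ k"
      unfolding GB[symmetric] by (rule orb_diff_monic; use j' two_le_degree cs k in simp)+
    then have lcB: "lead_coeff B = 1" unfolding lead_coeff_mult lc by simp
    have "G \<noteq> 0" "B \<noteq> 0" using lc lcB by auto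
    then have dB: "degree G + degree B = p ^ k"
      using \<open>degree (G * B) = p ^ k\<close> by (simp add: degree_mult_eq)
    show "\<not> ?q dvd lead_coeff G" "\<not> ?q dvd lead_coeff B"
      unfolding lc lcB using q by auto
    fix n assume n: "n < degree G + degree B"
    have "of_nat p dvd ([:cs i:] :: int poly poly)" if i: "i \<in> {j..<p}" for i
    proof -
      obtain d where "cs i = of_nat p * d" using cs(2)[OF i] by (rule dvdE)
      then have "[:cs i:] = of_nat p * [:d:]" by (simp add: of_nat_poly)
      then show ?thesis by (rule dvdI)
    qed
    then have "of_nat p dvd G * B - [:0, 1:] ^ (p ^ k)"
      unfolding GB[symmetric] using p j' cs(1) by (intro orb_diff_mod_prime) (auto simp: pCons_one)
    then have "[:?q:] dvd G * B - monom 1 (p ^ k)"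
      by (simp add: of_nat_poly monom_altdef)
    then have "?q dvd coeff (G * B - monom 1 (p ^ k)) n"
      using const_poly_dvd_iff by blast
    then show "?q dvd coeff (G * B) n" using n dB by simp
  qed
  moreover have "\<not> ?q ^ 2 dvd coeff G 0"
  proof
    assume "?q ^ 2 dvd coeff G 0"
    then have "[:(int p)\<^sup>2:] dvd [:0, c * int e:]" by (simp add: c0 of_nat_poly power2_eq_square)
    then have "(int p)\<^sup>2 dvd coeff [:0, c * int e:] 1" using const_poly_dvd_iff by blast
    then have "(int p)\<^sup>2 dvd c * int e" by simp
    moreover have "coprime ((int p)\<^sup>2) (int e)"
    proof -
      have "\<not> p dvd e" using e by (auto dest: dvd_imp_le)
      then have "coprime p e" using p by (simp add: prime_imp_coprime)
      then show ?thesis by simp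
    qed
    ultimately show False using c by (simp add: coprime_dvd_mult_left_iff)
  qed
  ultimately show "irreducible G"
    using eisenstein_monic[OF q lc deg] by blast
qed

section \<open>Algebraic dependence\<close>

text \<open>
  Exponent vectors are lists so that the chain argument below can peel off one function at a time.
\<close>

definition exponents :: "nat \<Rightarrow> nat \<Rightarrow> nat list set" where
  "exponents n s = {es. set es \<subseteq> {..s} \<and> length es = n}"

primrec monom_fun :: "('x \<Rightarrow> complex) list \<Rightarrow> nat list \<Rightarrow> 'x \<Rightarrow> complex" where
  "monom_fun [] es = (\<lambda>x. 1)"
| "monom_fun (h # hs) es = (\<lambda>x. h x ^ hd es * monom_fun hs (tl es) x)"

definition alg_dependent :: "('x \<Rightarrow> complex) list \<Rightarrow> 'x set \<Rightarrow> bool" where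
  "alg_dependent hs S \<longleftrightarrow> (\<exists>s c. (\<exists>es\<in>exponents (length hs) s. c es \<noteq> 0) \<and>
     (\<forall>x\<in>S. (\<Sum>es\<in>exponents (length hs) s. c es * monom_fun hs es x) = 0))"

lemma exponents_0 [simp]: "exponents 0 s = {[]}"
  by (auto simp: exponents_def)

lemma exponents_Suc: "exponents (Suc n) s = (\<lambda>(e, es). e # es) ` ({..s} \<times> exponents n s)"
  by (auto simp: exponents_def length_Suc_conv image_iff)

lemma finite_exponents [simp]: "finite (exponents n s)" and card_exponents: "card (exponents n s) = Suc s ^ n"
  by (simp_all add: exponents_def finite_lists_length_eq card_lists_length_eq)

lemma sum_exponents_Suc: "(\<Sum>es\<in>exponents (Suc n) s. f es) = (\<Sum>e\<le>s. \<Sum>es\<in>exponents n s. f (e # es))"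
proof -
  have "inj_on (\<lambda>(e, es). e # es) ({..s} \<times> exponents n s)" by (auto simp: inj_on_def)
  then have "(\<Sum>es\<in>exponents (Suc n) s. f es) = (\<Sum>(e, es)\<in>{..s} \<times> exponents n s. f (e # es))"
    unfolding exponents_Suc by (subst sum.reindex) (auto simp: case_prod_beta)
  then show ?thesis by (simp add: sum.cartesian_product)
qed

lemma alg_dependent_subset: "alg_dependent hs S \<Longrightarrow> T \<subseteq> S \<Longrightarrow> alg_dependent hs T"
  unfolding alg_dependent_def by blast

section \<open>Krull dimension and algebraic independence\<close>

text \<open>
  A ring of complex functions for which zero sets are closed and closed sets are cut out by functions,
  like the regular functions on an affine variety.
\<close>

locale separating_functions =
  fixes X :: "'x topology" and R :: "('x \<Rightarrow> complex) set"
  assumes const: "(\<lambda>x. c) \<in> R"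
    and add: "f \<in> R \<Longrightarrow> g \<in> R \<Longrightarrow> (\<lambda>x. f x + g x) \<in> R"
    and mult: "f \<in> R \<Longrightarrow> g \<in> R \<Longrightarrow> (\<lambda>x. f x * g x) \<in> R"
    and closed_zeros: "f \<in> R \<Longrightarrow> closedin X {x \<in> topspace X. f x = 0}"
    and separate: "closedin X Z \<Longrightarrow> x \<in> topspace X \<Longrightarrow> x \<notin> Z \<Longrightarrow> \<exists>f\<in>R. (\<forall>z\<in>Z. f z = 0) \<and> f x \<noteq> 0"
begin

lemma power: "f \<in> R \<Longrightarrow> (\<lambda>x. f x ^ n) \<in> R"
  by (induction n) (auto intro: const mult)

lemma sum: "(\<And>a. a \<in> A \<Longrightarrow> f a \<in> R) \<Longrightarrow> (\<lambda>x. \<Sum>a\<in>A. f a x) \<in> R"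
  by (induction A rule: infinite_finite_induct) (auto intro: const add)

lemma monom_fun: "set hs \<subseteq> R \<Longrightarrow> monom_fun hs es \<in> R"
  by (induction hs arbitrary: es) (auto intro: const mult power)

lemma irreducible_zero_product:
  assumes Z: "irreduciblein X Z" and fg: "f \<in> R" "g \<in> R" and 0: "\<And>z. z \<in> Z \<Longrightarrow> f z * g z = 0"
  shows "(\<forall>z\<in>Z. f z = 0) \<or> (\<forall>z\<in>Z. g z = 0)"
proof -
  have sub: "Z \<subseteq> topspace X" using Z by (simp add: irreduciblein_def)
  then have top: "topspace (subtopology X Z) = Z" by auto
  define A where "A h = Z \<inter> {x \<in> topspace X. h x = 0}" for h :: "'x \<Rightarrow> complex"
  have cl: "closedin (subtopology X Z) (A h)" if "h \<in> R" for h
    using closed_zeros[OF that] unfolding A_def by (metis closedin_subtopology inf_commute)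
  have "A f \<union> A g = Z" using 0 sub unfolding A_def by auto
  then have "A f = Z \<or> A g = Z"
    using Z cl[OF fg(1)] cl[OF fg(2)] top unfolding irreduciblein_def irreducible_space_def by metis
  then show ?thesis unfolding A_def by blast
qed

text \<open>
  Take \<open>h\<close> vanishing on \<open>Z n\<close> but not on \<open>Z (Suc n)\<close>. In a polynomial relation on \<open>Z (Suc n)\<close> between \<open>h\<close> and
  functions that are independent on \<open>Z n\<close>, the lowest power of \<open>h\<close> cancels because \<open>Z (Suc n)\<close> is irreducible;
  restricted to \<open>Z n\<close>, where \<open>h = 0\<close>, only the coefficient of that power remains, and it is a nontrivial
  relation there.
\<close>

lemma chain_independent:
  assumes "\<forall>i\<le>n. closedin X (Z i) \<and> irreduciblein X (Z i)" "\<forall>i<n. Z i \<subset> Z (Suc i)"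
  shows "\<exists>hs. length hs = n \<and> set hs \<subseteq> R \<and> \<not> alg_dependent hs (Z n)"
  using assms
proof (induction n)
  case 0
  then have "Z 0 \<noteq> {}"
    by (auto simp: irreduciblein_def irreducible_space_def)
  then have "\<not> alg_dependent [] (Z 0)" by (auto simp: alg_dependent_def)
  then show ?case by simp
next
  case (Suc n)
  obtain hs where hs: "length hs = n" "set hs \<subseteq> R" "\<not> alg_dependent hs (Z n)"
    using Suc by (metis le_SucI less_SucI)
  have cl: "closedin X (Z n)" and sub: "Z n \<subset> Z (Suc n)" and irr: "irreduciblein X (Z (Suc n))"
    using Suc.prems by auto
  then obtain x where x: "x \<in> Z (Suc n)" "x \<notin> Z n" by blast
  then have "x \<in> topspace X" using irr by (auto simp: irreduciblein_def)
  then obtain h where h: "h \<in> R" "\<And>z. z \<in> Z n \<Longrightarrow> h z = 0" "h x \<noteq> 0"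
    using separate[OF cl _ x(2)] by blast
  have "\<not> alg_dependent (h # hs) (Z (Suc n))"
  proof
    assume "alg_dependent (h # hs) (Z (Suc n))"
    then obtain s c where c: "\<exists>es\<in>exponents (Suc n) s. c es \<noteq> 0"
      and rel: "\<And>x. x \<in> Z (Suc n) \<Longrightarrow> (\<Sum>es\<in>exponents (Suc n) s. c es * monom_fun (h # hs) es x) = 0"
      unfolding alg_dependent_def using hs(1) by auto
    define q where "q e x = (\<Sum>es\<in>exponents n s. c (e # es) * monom_fun hs es x)" for e x
    have q_R: "q e \<in> R" for e
      unfolding q_def by (intro sum mult const monom_fun hs)
    have rel': "(\<Sum>e\<le>s. h z ^ e * q e z) = 0" if "z \<in> Z (Suc n)" for z
      using rel[OF that] by (simp add: sum_exponents_Suc q_def sum_distrib_left mult_ac)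
    define P where "P e \<longleftrightarrow> e \<le> s \<and> (\<exists>es\<in>exponents n s. c (e # es) \<noteq> 0)" for e
    \<comment> \<open>The lowest power of \<open>h\<close> that occurs in the relation.\<close>
    define i where "i = (LEAST e. P e)"
    have "\<exists>e. P e" using c unfolding P_def exponents_Suc by auto
    then have i: "P i" unfolding i_def by (rule LeastI_ex)
    have below: "q e z = 0" if "e < i" "e \<le> s" for e z
      using not_less_Least[of e P] that unfolding i_def q_def P_def
      by (intro sum.neutral) (auto simp: P_def)
    define T where "T z = (\<Sum>e=i..s. h z ^ (e - i) * q e z)" for z
    have T_R: "T \<in> R" unfolding T_def by (intro sum mult power h(1) q_R)
    have "h z ^ i * T z = 0" if z: "z \<in> Z (Suc n)" for z
    proof -
      have "h z ^ i * T z = (\<Sum>e=i..s. h z ^ e * q e z)"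
        unfolding T_def sum_distrib_left
        by (intro sum.cong refl) (simp add: power_add[symmetric] mult.assoc[symmetric])
      also have "\<dots> = (\<Sum>e\<le>s. h z ^ e * q e z)"
        by (rule sum.mono_neutral_left) (auto simp: below)
      finally show ?thesis using rel'[OF z] by simp
    qed
    then have "(\<forall>z\<in>Z (Suc n). h z ^ i = 0) \<or> (\<forall>z\<in>Z (Suc n). T z = 0)"
      by (intro irreducible_zero_product[OF irr power[OF h(1)] T_R])
    moreover have "h x ^ i \<noteq> 0" using h(3) by simp
    ultimately have T0: "\<forall>z\<in>Z (Suc n). T z = 0" using x(1) by blast
    have "q i z = 0" if z: "z \<in> Z n" for z
    proof -
      have "T z = (\<Sum>e\<in>{i}. h z ^ (e - i) * q e z)"
        unfolding T_def using i h(2)[OF z]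
        by (intro sum.mono_neutral_right) (auto simp: P_def power_0_left)
      then show ?thesis using T0 sub z by auto
    qed
    then have "alg_dependent hs (Z n)"
      unfolding alg_dependent_def hs(1) using i unfolding P_def q_def
      by (intro exI[of _ s] exI[of _ "\<lambda>es. c (i # es)"]) auto
    with hs(3) show False by blast
  qed
  then show ?case using hs h(1) by (intro exI[of _ "h # hs"]) auto
qed

lemma krull_dim_le:
  assumes "\<And>hs. length hs = Suc n \<Longrightarrow> set hs \<subseteq> R \<Longrightarrow> alg_dependent hs (topspace X)"
  shows "krull_dim X \<le> enat n"
  unfolding krull_dim_def
proof (rule Sup_least)
  fix d
  assume "d \<in> {enat n |n. \<exists>Z. (\<forall>i\<le>n. closedin X (Z i) \<and> irreduciblein X (Z i)) \<and> (\<forall>i<n. Z i \<subset> Z (Suc i))}"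
  then obtain m Z where d: "d = enat m" and
    Z: "\<forall>i\<le>m. closedin X (Z i) \<and> irreduciblein X (Z i)" "\<forall>i<m. Z i \<subset> Z (Suc i)" by blast
  have "m \<le> n"
  proof (rule ccontr)
    assume "\<not> m \<le> n"
    then obtain hs where hs: "length hs = Suc n" "set hs \<subseteq> R" "\<not> alg_dependent hs (Z (Suc n))"
      using chain_independent[of "Suc n" Z] Z by auto
    have "Z (Suc n) \<subseteq> topspace X"
      using Z \<open>\<not> m \<le> n\<close> by (simp add: irreduciblein_def)
    with hs assms alg_dependent_subset show False by blast
  qed
  then show "d \<le> enat n" by (simp add: d)
qed

end

section \<open>Counting monomials on a finite extension\<close>

text \<open>
  Gaussian elimination: one equation is used to express one unknown by the others.
\<close>

lemma underdetermined_linear_system: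
  fixes m :: "'a \<Rightarrow> 'b \<Rightarrow> complex"
  assumes "finite B" "finite A" "card B < card A"
  shows "\<exists>d. (\<exists>a\<in>A. d a \<noteq> 0) \<and> (\<forall>b\<in>B. (\<Sum>a\<in>A. d a * m a b) = 0)"
  using assms
proof (induction B arbitrary: A m rule: finite_induct)
  case empty
  then have "A \<noteq> {}" by auto
  then show ?case by (intro exI[of _ "\<lambda>_. 1"]) auto
next
  case (insert b B)
  show ?case
  proof (cases "\<forall>a\<in>A. m a b = 0")
    case True
    have "\<exists>d. (\<exists>a\<in>A. d a \<noteq> 0) \<and> (\<forall>b\<in>B. (\<Sum>a\<in>A. d a * m a b) = 0)"
      by (rule insert.IH) (use insert in auto)
    then obtain d where "\<exists>a\<in>A. d a \<noteq> 0" "\<forall>b\<in>B. (\<Sum>a\<in>A. d a * m a b) = 0" by blast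
    with True show ?thesis by (intro exI[of _ d]) (auto intro: sum.neutral)
  next
    case False
    then obtain a0 where a0: "a0 \<in> A" "m a0 b \<noteq> 0" by blast
    define m' where "m' a \<beta> = m a \<beta> - m a b / m a0 b * m a0 \<beta>" for a \<beta>
    have "card B < card (A - {a0})" using insert a0 by simp
    then have "\<exists>d. (\<exists>a\<in>A - {a0}. d a \<noteq> 0) \<and> (\<forall>\<beta>\<in>B. (\<Sum>a\<in>A - {a0}. d a * m' a \<beta>) = 0)"
      by (intro insert.IH) (use insert in auto)
    then obtain d where d: "\<exists>a\<in>A - {a0}. d a \<noteq> 0" "\<forall>\<beta>\<in>B. (\<Sum>a\<in>A - {a0}. d a * m' a \<beta>) = 0"
      by blast
    define d' where "d' a = (if a = a0 then - (\<Sum>a\<in>A - {a0}. d a * (m a b / m a0 b)) else d a)" for a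
    have eq: "(\<Sum>a\<in>A. d' a * m a \<beta>) = (\<Sum>a\<in>A - {a0}. d a * m' a \<beta>)" for \<beta>
    proof -
      have "(\<Sum>a\<in>A. d' a * m a \<beta>) = d' a0 * m a0 \<beta> + (\<Sum>a\<in>A - {a0}. d' a * m a \<beta>)"
        using a0 insert.prems by (simp add: sum.remove)
      also have "(\<Sum>a\<in>A - {a0}. d' a * m a \<beta>) = (\<Sum>a\<in>A - {a0}. d a * m a \<beta>)"
        by (intro sum.cong) (auto simp: d'_def)
      also have "d' a0 * m a0 \<beta> = - (\<Sum>a\<in>A - {a0}. d a * (m a b / m a0 b * m a0 \<beta>))"
        unfolding d'_def by (simp add: sum_distrib_right mult.assoc)
      finally show ?thesis unfolding m'_def by (simp add: right_diff_distrib sum_subtractf)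
    qed
    have "(\<Sum>a\<in>A. d' a * m a b) = 0" unfolding eq using a0 by (simp add: m'_def)
    moreover have "\<exists>a\<in>A. d' a \<noteq> 0" using d(1) by (auto simp: d'_def)
    ultimately show ?thesis using d(2) eq by (intro exI[of _ d']) auto
  qed
qed

text \<open>
  On \<open>W\<close> the coordinate \<open>b\<close> will satisfy a monic equation of degree \<open>M\<close> over the coordinates in \<open>J\<close>. Polynomial
  functions are then combinations of \<open>1, b, \<dots>, b ^ (M - 1)\<close>, and their growth is governed by \<open>card J\<close>.
\<close>

locale monic_extension =
  fixes W :: "(nat \<Rightarrow> complex) set" and J :: "nat set" and b :: nat and M :: nat
  assumes fin: "finite J" and M: "0 < M"
begin

text \<open>
  Only the values on \<open>W\<close> matter, so that the monic equation for \<open>b\<close> can be used to reduce powers.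
\<close>

definition box :: "nat \<Rightarrow> ((nat \<Rightarrow> complex) \<Rightarrow> complex) set" where
  "box D = {f. \<exists>c. \<forall>x\<in>W. f x = (\<Sum>e\<in>J \<rightarrow>\<^sub>E {..D}. c e * (\<Prod>l\<in>J. x l ^ e l))}"

lemma fin_PiE: "finite (J \<rightarrow>\<^sub>E {..D::nat})"
  using fin by (simp add: finite_PiE)

lemma box_cong: "f \<in> box D \<Longrightarrow> (\<And>x. x \<in> W \<Longrightarrow> f x = g x) \<Longrightarrow> g \<in> box D"
  unfolding box_def by simp

lemma box_add: "f \<in> box D \<Longrightarrow> g \<in> box D \<Longrightarrow> (\<lambda>x. f x + g x) \<in> box D"
  unfolding box_def
proof clarify
  fix c c'
  assume *: "\<forall>x\<in>W. f x = (\<Sum>e\<in>J \<rightarrow>\<^sub>E {..D}. c e * (\<Prod>l\<in>J. x l ^ e l))"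
    "\<forall>x\<in>W. g x = (\<Sum>e\<in>J \<rightarrow>\<^sub>E {..D}. c' e * (\<Prod>l\<in>J. x l ^ e l))"
  show "\<exists>c. \<forall>x\<in>W. f x + g x = (\<Sum>e\<in>J \<rightarrow>\<^sub>E {..D}. c e * (\<Prod>l\<in>J. x l ^ e l))"
    using * by (intro exI[of _ "\<lambda>e. c e + c' e"]) (simp add: distrib_right sum.distrib)
qed

lemma box_monomial:
  assumes "\<And>l. l \<in> J \<Longrightarrow> e l \<le> D"
  shows "(\<lambda>x. a * (\<Prod>l\<in>J. x l ^ e l)) \<in> box D"
proof -
  have "a * (\<Prod>l\<in>J. x l ^ e l) = (\<Sum>e'\<in>J \<rightarrow>\<^sub>E {..D}. (if e' = restrict e J then a else 0) * (\<Prod>l\<in>J. x l ^ e' l))"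
    for x :: "nat \<Rightarrow> complex"
  proof -
    have "restrict e J \<in> J \<rightarrow>\<^sub>E {..D}" using assms by auto
    then have "(\<Sum>e'\<in>J \<rightarrow>\<^sub>E {..D}. (if e' = restrict e J then a else 0) * (\<Prod>l\<in>J. x l ^ e' l))
        = (\<Sum>e'\<in>{restrict e J}. (if e' = restrict e J then a else 0) * (\<Prod>l\<in>J. x l ^ e' l))"
      by (intro sum.mono_neutral_right fin_PiE) auto
    then show ?thesis by simp
  qed
  then show ?thesis unfolding box_def mem_Collect_eq
    by (intro exI[of _ "\<lambda>e'. if e' = restrict e J then a else 0"] ballI)
qed

lemma box_const: "(\<lambda>x. a) \<in> box D"
  using box_monomial[of "\<lambda>_. 0" D a] by simp

lemma box_coord:
  assumes "l \<in> J"
  shows "(\<lambda>x. x l) \<in> box (Suc D)"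
proof -
  have "(\<Prod>m\<in>J. x m ^ (if m = l then 1 else 0)) = x l" for x :: "nat \<Rightarrow> complex"
    using assms fin by (subst prod.remove[of _ l]) (auto intro!: prod.neutral)
  then show ?thesis using box_monomial[of "\<lambda>m. if m = l then 1 else 0" "Suc D" 1] by simp
qed

lemma box_sum: "(\<And>i. i \<in> A \<Longrightarrow> f i \<in> box D) \<Longrightarrow> (\<lambda>x. \<Sum>i\<in>A. f i x) \<in> box D"
  by (induction A rule: infinite_finite_induct) (auto intro: box_const box_add)

lemma box_mult:
  assumes "f \<in> box D" "g \<in> box E"
  shows "(\<lambda>x. f x * g x) \<in> box (D + E)"
proof -
  obtain c c' where *: "\<forall>x\<in>W. f x = (\<Sum>e\<in>J \<rightarrow>\<^sub>E {..D}. c e * (\<Prod>l\<in>J. x l ^ e l))"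
    "\<forall>x\<in>W. g x = (\<Sum>e\<in>J \<rightarrow>\<^sub>E {..E}. c' e * (\<Prod>l\<in>J. x l ^ e l))"
    using assms unfolding box_def by blast
  have "(\<lambda>x. \<Sum>e\<in>J \<rightarrow>\<^sub>E {..D}. \<Sum>e'\<in>J \<rightarrow>\<^sub>E {..E}. (c e * c' e') * (\<Prod>l\<in>J. x l ^ (e l + e' l))) \<in> box (D + E)"
    by (intro box_sum box_monomial) (auto simp: PiE_iff intro!: add_mono)
  then show ?thesis
  proof (rule box_cong)
    fix x assume "x \<in> W"
    then show "(\<Sum>e\<in>J \<rightarrow>\<^sub>E {..D}. \<Sum>e'\<in>J \<rightarrow>\<^sub>E {..E}. (c e * c' e') * (\<Prod>l\<in>J. x l ^ (e l + e' l))) = f x * g x"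
      unfolding *(1)[rule_format, OF \<open>x \<in> W\<close>] *(2)[rule_format, OF \<open>x \<in> W\<close>] sum_product
      by (intro sum.cong refl) (simp add: power_add prod.distrib mult_ac)
  qed
qed

lemma box_mono: "f \<in> box D \<Longrightarrow> D \<le> E \<Longrightarrow> f \<in> box E"
  using box_mult[OF _ box_const[of 1 "E - D"], of f D] by simp

definition ext :: "nat \<Rightarrow> ((nat \<Rightarrow> complex) \<Rightarrow> complex) set" where
  "ext D = {f. \<exists>a. (\<forall>i<M. a i \<in> box D) \<and> (\<forall>x\<in>W. f x = (\<Sum>i<M. a i x * x b ^ i))}"

lemma ext_add: "f \<in> ext D \<Longrightarrow> g \<in> ext D \<Longrightarrow> (\<lambda>x. f x + g x) \<in> ext D"
  unfolding ext_def
proof clarify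
  fix u v
  assume "\<forall>i<M. u i \<in> box D" "\<forall>x\<in>W. f x = (\<Sum>i<M. u i x * x b ^ i)"
    "\<forall>i<M. v i \<in> box D" "\<forall>x\<in>W. g x = (\<Sum>i<M. v i x * x b ^ i)"
  then show "\<exists>a. (\<forall>i<M. a i \<in> box D) \<and> (\<forall>x\<in>W. f x + g x = (\<Sum>i<M. a i x * x b ^ i))"
    by (intro exI[of _ "\<lambda>i x. u i x + v i x"]) (auto intro: box_add simp: distrib_right sum.distrib)
qed

lemma ext_cong: "f \<in> ext D \<Longrightarrow> (\<And>x. x \<in> W \<Longrightarrow> f x = g x) \<Longrightarrow> g \<in> ext D"
  unfolding ext_def by force

lemma ext_mono: "f \<in> ext D \<Longrightarrow> D \<le> E \<Longrightarrow> f \<in> ext E"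
  unfolding ext_def using box_mono by blast

lemma ext_box_mult: "g \<in> box E \<Longrightarrow> f \<in> ext D \<Longrightarrow> (\<lambda>x. g x * f x) \<in> ext (E + D)"
  unfolding ext_def
proof clarify
  fix u
  assume "g \<in> box E" "\<forall>i<M. u i \<in> box D" "\<forall>x\<in>W. f x = (\<Sum>i<M. u i x * x b ^ i)"
  then show "\<exists>a. (\<forall>i<M. a i \<in> box (E + D)) \<and> (\<forall>x\<in>W. g x * f x = (\<Sum>i<M. a i x * x b ^ i))"
    by (intro exI[of _ "\<lambda>i x. g x * u i x"]) (auto intro: box_mult simp: sum_distrib_left mult.assoc)
qed

lemma ext_of_box: "f \<in> box D \<Longrightarrow> f \<in> ext D"
  unfolding ext_def
proof clarify
  assume f: "f \<in> box D"
  have "f x = (\<Sum>i<M. (if i = 0 then f else (\<lambda>x. 0)) x * x b ^ i)" for x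
    using M by (subst sum.remove[of _ 0]) (auto intro!: sum.neutral)
  then show "\<exists>a. (\<forall>i<M. a i \<in> box D) \<and> (\<forall>x\<in>W. f x = (\<Sum>i<M. a i x * x b ^ i))"
    using f by (intro exI[of _ "\<lambda>i. if i = 0 then f else (\<lambda>x. 0)"]) (auto intro: box_const)
qed

lemma ext_sum: "(\<And>i. i \<in> A \<Longrightarrow> f i \<in> ext D) \<Longrightarrow> (\<lambda>x. \<Sum>i\<in>A. f i x) \<in> ext D"
  by (induction A rule: infinite_finite_induct) (auto intro: ext_of_box box_const ext_add)

context
  fixes D0 :: nat and g :: "nat \<Rightarrow> (nat \<Rightarrow> complex) \<Rightarrow> complex"
  assumes g: "\<And>i. i < M \<Longrightarrow> g i \<in> box D0"
    and rel: "\<And>x. x \<in> W \<Longrightarrow> x b ^ M = (\<Sum>i<M. g i x * x b ^ i)"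
begin

text \<open>
  Multiplying by \<open>b\<close> shifts the coefficients; the overflow \<open>b ^ M\<close> is replaced by means of the monic equation.
\<close>

lemma ext_root_mult:
  assumes "f \<in> ext D"
  shows "(\<lambda>x. x b * f x) \<in> ext (D + D0)"
proof -
  obtain u where u: "\<And>i. i < M \<Longrightarrow> u i \<in> box D" "\<And>x. x \<in> W \<Longrightarrow> f x = (\<Sum>i<M. u i x * x b ^ i)"
    using assms unfolding ext_def by blast
  obtain N where N: "M = Suc N" using M by (cases M) auto
  have top: "(\<lambda>x. \<Sum>i<M. g i x * x b ^ i) \<in> ext D0"
    unfolding ext_def using g by blast
  have "(\<lambda>x. \<Sum>i<M. (if i = 0 then (\<lambda>x. 0) else u (i - 1)) x * x b ^ i) \<in> ext D"
    unfolding ext_def using u(1) by (intro CollectI exI[of _ "\<lambda>i. if i = 0 then (\<lambda>x. 0) else u (i - 1)"])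
      (auto intro: box_const)
  moreover have "(\<lambda>x. u N x * (\<Sum>i<M. g i x * x b ^ i)) \<in> ext (D + D0)"
    by (intro ext_box_mult top u(1)) (simp add: N)
  ultimately have "(\<lambda>x. (\<Sum>i<M. (if i = 0 then (\<lambda>x. 0) else u (i - 1)) x * x b ^ i)
      + u N x * (\<Sum>i<M. g i x * x b ^ i)) \<in> ext (D + D0)"
    by (intro ext_add) (auto intro: ext_mono)
  then show ?thesis
  proof (rule ext_cong)
    fix x assume x: "x \<in> W"
    have "x b * f x = (\<Sum>i<N. u i x * x b ^ Suc i) + u N x * x b ^ M"
      unfolding u(2)[OF x] N by (simp add: sum_distrib_left distrib_left mult_ac)
    also have "(\<Sum>i<N. u i x * x b ^ Suc i)
        = (\<Sum>i<M. (if i = 0 then (\<lambda>x. 0) else u (i - 1)) x * x b ^ i)"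
      unfolding N sum.lessThan_Suc_shift by simp
    finally show "(\<Sum>i<M. (if i = 0 then (\<lambda>x. 0) else u (i - 1)) x * x b ^ i)
      + u N x * (\<Sum>i<M. g i x * x b ^ i) = x b * f x"
      using rel[OF x] by simp
  qed
qed

lemma ext_root_power_mult: "f \<in> ext D \<Longrightarrow> (\<lambda>x. x b ^ i * f x) \<in> ext (D + i * D0)"
proof (induction i)
  case (Suc i)
  then show ?case using ext_root_mult[of "\<lambda>x. x b ^ i * f x" "D + i * D0"]
    by (simp add: mult.assoc add_ac)
qed simp

lemma ext_mult:
  assumes "f \<in> ext D" "h \<in> ext E"
  shows "(\<lambda>x. f x * h x) \<in> ext (E + (D + M * D0))"
proof -
  obtain u where u: "\<And>i. i < M \<Longrightarrow> u i \<in> box D" "\<And>x. x \<in> W \<Longrightarrow> f x = (\<Sum>i<M. u i x * x b ^ i)"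
    using assms(1) unfolding ext_def by blast
  have "(\<lambda>x. \<Sum>i<M. u i x * (x b ^ i * h x)) \<in> ext (E + (D + M * D0))"
  proof (rule ext_sum)
    fix i assume "i \<in> {..<M}"
    then have i: "i < M" by simp
    have "(\<lambda>x. u i x * (x b ^ i * h x)) \<in> ext (D + (E + i * D0))"
      by (intro ext_box_mult u(1) i ext_root_power_mult assms(2))
    then show "(\<lambda>x. u i x * (x b ^ i * h x)) \<in> ext (E + (D + M * D0))"
      by (rule ext_mono) (use i in \<open>simp add: mult_le_mono1\<close>)
  qed
  then show ?thesis
    by (rule ext_cong) (simp add: u(2) sum_distrib_right mult.assoc)
qed

lemma poly_funs_ext:
  assumes "f \<in> poly_funs (insert b J)"
  shows "\<exists>D. f \<in> ext D"
  using assms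
proof induction
  case (const c)
  then show ?case using ext_of_box[OF box_const] by blast
next
  case (coord i)
  then consider "i \<in> J" | "i = b" by blast
  then show ?case
  proof cases
    case 1
    then show ?thesis using ext_of_box[OF box_coord] by blast
  next
    case 2
    then show ?thesis using ext_root_mult[OF ext_of_box[OF box_const[of 1]]] by auto
  qed
next
  case (add f g)
  then obtain D E where "f \<in> ext D" "g \<in> ext E" by blast
  then have "f \<in> ext (D + E)" "g \<in> ext (D + E)" by (auto intro: ext_mono)
  then show ?case using ext_add by blast
next
  case (mult f g)
  then show ?case using ext_mult by blast
qed

lemma ext_monom_fun:
  assumes "set hs \<subseteq> ext D" "length es = length hs"
  shows "monom_fun hs es \<in> ext (sum_list es * (D + M * D0))"
  using assms
proof (induction hs arbitrary: es)
  case Nil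
  then show ?case using ext_of_box[OF box_const] by simp
next
  case (Cons h hs)
  then obtain e es' where es: "es = e # es'" by (cases es) auto
  have IH: "monom_fun hs es' \<in> ext (sum_list es' * (D + M * D0))" using Cons es by auto
  have "(\<lambda>x. h x ^ i * monom_fun hs es' x) \<in> ext (sum_list es' * (D + M * D0) + i * (D + M * D0))" for i
  proof (induction i)
    case 0
    then show ?case using IH by simp
  next
    case (Suc i)
    have "h \<in> ext D" using Cons.prems by simp
    from ext_mult[OF this Suc] show ?case by (simp add: mult.assoc algebra_simps)
  qed
  from this[of e] show ?case by (simp add: es algebra_simps)
qed

text \<open>
  The monomials with exponents up to \<open>s\<close> in \<open>n + 1\<close> given functions number \<open>(s + 1) ^ (n + 1)\<close>, whereas
  they lie in a space of dimension at most \<open>M * (K * s + 1) ^ n\<close> with \<open>K\<close> independent of \<open>s\<close>. For large \<open>s\<close>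
  there are more monomials than dimensions.
\<close>

lemma poly_funs_alg_dependent:
  assumes hs: "set hs \<subseteq> poly_funs (insert b J)" "length hs = Suc (card J)"
  shows "alg_dependent hs W"
proof -
  define n where "n = card J"
  have "\<exists>D. set hs \<subseteq> ext D" using hs(1)
  proof (induction hs)
    case (Cons h hs)
    then have "\<exists>D. set hs \<subseteq> ext D" "\<exists>E. h \<in> ext E" by (auto intro: poly_funs_ext)
    then obtain D E where "set hs \<subseteq> ext D" "h \<in> ext E" by blast
    then have "set hs \<subseteq> ext (D + E)" "h \<in> ext (D + E)" by (auto intro: ext_mono)
    then show ?case by auto
  qed auto
  then obtain D where D: "set hs \<subseteq> ext D" by blast
  define K where "K = Suc n * (D + M * D0)"
  \<comment> \<open>Large enough for \<open>M * (K * s + 1) ^ n < (s + 1) ^ (n + 1)\<close>.\<close>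
  define s where "s = M * Suc K ^ n"
  define B where "B = {..<M} \<times> (J \<rightarrow>\<^sub>E {..K * s})"
  have "\<exists>c. \<forall>x\<in>W. monom_fun hs es x = (\<Sum>(i, e)\<in>B. c (i, e) * ((\<Prod>l\<in>J. x l ^ e l) * x b ^ i))"
    if es: "es \<in> exponents (Suc n) s" for es
  proof -
    have "set es \<subseteq> {..s}" using es by (simp add: exponents_def)
    then have "sum_list es \<le> length es * s" by (induction es) auto
    then have "sum_list es \<le> Suc n * s" using es by (simp add: exponents_def)
    then have "sum_list es * (D + M * D0) \<le> (Suc n * s) * (D + M * D0)" by (rule mult_le_mono1)
    also have "\<dots> = K * s" unfolding K_def by (simp only: mult_ac)
    finally have "sum_list es * (D + M * D0) \<le> K * s" .
    moreover have "length es = length hs" using es hs(2) by (simp add: exponents_def n_def)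
    ultimately have "monom_fun hs es \<in> ext (K * s)" using ext_monom_fun[OF D] ext_mono by blast
    then obtain u where u: "\<And>i. i < M \<Longrightarrow> u i \<in> box (K * s)" "\<And>x. x \<in> W \<Longrightarrow> monom_fun hs es x = (\<Sum>i<M. u i x * x b ^ i)"
      unfolding ext_def by blast
    have "\<forall>i\<in>{..<M}. \<exists>c. \<forall>x\<in>W. u i x = (\<Sum>e\<in>J \<rightarrow>\<^sub>E {..K * s}. c e * (\<Prod>l\<in>J. x l ^ e l))"
      using u(1) unfolding box_def by blast
    from bchoice[OF this] obtain c
      where c: "\<forall>i\<in>{..<M}. \<forall>x\<in>W. u i x = (\<Sum>e\<in>J \<rightarrow>\<^sub>E {..K * s}. c i e * (\<Prod>l\<in>J. x l ^ e l))"
      by blast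
    have "monom_fun hs es x = (\<Sum>(i, e)\<in>B. c i e * ((\<Prod>l\<in>J. x l ^ e l) * x b ^ i))" if "x \<in> W" for x
      using that c by (simp add: B_def u(2) sum_distrib_right mult.assoc flip: sum.cartesian_product)
    then show ?thesis by (intro exI[of _ "\<lambda>(i, e). c i e"]) simp
  qed
  then have "\<forall>es\<in>exponents (Suc n) s. \<exists>c. \<forall>x\<in>W.
      monom_fun hs es x = (\<Sum>(i, e)\<in>B. c (i, e) * ((\<Prod>l\<in>J. x l ^ e l) * x b ^ i))"
    by (rule ballI)
  from bchoice[OF this] obtain c where c: "\<And>es x. es \<in> exponents (Suc n) s \<Longrightarrow> x \<in> W \<Longrightarrow>
      monom_fun hs es x = (\<Sum>(i, e)\<in>B. c es (i, e) * ((\<Prod>l\<in>J. x l ^ e l) * x b ^ i))"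
    by blast
  have finB: "finite B" unfolding B_def using fin_PiE by simp
  have "card B = M * Suc (K * s) ^ n"
    unfolding B_def using fin by (simp add: card_cartesian_product card_PiE n_def)
  also have "\<dots> \<le> M * (Suc K * Suc s) ^ n"
    by (intro mult_le_mono2 power_mono) auto
  also have "\<dots> = s * Suc s ^ n" by (simp only: s_def power_mult_distrib mult.assoc)
  also have "\<dots> < card (exponents (Suc n) s)" by (simp add: card_exponents)
  finally obtain d where d: "\<exists>es\<in>exponents (Suc n) s. d es \<noteq> 0"
    "\<forall>\<beta>\<in>B. (\<Sum>es\<in>exponents (Suc n) s. d es * c es \<beta>) = 0"
    using underdetermined_linear_system[OF finB finite_exponents, of "Suc n" s c] by blast
  have "(\<Sum>es\<in>exponents (Suc n) s. d es * monom_fun hs es x) = 0" if x: "x \<in> W" for x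
  proof -
    have "(\<Sum>es\<in>exponents (Suc n) s. d es * monom_fun hs es x)
        = (\<Sum>es\<in>exponents (Suc n) s. \<Sum>\<beta>\<in>B. d es * c es \<beta> * ((\<Prod>l\<in>J. x l ^ snd \<beta> l) * x b ^ fst \<beta>))"
      using x by (simp add: c sum_distrib_left case_prod_beta mult.assoc)
    also have "\<dots> = (\<Sum>\<beta>\<in>B. (\<Sum>es\<in>exponents (Suc n) s. d es * c es \<beta>) * ((\<Prod>l\<in>J. x l ^ snd \<beta> l) * x b ^ fst \<beta>))"
      by (subst sum.swap) (simp add: sum_distrib_right)
    also have "\<dots> = 0" using d(2) by simp
    finally show ?thesis .
  qed
  then show ?thesis
    unfolding alg_dependent_def hs(2) using d(1) n_def by blast
qed

end

end

section \<open>Polynomials with prescribed critical points\<close>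

text \<open>
  Vieta's formula.
\<close>

lemma prod_linear_factors:
  fixes v :: "'i \<Rightarrow> 'a::comm_ring_1"
  assumes "finite I"
  shows "(\<Prod>i\<in>I. [:- v i, 1:]) = (\<Sum>i\<le>card I. monom ((-1) ^ i * elem_sym I i v) (card I - i))"
proof -
  let ?t = "\<lambda>S. monom ((-1) ^ card S * (\<Prod>i\<in>S. v i)) (card I - card S)"
  have "(\<Prod>i\<in>I. [:- v i, 1:]) = (\<Prod>i\<in>I. [:- v i:] + [:0, 1:])" by simp
  also have "\<dots> = (\<Sum>S\<in>Pow I. (\<Prod>i\<in>S. [:- v i:]) * (\<Prod>i\<in>I - S. [:0, 1:]))"
    by (rule prod_add[OF assms])
  also have "\<dots> = (\<Sum>S\<in>Pow I. ?t S)"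
  proof (rule sum.cong[OF refl])
    fix S assume S: "S \<in> Pow I"
    then have fin: "finite S" using assms finite_subset by blast
    have "(\<Prod>i\<in>S. [:- v i:]) = [:\<Prod>i\<in>S. - v i:]"
      using fin by induction (auto simp: pCons_one)
    also have "(\<Prod>i\<in>S. - v i) = (-1) ^ card S * (\<Prod>i\<in>S. v i)"
      by (simp add: prod_uminus)
    finally have 1: "(\<Prod>i\<in>S. [:- v i:]) = [:(-1) ^ card S * (\<Prod>i\<in>S. v i):]" .
    have 2: "(\<Prod>i\<in>I - S. [:0, 1 :: 'a:]) = monom 1 (card I - card S)"
      using S fin by (simp add: card_Diff_subset monom_altdef)
    show "(\<Prod>i\<in>S. [:- v i:]) * (\<Prod>i\<in>I - S. [:0, 1:]) = ?t S"
      unfolding 1 2 by (simp add: smult_monom)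
  qed
  also have "\<dots> = (\<Sum>i\<le>card I. \<Sum>S | S \<in> Pow I \<and> card S = i. ?t S)"
    using assms by (intro sum.group[symmetric]) (auto intro: card_mono)
  also have "\<dots> = (\<Sum>i\<le>card I. monom ((-1) ^ i * elem_sym I i v) (card I - i))"
    by (intro sum.cong refl) (simp add: elem_sym_def sum_distrib_left monom_sum)
  finally show ?thesis .
qed

lemma elem_sym_0 [simp]: "finite I \<Longrightarrow> elem_sym I 0 v = 1"
proof -
  assume "finite I"
  then have "{S. S \<subseteq> I \<and> card S = 0} = {{}}" by (auto dest: finite_subset)
  then show ?thesis by (simp add: elem_sym_def)
qed

lemma elem_sym_1 [simp]: "elem_sym I (Suc 0) v = (\<Sum>i\<in>I. v i)"
proof -
  have "{S. S \<subseteq> I \<and> card S = Suc 0} = (\<lambda>i. {i}) ` I" by (auto simp: card_1_singleton_iff)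
  then show ?thesis by (simp add: elem_sym_def sum.reindex)
qed

lemma smult_sum_distrib: "smult c (\<Sum>i\<in>A. f i) = (\<Sum>i\<in>A. smult c (f i))"
  by (induction A rule: infinite_finite_induct) (auto simp: smult_add_right)

lemma pderiv_sum: "pderiv (\<Sum>i\<in>A. f i) = (\<Sum>i\<in>A. pderiv (f i))"
  by (induction A rule: infinite_finite_induct) (auto simp: pderiv_add)

text \<open>
  By Vieta's formula; the condition \<open>(\<Sum>i=1..d-1. v i) = 0\<close> accounts for the missing term of degree \<open>d - 1\<close>.
  The derivative and the value at \<open>v 1\<close> determine the polynomial, which is how it is identified below.
\<close>

lemma param_poly_facts:
  assumes d: "2 \<le> d" and v: "v \<in> param_space d"
  shows pderiv_param_poly: "pderiv (param_poly d v) = smult (of_nat d) (\<Prod>i\<in>{1..d-1}. [:- v i, 1:])"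
    and poly_param_poly: "poly (param_poly d v) (v 1) = v d"
    and degree_param_poly: "degree (param_poly d v) = d"
    and lead_coeff_param_poly: "coeff (param_poly d v) d = 1"
proof -
  define c where "c i = (-1) ^ i * (of_nat d / of_nat (d - i)) * elem_sym {1..d-1} i v" for i
  define e where "e i = (-1) ^ i * elem_sym {1..d-1} i v" for i
  have eq: "param_poly d v = monom 1 d + ((\<Sum>i=2..d-1. monom (c i) (d - i))
      + [:- (v 1 ^ d) - (\<Sum>i=2..d-1. c i * v 1 ^ (d - i)) + v d:])"
    by (simp add: param_poly_def c_def Let_def)
  show "poly (param_poly d v) (v 1) = v d"
    by (simp add: eq poly_sum poly_monom)
  have "degree ((\<Sum>i=2..d-1. monom (c i) (d - i))
      + [:- (v 1 ^ d) - (\<Sum>i=2..d-1. c i * v 1 ^ (d - i)) + v d:]) \<le> d - 1"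
    by (intro degree_add_le degree_sum_le) (auto intro: order.trans[OF degree_monom_le])
  then have "degree ((\<Sum>i=2..d-1. monom (c i) (d - i))
      + [:- (v 1 ^ d) - (\<Sum>i=2..d-1. c i * v 1 ^ (d - i)) + v d:]) < degree (monom (1::complex) d)"
    using d by (simp add: degree_monom_eq)
  from monic_add_lower[OF _ this] show "degree (param_poly d v) = d" "coeff (param_poly d v) d = 1"
    unfolding eq by (simp_all add: degree_monom_eq)
  have "pderiv (param_poly d v) = monom (of_nat d) (d - 1)
      + (\<Sum>i=2..d-1. monom (of_nat (d - i) * c i) (d - i - 1))"
    by (simp add: eq pderiv_add pderiv_monom pderiv_sum pderiv_pCons)
  also have "(\<Sum>i=2..d-1. monom (of_nat (d - i) * c i) (d - i - 1))
      = (\<Sum>i=2..d-1. smult (of_nat d) (monom (e i) (d - 1 - i)))"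
  proof (rule sum.cong[OF refl])
    fix i assume "i \<in> {2..d - 1}"
    then have "i < d" using d by auto
    then have "(of_nat (d - i) :: complex) \<noteq> 0" by simp
    then have "of_nat (d - i) * c i = of_nat d * e i" by (simp add: c_def e_def)
    then show "monom (of_nat (d - i) * c i) (d - i - 1) = smult (of_nat d) (monom (e i) (d - 1 - i))"
      by (simp add: smult_monom diff_right_commute)
  qed
  also have "monom (of_nat d) (d - 1) + \<dots>
      = smult (of_nat d) (\<Sum>i\<in>insert 0 (insert 1 {2..d-1}). monom (e i) (d - 1 - i))"
  proof -
    have "e 0 = 1" "e 1 = 0"
      using v by (simp_all add: e_def param_space_def)
    then show ?thesis by (simp add: smult_add_right smult_sum_distrib smult_monom)
  qed
  also have "insert 0 (insert 1 {2..d-1}) = {..d-1}" using d by auto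
  also have "(\<Sum>i\<in>{..d-1}. monom (e i) (d - 1 - i)) = (\<Prod>i\<in>{1..d-1}. [:- v i, 1:])"
    by (subst prod_linear_factors) (auto simp: e_def)
  finally show "pderiv (param_poly d v) = smult (of_nat d) (\<Prod>i\<in>{1..d-1}. [:- v i, 1:])" .
qed

lemma poly_eq_of_pderiv_eq:
  fixes f g :: "'a::field_char_0 poly"
  assumes "pderiv f = pderiv g" "poly f x = poly g x"
  shows "f = g"
proof -
  have "pderiv (f - g) = 0" using assms by (simp add: pderiv_diff)
  then obtain c where "f - g = [:c:]" by (metis pderiv_eq_0_iff degree_eq_zeroE)
  moreover from this have "c = 0" using assms(2) by (metis poly_diff poly_pCons mult_zero_right
      poly_0 add.right_neutral right_minus_eq)
  ultimately show ?thesis by simp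
qed

lemma marked_param_poly:
  assumes "2 \<le> d" "v \<in> param_space d"
  shows "(param_poly d v, v 1) \<in> marked_pairs d"
proof -
  have "poly (pderiv (param_poly d v)) (v 1) = of_nat d * (\<Prod>i\<in>{1..d-1}. v 1 - v i)"
    by (simp add: pderiv_param_poly[OF assms] poly_prod)
  also have "(\<Prod>i\<in>{1..d-1}. v 1 - v i) = 0"
    using assms(1) by (intro prod_zero) auto
  finally show ?thesis by (simp add: marked_pairs_def degree_param_poly[OF assms])
qed

section \<open>Affine conjugation\<close>

lemma poly_affine_conj:
  fixes a :: complex
  assumes "a \<noteq> 0"
  shows "g = [:b, a:] \<circ>\<^sub>p f \<circ>\<^sub>p [:- b / a, 1 / a:] \<longleftrightarrow> (\<forall>z. poly g (a * z + b) = a * poly f z + b)"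
proof
  assume g: "g = [:b, a:] \<circ>\<^sub>p f \<circ>\<^sub>p [:- b / a, 1 / a:]"
  have "- b / a + (a * z + b) * (1 / a) = z" for z
    using assms by (simp add: add_divide_distrib algebra_simps)
  then show "\<forall>z. poly g (a * z + b) = a * poly f z + b"
    by (simp add: g poly_pcompose)
next
  assume *: "\<forall>z. poly g (a * z + b) = a * poly f z + b"
  have "poly g = poly ([:b, a:] \<circ>\<^sub>p f \<circ>\<^sub>p [:- b / a, 1 / a:])"
  proof
    fix w
    have "poly g (a * ((w - b) / a) + b) = a * poly f ((w - b) / a) + b" using * by blast
    moreover have "a * ((w - b) / a) + b = w" using assms by simp
    moreover have "poly [:- b / a, 1 / a:] w = (w - b) / a" by (simp add: diff_divide_distrib)
    ultimately show "poly g w = poly ([:b, a:] \<circ>\<^sub>p f \<circ>\<^sub>p [:- b / a, 1 / a:]) w"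
      by (simp only: poly_pcompose) (simp add: mult.commute)
  qed
  then show "g = [:b, a:] \<circ>\<^sub>p f \<circ>\<^sub>p [:- b / a, 1 / a:]" by (simp only: poly_eq_poly_eq_iff)
qed

lemma affine_conj_iff:
  "((f, \<alpha>), (g, \<gamma>)) \<in> affine_conj d \<longleftrightarrow> (f, \<alpha>) \<in> marked_pairs d \<and> (g, \<gamma>) \<in> marked_pairs d \<and>
     (\<exists>a b. a \<noteq> 0 \<and> (\<forall>z. poly g (a * z + b) = a * poly f z + b) \<and> \<gamma> = a * \<alpha> + b)"
proof -
  have "a \<noteq> 0 \<and> g = [:b, a:] \<circ>\<^sub>p f \<circ>\<^sub>p [:- b / a, 1 / a:] \<and> poly [:b, a:] \<alpha> = \<gamma> \<longleftrightarrow>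
      a \<noteq> 0 \<and> (\<forall>z. poly g (a * z + b) = a * poly f z + b) \<and> \<gamma> = a * \<alpha> + b" for a b
  proof (cases "a = 0")
    case False
    show ?thesis unfolding poly_affine_conj[OF False] by (auto simp: mult.commute add.commute)
  qed simp
  then show ?thesis unfolding affine_conj_def by (simp only: mem_Collect_eq prod.case)
qed

lemma equiv_affine_conj: "equiv (marked_pairs d) (affine_conj d)"
proof (rule equivI)
  show "affine_conj d \<subseteq> marked_pairs d \<times> marked_pairs d"
    by (auto simp: affine_conj_def)
  show "refl_on (marked_pairs d) (affine_conj d)"
  proof (rule refl_onI)
    fix x assume "x \<in> marked_pairs d"
    moreover obtain f \<alpha> where x: "x = (f, \<alpha>)" by (cases x)
    moreover have "(1::complex) \<noteq> 0 \<and> (\<forall>z. poly f (1 * z + 0) = 1 * poly f z + 0) \<and> \<alpha> = 1 * \<alpha> + 0" by simp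
    ultimately show "(x, x) \<in> affine_conj d" using affine_conj_iff by blast
  qed
  show "sym (affine_conj d)"
  proof (rule symI, clarify)
    fix f \<alpha> g \<gamma> assume "((f, \<alpha>), (g, \<gamma>)) \<in> affine_conj d"
    then obtain a b where *: "(f, \<alpha>) \<in> marked_pairs d" "(g, \<gamma>) \<in> marked_pairs d"
      "a \<noteq> 0" "\<And>z. poly g (a * z + b) = a * poly f z + b" "\<gamma> = a * \<alpha> + b"
      unfolding affine_conj_iff by blast
    have e: "inverse a * y + - b / a = (y - b) / a" for y
      by (simp add: diff_divide_distrib) (simp add: divide_inverse)
    have "poly f (inverse a * z + - b / a) = inverse a * poly g z + - b / a" for z
    proof -
      have "a * ((z - b) / a) + b = z" using *(3) by simp
      then have "poly g z = a * poly f ((z - b) / a) + b" using *(4)[of "(z - b) / a"] by simp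
      then show ?thesis unfolding e using *(3) by simp
    qed
    moreover have "\<alpha> = inverse a * \<gamma> + - b / a" unfolding e using *(3,5) by simp
    moreover have "inverse a \<noteq> 0" using *(3) by simp
    ultimately show "((g, \<gamma>), (f, \<alpha>)) \<in> affine_conj d"
      unfolding affine_conj_iff using *(1,2) by blast
  qed
  show "trans (affine_conj d)"
  proof (rule transI, clarify)
    fix f \<alpha> g \<gamma> h \<eta>
    assume "((f, \<alpha>), (g, \<gamma>)) \<in> affine_conj d" "((g, \<gamma>), (h, \<eta>)) \<in> affine_conj d"
    then obtain a b a' b' where *: "(f, \<alpha>) \<in> marked_pairs d" "(h, \<eta>) \<in> marked_pairs d"
      "a \<noteq> 0" "\<And>z. poly g (a * z + b) = a * poly f z + b" "\<gamma> = a * \<alpha> + b"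
      "a' \<noteq> 0" "\<And>z. poly h (a' * z + b') = a' * poly g z + b'" "\<eta> = a' * \<gamma> + b'"
      unfolding affine_conj_iff by blast
    have "poly h ((a' * a) * z + (a' * b + b')) = (a' * a) * poly f z + (a' * b + b')" for z
      using *(7)[of "a * z + b"] *(4)[of z] by (simp add: algebra_simps)
    moreover have "\<eta> = (a' * a) * \<alpha> + (a' * b + b')" using *(5,8) by (simp add: algebra_simps)
    moreover have "a' * a \<noteq> 0" using *(3,6) by simp
    ultimately show "((f, \<alpha>), (h, \<eta>)) \<in> affine_conj d"
      unfolding affine_conj_iff using *(1,2) by blast
  qed
qed

lemma param_map_eq_iff:
  assumes "2 \<le> d" "v \<in> param_space d" "w \<in> param_space d"
  shows "param_map d v = param_map d w \<longleftrightarrow>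
    (\<exists>a b. a \<noteq> 0 \<and> (\<forall>z. poly (param_poly d w) (a * z + b) = a * poly (param_poly d v) z + b) \<and> w 1 = a * v 1 + b)"
  unfolding param_map_def moduli_class_def
  using eq_equiv_class_iff[OF equiv_affine_conj marked_param_poly[OF assms(1,2)] marked_param_poly[OF assms(1,3)]]
    affine_conj_iff marked_param_poly[OF assms(1,2)] marked_param_poly[OF assms(1,3)] by auto

lemma param_map_in: "2 \<le> d \<Longrightarrow> v \<in> param_space d \<Longrightarrow> param_map d v \<in> moduli_space d"
  unfolding param_map_def moduli_class_def moduli_space_def
  by (intro quotientI marked_param_poly)

text \<open>
  The group \<open>G\<close> acting on the parameter space, as pairs of a root of unity and a permutation of the indices
  of the unmarked critical points.
\<close>

definition group_elems :: "nat \<Rightarrow> (complex \<times> (nat \<Rightarrow> nat)) set" where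
  "group_elems d = {\<zeta>. \<zeta> ^ (d - 1) = 1} \<times> {\<sigma>. \<sigma> permutes {2..d-1}}"

definition act :: "nat \<Rightarrow> complex \<times> (nat \<Rightarrow> nat) \<Rightarrow> (nat \<Rightarrow> complex) \<Rightarrow> nat \<Rightarrow> complex" where
  "act d \<gamma> v = (\<lambda>i\<in>{1..d}. fst \<gamma> * v (snd \<gamma> i))"

lemma permutes_fixes_ends:
  assumes "2 \<le> d" "\<sigma> permutes {2..d - 1 :: nat}"
  shows "\<sigma> 1 = 1" "\<sigma> d = d" "\<sigma> permutes {1..d-1}" "\<sigma> permutes {1..d}"
  using assms permutes_not_in[OF assms(2)] permutes_subset[OF assms(2)] by auto

lemma act_in_param_space:
  assumes "2 \<le> d" "\<gamma> \<in> group_elems d" "v \<in> param_space d"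
  shows "act d \<gamma> v \<in> param_space d"
proof -
  obtain \<zeta> \<sigma> where \<gamma>: "\<gamma> = (\<zeta>, \<sigma>)" "\<sigma> permutes {2..d-1}"
    using assms(2) unfolding group_elems_def by auto
  have "(\<Sum>i=1..d-1. act d \<gamma> v i) = (\<Sum>i=1..d-1. \<zeta> * v (\<sigma> i))"
    by (intro sum.cong) (auto simp: act_def \<gamma>)
  also have "\<dots> = \<zeta> * (\<Sum>i=1..d-1. v i)"
    unfolding sum_distrib_left[symmetric]
    by (subst sum.permute[OF permutes_fixes_ends(3)[OF assms(1) \<gamma>(2)]]) (simp add: o_def)
  finally show ?thesis using assms(3) by (auto simp: param_space_def act_def)
qed

lemma param_map_act:
  assumes d: "2 \<le> d" and \<gamma>: "\<gamma> \<in> group_elems d" and v: "v \<in> param_space d"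
  shows "param_map d (act d \<gamma> v) = param_map d v"
proof -
  obtain \<zeta> \<sigma> where \<gamma>eq: "\<gamma> = (\<zeta>, \<sigma>)" and \<zeta>: "\<zeta> ^ (d - 1) = 1" and \<sigma>: "\<sigma> permutes {2..d-1}"
    using \<gamma> unfolding group_elems_def by auto
  define w where "w = act d \<gamma> v"
  have w: "w \<in> param_space d" unfolding w_def by (rule act_in_param_space[OF d \<gamma> v])
  have \<zeta>0: "\<zeta> \<noteq> 0" using \<zeta> d by (auto simp: power_0_left split: if_splits)
  have wi: "w i = \<zeta> * v (\<sigma> i)" if "i \<in> {1..d}" for i
    using that by (simp add: w_def act_def \<gamma>eq)
  have w1: "w 1 = \<zeta> * v 1" and wd: "w d = \<zeta> * v d"
    using d wi permutes_fixes_ends[OF d \<sigma>] by auto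
  define g where "g = smult \<zeta> (pcompose (param_poly d v) [:0, inverse \<zeta>:])"
  have "pderiv g = pcompose (pderiv (param_poly d v)) [:0, inverse \<zeta>:]"
    using \<zeta>0 by (simp add: g_def pderiv_smult pderiv_pcompose pderiv_pCons)
  also have "\<dots> = smult (of_nat d) (\<Prod>i\<in>{1..d-1}. smult (inverse \<zeta>) [:- (\<zeta> * v i), 1:])"
  proof -
    have pc: "pcompose [:- v i, 1:] [:0, inverse \<zeta>:] = smult (inverse \<zeta>) [:- (\<zeta> * v i), 1:]" for i
      using \<zeta>0 by (simp add: pcompose_pCons)
    show ?thesis
      unfolding pderiv_param_poly[OF d v] by (simp only: pcompose_smult pcompose_prod pc)
  qed
  also have "\<dots> = smult (of_nat d) (\<Prod>i\<in>{1..d-1}. [:- (\<zeta> * v i), 1:])"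
    using \<zeta> by (simp add: prod_smult power_inverse del: smult_pCons)
  also have "(\<Prod>i\<in>{1..d-1}. [:- (\<zeta> * v i), 1:]) = (\<Prod>i\<in>{1..d-1}. [:- (\<zeta> * v (\<sigma> i)), 1:])"
    by (subst prod.permute[OF permutes_fixes_ends(3)[OF d \<sigma>]]) (simp add: o_def)
  also have "\<dots> = (\<Prod>i\<in>{1..d-1}. [:- w i, 1:])"
    by (intro prod.cong) (auto simp: wi)
  finally have "pderiv g = pderiv (param_poly d w)" by (simp add: pderiv_param_poly[OF d w])
  moreover have "poly g (w 1) = poly (param_poly d w) (w 1)"
  proof -
    have e: "poly [:0, inverse \<zeta>:] (\<zeta> * v 1) = v 1" using \<zeta>0 by simp
    have "poly g (w 1) = \<zeta> * poly (param_poly d v) (v 1)"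
      unfolding w1 g_def poly_smult poly_pcompose e ..
    then show ?thesis by (simp only: poly_param_poly[OF d v] poly_param_poly[OF d w] wd)
  qed
  ultimately have "param_poly d w = g" by (rule poly_eq_of_pderiv_eq[symmetric])
  then have "\<forall>z. poly (param_poly d w) (\<zeta> * z + 0) = \<zeta> * poly (param_poly d v) z + 0"
    using \<zeta>0 by (simp add: g_def poly_pcompose field_simps)
  then have "param_map d v = param_map d w"
    unfolding param_map_eq_iff[OF d v w] using \<zeta>0 w1 by (intro exI[of _ \<zeta>] exI[of _ 0]) simp
  then show ?thesis by (simp add: w_def)
qed

lemma proots_prod_linear:
  fixes v :: "'i \<Rightarrow> 'a::idom"
  shows "finite I \<Longrightarrow> proots (\<Prod>i\<in>I. [:- v i, 1:]) = image_mset v (mset_set I)"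
  by (induction I rule: finite_induct) (auto simp: proots_mult simp del: mult_pCons_left)

text \<open>
  A conjugacy \<open>z \<mapsto> a * z + b\<close> between centred monic polynomials maps critical points to critical
  points with multiplicity. Comparing leading coefficients gives \<open>a ^ (d - 1) = 1\<close>, comparing the sums
  of the critical points gives \<open>b = 0\<close>, and equality of multisets provides the permutation.
\<close>

lemma param_map_eq_imp_act:
  assumes d: "2 \<le> d" and v: "v \<in> param_space d" and w: "w \<in> param_space d"
    and eq: "param_map d v = param_map d w"
  shows "\<exists>\<gamma>\<in>group_elems d. w = act d \<gamma> v"
proof -
  obtain a b where a: "a \<noteq> 0" and conj: "\<And>z. poly (param_poly d w) (a * z + b) = a * poly (param_poly d v) z + b"
    and w1: "w 1 = a * v 1 + b"
    using eq unfolding param_map_eq_iff[OF d v w] by blast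
  have "poly (pcompose (param_poly d w) [:b, a:]) = poly (smult a (param_poly d v) + [:b:])"
    using conj by (auto simp: poly_pcompose add.commute mult.commute)
  then have polyeq: "pcompose (param_poly d w) [:b, a:] = smult a (param_poly d v) + [:b:]"
    by (simp only: poly_eq_poly_eq_iff)
  have "smult a (pcompose (pderiv (param_poly d w)) [:b, a:]) = smult a (pderiv (param_poly d v))"
    using arg_cong[OF polyeq, of pderiv] by (simp add: pderiv_pcompose pderiv_smult pderiv_add pderiv_pCons)
  then have "pcompose (pderiv (param_poly d w)) [:b, a:] = pderiv (param_poly d v)"
    using a by (metis smult_cancel)
  then have eqp: "smult (of_nat d) (\<Prod>i\<in>{1..d-1}. [:b - w i, a:]) = smult (of_nat d) (\<Prod>i\<in>{1..d-1}. [:- v i, 1:])"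
    unfolding pderiv_param_poly[OF d v] pderiv_param_poly[OF d w]
    by (simp add: pcompose_smult pcompose_prod pcompose_pCons)
  have "(\<Prod>i\<in>{1..d-1}. [:b - w i, a:]) = (\<Prod>i\<in>{1..d-1}. [:- v i, 1:])"
  proof -
    note eqp
    moreover have "(of_nat d :: complex) \<noteq> 0" using d by simp
    ultimately show ?thesis by (metis smult_cancel)
  qed
  moreover have "(\<Prod>i\<in>{1..d-1}. [:b - w i, a:]) = smult (a ^ (d - 1)) (\<Prod>i\<in>{1..d-1}. [:- ((w i - b) / a), 1:])"
  proof -
    have "[:b - w i, a:] = smult a [:- ((w i - b) / a), 1:]" for i using a by simp
    then show ?thesis by (simp add: prod_smult del: smult_pCons)
  qed
  ultimately have prods: "smult (a ^ (d - 1)) (\<Prod>i\<in>{1..d-1}. [:- ((w i - b) / a), 1:])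
      = (\<Prod>i\<in>{1..d-1}. [:- v i, 1:])" by simp
  have lead: "lead_coeff (\<Prod>i\<in>{1..d-1}. [:- u i, 1:]) = 1" for u :: "nat \<Rightarrow> complex"
    by (simp add: lead_coeff_prod)
  have ad: "a ^ (d - 1) = 1"
    using arg_cong[OF prods, of lead_coeff] unfolding lead_coeff_smult lead by simp
  have "proots (\<Prod>i\<in>{1..d-1}. [:- ((w i - b) / a), 1:]) = proots (\<Prod>i\<in>{1..d-1}. [:- v i, 1:])"
    using prods by (simp only: ad smult_1_left)
  then have mset: "image_mset (\<lambda>i. (w i - b) / a) (mset_set {1..d-1}) = image_mset v (mset_set {1..d-1})"
    by (simp only: proots_prod_linear finite_atLeastAtMost)
  then have "(\<Sum>i=1..d-1. (w i - b) / a) = (\<Sum>i=1..d-1. v i)"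
    by (metis sum_unfold_sum_mset)
  moreover have "(\<Sum>i=1..d-1. (w i - b) / a) = ((\<Sum>i=1..d-1. w i) - of_nat (d - 1) * b) / a"
    by (simp add: sum_subtractf flip: sum_divide_distrib)
  ultimately have b: "b = 0" using v w a d by (auto simp: param_space_def)
  have split: "{1..d-1} = insert 1 {2..d-1}" using d by auto
  have "image_mset w (mset_set {1..d-1}) = image_mset (\<lambda>x. a * x) (image_mset (\<lambda>i. (w i - b) / a) (mset_set {1..d-1}))"
    using a b by (simp add: image_mset.compositionality comp_def)
  also have "\<dots> = image_mset (\<lambda>i. a * v i) (mset_set {1..d-1})"
    unfolding mset by (simp add: image_mset.compositionality comp_def)
  finally have "image_mset w (mset_set {2..d-1}) = image_mset (\<lambda>i. a * v i) (mset_set {2..d-1})"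
    unfolding split using w1 b by simp
  then obtain \<sigma> where \<sigma>: "\<sigma> permutes {2..d-1}" "\<forall>i\<in>{2..d-1}. w i = a * v (\<sigma> i)"
    by (rule image_mset_eq_implies_permutes[OF finite_atLeastAtMost])
  have wd: "w d = a * v d"
    using conj[of "v 1"] poly_param_poly[OF d v] poly_param_poly[OF d w] w1 b by simp
  have "w = act d (a, \<sigma>) v"
  proof
    fix i
    consider "i = 1" | "i \<in> {2..d-1}" | "i = d" | "i \<notin> {1..d}" by force
    then show "w i = act d (a, \<sigma>) v i"
    proof cases
      case 4
      then have "w i = undefined" using w by (auto simp: param_space_def)
      then show ?thesis using 4 by (auto simp: act_def)
    qed (use d \<sigma> wd w1 b permutes_fixes_ends[OF d \<sigma>(1)] in \<open>auto simp: act_def\<close>)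
  qed
  then show ?thesis using ad \<sigma>(1) unfolding group_elems_def by force
qed

text \<open>
  Conjugate by the affine map that makes the polynomial monic and its critical points sum to zero. The
  critical points are listed with the marked one first.
\<close>

lemma param_map_surj:
  assumes d: "2 \<le> d" and c: "c \<in> moduli_space d"
  shows "\<exists>v\<in>param_space d. param_map d v = c"
proof -
  obtain f \<alpha> where f: "(f, \<alpha>) \<in> marked_pairs d" "c = affine_conj d `` {(f, \<alpha>)}"
    using c unfolding moduli_space_def quotient_def by auto
  have deg: "degree f = d" and crit: "poly (pderiv f) \<alpha> = 0" using f by (auto simp: marked_pairs_def)
  have degd: "degree (pderiv f) = d - 1" using deg by (simp add: degree_pderiv)
  then have nz: "pderiv f \<noteq> 0" using d deg by (metis pderiv_eq_0_iff not_numeral_le_zero)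
  obtain xs where xs: "mset xs = proots (pderiv f)" using ex_mset by blast
  have \<alpha>_in: "\<alpha> \<in> set xs" using crit nz xs by (metis set_mset_mset set_count_proots mem_Collect_eq)
  define ys where "ys = \<alpha> # remove1 \<alpha> xs"
  have "mset ys = mset xs" using \<alpha>_in by (simp add: ys_def)
  with xs have ys: "mset ys = proots (pderiv f)" by simp
  have len: "length ys = d - 1" using ys degd size_proots_complex[of "pderiv f"] by (metis size_mset)
  \<comment> \<open>Critical points are indexed from \<open>1\<close>, list entries from \<open>0\<close>.\<close>
  define u where "u i = ys ! (i - 1)" for i
  have u1: "u 1 = \<alpha>" by (simp add: u_def ys_def)
  define lc where "lc = lead_coeff f"
  have lc: "lc \<noteq> 0" using deg d by (auto simp: lc_def)
  have "lead_coeff (pderiv f) = of_nat d * lc"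
    using d deg by (simp add: degd coeff_pderiv lc_def)
  moreover have "(\<Prod>x\<in>#proots (pderiv f). [:- x, 1:]) = (\<Prod>i\<in>{1..d-1}. [:- u i, 1:])"
  proof -
    have "(\<Prod>x\<in>#proots (pderiv f). [:- x, 1:]) = (\<Prod>x\<leftarrow>ys. [:- x, 1:])"
      unfolding ys[symmetric] by (simp flip: prod_mset_prod_list)
    also have "\<dots> = (\<Prod>i=0..<d-1. [:- ys ! i, 1:])"
      by (subst prod.list_conv_set_nth) (auto simp: len)
    also have "\<dots> = (\<Prod>i\<in>{1..d-1}. [:- u i, 1:])"
      by (rule prod.reindex_bij_witness[of _ "\<lambda>i. i - 1" Suc]) (auto simp: u_def)
    finally show ?thesis .
  qed
  ultimately have pf: "pderiv f = smult (of_nat d * lc) (\<Prod>i\<in>{1..d-1}. [:- u i, 1:])"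
    using complex_poly_decompose_multiset[of "pderiv f"] by simp
  obtain a where a: "a ^ (d - 1) = lc"
  proof -
    have "\<not> constant (poly (monom 1 (d - 1) - [:lc:]))"
    proof -
      have "degree (- [:lc:]) < degree (monom (1::complex) (d - 1))" using d by (simp add: degree_monom_eq)
      from monic_add_lower(1)[OF _ this, unfolded add_uminus_conv_diff] show ?thesis
        using d by (simp add: constant_degree degree_monom_eq)
    qed
    then obtain a where "poly (monom 1 (d - 1) - [:lc:]) a = 0"
      using fundamental_theorem_of_algebra by blast
    then show ?thesis by (intro that[of a]) (simp add: poly_monom)
  qed
  have a0: "a \<noteq> 0" using a lc d by (auto simp: power_0_left)
  define b where "b = - (a * (\<Sum>i=1..d-1. u i)) / of_nat (d - 1)"
  define v where "v = (\<lambda>i\<in>{1..d}. if i < d then a * u i + b else a * poly f \<alpha> + b)"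
  have vi: "v i = a * u i + b" if "i \<in> {1..d-1}" for i using that by (auto simp: v_def)
  have v1: "v 1 = a * \<alpha> + b" using d vi[of 1] u1 by simp
  have vd: "v d = a * poly f \<alpha> + b" using d by (simp add: v_def)
  have "(\<Sum>i=1..d-1. v i) = a * (\<Sum>i=1..d-1. u i) + of_nat (d - 1) * b"
    using vi by (simp add: sum.distrib sum_distrib_left)
  also have "\<dots> = 0" using d by (simp add: b_def)
  finally have v: "v \<in> param_space d" by (simp add: param_space_def v_def)
  define g where "g = [:b, a:] \<circ>\<^sub>p f \<circ>\<^sub>p [:- b / a, 1 / a:]"
  have "pderiv g = pcompose (pderiv f) [:- b / a, 1 / a:]"
    using a0 by (simp add: g_def pderiv_pcompose pderiv_pCons pcompose_pCons pderiv_add pderiv_mult pderiv_smult pcompose_smult)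
  also have "\<dots> = smult (of_nat d * lc) (\<Prod>i\<in>{1..d-1}. smult (inverse a) [:- v i, 1:])"
  proof -
    have "[:- b / a, 1 / a:] + [:- u i:] = smult (inverse a) [:- v i, 1:]" if "i \<in> {1..d-1}" for i
      using a0 vi[OF that] by (simp add: field_simps)
    then show ?thesis
      unfolding pf by (simp add: pcompose_smult pcompose_prod pcompose_pCons add.commute)
  qed
  also have "\<dots> = smult (of_nat d) (\<Prod>i\<in>{1..d-1}. [:- v i, 1:])"
    using lc a by (simp add: prod_smult power_inverse mult.assoc del: smult_pCons)
  finally have "pderiv g = pderiv (param_poly d v)" by (simp add: pderiv_param_poly[OF d v])
  moreover have gconj: "\<forall>z. poly g (a * z + b) = a * poly f z + b"
    using poly_affine_conj[OF a0, of g b f] g_def by simp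
  then have "poly g (v 1) = v d" unfolding v1 vd by blast
  then have "poly g (v 1) = poly (param_poly d v) (v 1)" by (simp only: poly_param_poly[OF d v])
  ultimately have "g = param_poly d v" by (rule poly_eq_of_pderiv_eq)
  then have "((f, \<alpha>), (param_poly d v, v 1)) \<in> affine_conj d"
    unfolding affine_conj_iff using f(1) marked_param_poly[OF d v] a0 gconj v1 by blast
  then have "param_map d v = c"
    unfolding param_map_def moduli_class_def f(2)
    using equiv_class_eq[OF equiv_affine_conj] by metis
  with v show ?thesis by blast
qed

section \<open>Invariance under conjugation\<close>

lemma funpow_conj:
  assumes "\<And>z. g (h z) = h (f z)"
  shows "(g ^^ n) (h z) = h ((f ^^ n) z)"
  by (induction n) (auto simp: assms)

lemma strictly_preperiodic_conj:
  assumes "\<And>z. g (h z) = h (f z)" "inj h"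
  shows "strictly_preperiodic g k n (h x) \<longleftrightarrow> strictly_preperiodic f k n x"
  unfolding strictly_preperiodic_def funpow_conj[of g h f, OF assms(1)] inj_eq[OF assms(2)] ..

text \<open>
  Multiplicity of a root survives an affine change of variable. Only divisibility has to be shown, since
  the inverse conjugacy provides the other inequality.
\<close>

lemma power_dvd_conj:
  fixes a :: complex
  assumes a: "a \<noteq> 0" and conj: "\<And>z. poly g (a * z + b) = a * poly f z + b"
    and dvd: "[:- \<alpha>, 1:] ^ n dvd f - [:poly f \<alpha>:]"
  shows "[:- (a * \<alpha> + b), 1:] ^ n dvd g - [:poly g (a * \<alpha> + b):]"
proof -
  define L where "L = [:- b / a, 1 / a:]"
  interpret c: ring_map "\<lambda>P. pcompose P L" by (rule ring_map_pcompose)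
  have 1: "pcompose [:- \<alpha>, 1:] L = smult (inverse a) [:- (a * \<alpha> + b), 1:]"
    using a by (simp add: L_def pcompose_pCons field_simps)
  have g: "g = [:b, a:] \<circ>\<^sub>p f \<circ>\<^sub>p L" unfolding L_def using poly_affine_conj[OF a] conj by blast
  have "g - [:a * poly f \<alpha> + b:] = smult a (pcompose (f - [:poly f \<alpha>:]) L)"
    unfolding g by (simp add: pcompose_pCons pcompose_diff pcompose_smult pcompose_add smult_diff_right)
  then have "g - [:poly g (a * \<alpha> + b):] = smult a (pcompose (f - [:poly f \<alpha>:]) L)"
    by (simp only: conj)
  moreover obtain Q where "f - [:poly f \<alpha>:] = [:- \<alpha>, 1:] ^ n * Q" using dvd by (rule dvdE)
  then have "pcompose (f - [:poly f \<alpha>:]) L = smult (inverse a) [:- (a * \<alpha> + b), 1:] ^ n * pcompose Q L"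
    by (simp only: c.mult c.power 1)
  ultimately have "g - [:poly g (a * \<alpha> + b):]
      = [:- (a * \<alpha> + b), 1:] ^ n * smult (a * inverse a ^ n) (pcompose Q L)"
    by (simp only: smult_power mult_smult_left mult_smult_right smult_smult)
  then show ?thesis by (rule dvdI)
qed

lemma
  assumes d: "2 \<le> d" and conj: "((f, \<alpha>), (g, \<gamma>)) \<in> affine_conj d"
  shows strictly_preperiodic_affine_conj:
      "strictly_preperiodic (poly g) k n \<gamma> \<longleftrightarrow> strictly_preperiodic (poly f) k n \<alpha>"
    and iterate_eq_affine_conj: "(poly g ^^ l) \<gamma> = (poly g ^^ m) \<gamma> \<longleftrightarrow> (poly f ^^ l) \<alpha> = (poly f ^^ m) \<alpha>"
    and ramification_index_affine_conj_le: "ramification_index f \<alpha> \<le> ramification_index g \<gamma>"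
proof -
  obtain a b where a: "a \<noteq> 0" and c: "\<And>z. poly g (a * z + b) = a * poly f z + b" and \<gamma>: "\<gamma> = a * \<alpha> + b"
    using conj unfolding affine_conj_iff by blast
  have inj: "inj (\<lambda>z. a * z + b)" using a by (auto simp: inj_def)
  show "strictly_preperiodic (poly g) k n \<gamma> \<longleftrightarrow> strictly_preperiodic (poly f) k n \<alpha>"
    using strictly_preperiodic_conj[of "poly g" "\<lambda>z. a * z + b" "poly f", OF c inj] by (simp add: \<gamma>)
  show "(poly g ^^ l) \<gamma> = (poly g ^^ m) \<gamma> \<longleftrightarrow> (poly f ^^ l) \<alpha> = (poly f ^^ m) \<alpha>"
    using funpow_conj[of "poly g" "\<lambda>z. a * z + b" "poly f", OF c] a by (simp add: \<gamma>)
  have "degree g = d" using conj by (simp add: affine_conj_def marked_pairs_def)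
  then have "g - [:poly g \<gamma>:] \<noteq> 0" using d by (metis degree_pCons_0 eq_iff_diff_eq_0 not_numeral_le_zero)
  moreover have "[:- \<gamma>, 1:] ^ ramification_index f \<alpha> dvd g - [:poly g \<gamma>:]"
    unfolding \<gamma> by (rule power_dvd_conj[OF a c]) (simp add: ramification_index_def order_1)
  ultimately show "ramification_index f \<alpha> \<le> ramification_index g \<gamma>"
    unfolding ramification_index_def[of g] by (simp add: order_divides)
qed

lemma ramification_index_affine_conj:
  assumes "2 \<le> d" "((f, \<alpha>), (g, \<gamma>)) \<in> affine_conj d"
  shows "ramification_index g \<gamma> = ramification_index f \<alpha>"
proof -
  have "((g, \<gamma>), (f, \<alpha>)) \<in> affine_conj d"
    using assms(2) equiv_affine_conj[of d] by (meson equiv_def symD)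
  with assms ramification_index_affine_conj_le show ?thesis by (meson le_antisym)
qed

lemma class_predicate_iff:
  assumes d: "2 \<le> d" and v: "v \<in> param_space d"
    and inv: "\<And>f \<alpha> g \<gamma>. ((f, \<alpha>), (g, \<gamma>)) \<in> affine_conj d \<Longrightarrow> P g \<gamma> = P f \<alpha>"
  shows "(\<exists>(f, \<alpha>)\<in>param_map d v. P f \<alpha>) \<longleftrightarrow> P (param_poly d v) (v 1)"
proof -
  have "(param_poly d v, v 1) \<in> param_map d v"
    unfolding param_map_def moduli_class_def
    using equiv_class_self[OF equiv_affine_conj marked_param_poly[OF d v]] .
  moreover have "((param_poly d v, v 1), y) \<in> affine_conj d" if "y \<in> param_map d v" for y
    using that unfolding param_map_def moduli_class_def by simp
  ultimately show ?thesis using inv by fastforce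
qed

lemma preperiodic_locus_iff:
  assumes "2 \<le> d" "v \<in> param_space d"
  shows "param_map d v \<in> preperiodic_locus d k n i \<longleftrightarrow>
    strictly_preperiodic (poly (param_poly d v)) k n (v 1) \<and> ramification_index (param_poly d v) (v 1) = i"
  unfolding preperiodic_locus_def
  using class_predicate_iff[OF assms, of "\<lambda>f \<alpha>. strictly_preperiodic (poly f) k n \<alpha> \<and> ramification_index f \<alpha> = i"]
    strictly_preperiodic_affine_conj[OF assms(1)] ramification_index_affine_conj[OF assms(1)] param_map_in[OF assms]
  by (simp del: One_nat_def)

lemma order_prod_linear:
  fixes v :: "'i \<Rightarrow> 'a::idom"
  shows "finite I \<Longrightarrow> order a (\<Prod>i\<in>I. [:- v i, 1:]) = card {i\<in>I. v i = a}"
proof (induction I rule: finite_induct)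
  case (insert i I)
  have "(\<Prod>i\<in>I. [:- v i, 1:]) \<noteq> 0" using insert by simp
  then have "order a (\<Prod>i\<in>insert i I. [:- v i, 1:]) = order a [:- v i, 1:] + card {i\<in>I. v i = a}"
    using insert by (subst prod.insert) (auto simp: order_mult simp del: mult_pCons_left)
  moreover have "order a [:- v i, 1:] = (if v i = a then 1 else 0)"
    using order_power_n_n[of a 1] by (auto simp: order_0I)
  moreover have "{l\<in>insert i I. v l = a} = (if v i = a then insert i {l\<in>I. v l = a} else {l\<in>I. v l = a})"
    by auto
  ultimately show ?case using insert by simp
qed simp

lemma ramification_index_param_poly:
  assumes d: "2 \<le> d" and v: "v \<in> param_space d"
  shows "ramification_index (param_poly d v) (v 1) = Suc (card {i\<in>{1..d-1}. v i = v 1})"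
proof -
  let ?f = "param_poly d v - [:poly (param_poly d v) (v 1):]"
  have "?f \<noteq> 0" using degree_param_poly[OF d v] d by (metis degree_pCons_0 eq_iff_diff_eq_0 not_numeral_le_zero)
  then have "order (v 1) ?f = Suc (order (v 1) (pderiv ?f))" by (intro order_pderiv) auto
  also have "pderiv ?f = smult (of_nat d) (\<Prod>i\<in>{1..d-1}. [:- v i, 1:])"
    by (simp add: pderiv_diff pderiv_pCons pderiv_param_poly[OF d v])
  finally show ?thesis
    using d by (simp add: ramification_index_def order_smult order_prod_linear)
qed

section \<open>Coordinates on the polynomials with a critical point of given multiplicity\<close>

text \<open>
  The coefficients \<open>c\<^sub>i\<close> of the polynomial with derivative \<open>p * z ^ (j - 1) * (\<Prod>l. z - x\<^sub>l)\<close>.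
\<close>

definition crit_coeffs :: "nat \<Rightarrow> nat \<Rightarrow> (nat \<Rightarrow> complex) \<Rightarrow> nat \<Rightarrow> complex" where
  "crit_coeffs j p x i = of_nat p / of_nat i * coeff (\<Prod>l\<in>{j..<p}. [:- x l, 1:]) (i - j)"

text \<open>
  The parameter of the polynomial whose critical points, relative to the marked one, are \<open>0\<close> (\<open>j - 1\<close> times)
  and \<open>x\<^sub>j, \<dots>, x\<^sub>p\<^sub>-\<^sub>1\<close>, and whose critical value, relative to the marked point, is \<open>x\<^sub>p\<close>. The subtracted mean
  makes the critical points sum to zero.
\<close>

definition emb :: "nat \<Rightarrow> nat \<Rightarrow> (nat \<Rightarrow> complex) \<Rightarrow> nat \<Rightarrow> complex" where
  "emb j p x = (\<lambda>i\<in>{1..p}. (if i < j then 0 else x i) - (\<Sum>l\<in>{j..<p}. x l) / of_nat (p - 1))"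

definition stratum :: "nat \<Rightarrow> nat \<Rightarrow> nat \<Rightarrow> (nat \<Rightarrow> complex) set" where
  "stratum j p k = {x. (\<forall>l\<in>{j..<p}. x l \<noteq> 0) \<and> prep j p (crit_coeffs j p x) (x p) k = 0 \<and>
     gap j p (crit_coeffs j p x) (x p) k \<noteq> 0}"

lemma cong_on_coordinates:
  assumes "\<And>l. l \<in> {j..p} \<Longrightarrow> x l = y l" "j \<le> p"
  shows "emb j p x = emb j p y" "x \<in> stratum j p k \<longleftrightarrow> y \<in> stratum j p k"
proof -
  have s: "(\<Sum>l\<in>{j..<p}. x l) = (\<Sum>l\<in>{j..<p}. y l)" using assms by (intro sum.cong) auto
  show "emb j p x = emb j p y" unfolding emb_def s using assms by (intro restrict_ext) auto
  have "(\<Prod>l\<in>{j..<p}. [:- x l, 1:]) = (\<Prod>l\<in>{j..<p}. [:- y l, 1:])" using assms by (intro prod.cong) auto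
  then have "crit_coeffs j p x = crit_coeffs j p y" by (simp add: crit_coeffs_def fun_eq_iff)
  moreover have "x p = y p" using assms by auto
  ultimately show "x \<in> stratum j p k \<longleftrightarrow> y \<in> stratum j p k" using assms by (auto simp: stratum_def)
qed

lemma degree_prod_linear: "degree (\<Prod>l\<in>A. [:- x l, 1 :: 'a::idom:]) = card A"
  by (subst degree_prod_eq_sum_degree) auto

lemma lead_coeff_prod_linear: "lead_coeff (\<Prod>l\<in>A. [:- x l, 1 :: 'a::idom:]) = 1"
  by (simp add: lead_coeff_prod)

lemma crit_coeffs_top: "j \<le> p \<Longrightarrow> 0 < p \<Longrightarrow> crit_coeffs j p x p = 1"
  using degree_prod_linear[of x "{j..<p}"] lead_coeff_prod_linear[of x "{j..<p}"]
  by (simp add: crit_coeffs_def)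

context
  fixes j p :: nat
  assumes j: "2 \<le> j" and jp: "j < p"
begin

lemma two_le_degree: "2 \<le> p" using j jp by simp

lemma emb_1: "emb j p x 1 = - ((\<Sum>l\<in>{j..<p}. x l) / of_nat (p - 1))"
  using j jp by (simp add: emb_def)

lemma emb_rel: "i \<in> {1..p} \<Longrightarrow> emb j p x i = emb j p x 1 + (if i < j then 0 else x i)"
  unfolding emb_1 by (simp add: emb_def)

lemma emb_in_param_space: "emb j p x \<in> param_space p"
proof -
  let ?s = "\<Sum>l\<in>{j..<p}. x l"
  have "(\<Sum>i=1..p-1. emb j p x i) = (\<Sum>i=1..p-1. (if i < j then 0 else x i) - ?s / of_nat (p - 1))"
    by (intro sum.cong) (auto simp: emb_def)
  also have "\<dots> = (\<Sum>i=1..p-1. if i < j then 0 else x i) - ?s"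
    using jp j by (simp add: sum_subtractf)
  also have "(\<Sum>i=1..p-1. if i < j then 0 else x i) = ?s"
    using j jp by (intro sum.mono_neutral_cong_right) auto
  finally show ?thesis by (simp add: param_space_def emb_def)
qed

lemma poly_param_poly_emb:
  "poly (param_poly p (emb j p x)) (emb j p x 1 + z)
    = emb j p x 1 + (x p + (\<Sum>i=j..p. crit_coeffs j p x i * z ^ i))"
proof -
  let ?v = "emb j p x"
  note v = emb_in_param_space[of x]
  let ?L = "\<Prod>l\<in>{j..<p}. [:- x l, 1:]"
  define T where "T = [:?v 1 + x p:] + (\<Sum>i=j..p. monom (crit_coeffs j p x i) i)"
  define F where "F = pcompose (param_poly p ?v) [:?v 1, 1:]"
  have coeffT: "coeff (\<Sum>i=j..p. monom (crit_coeffs j p x i) i) n = (if n \<in> {j..p} then crit_coeffs j p x n else 0)" for n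
    by (simp add: coeff_sum sum.delta')
  have "pderiv T = smult (of_nat p) (monom 1 (j - 1) * ?L)"
  proof (rule poly_eqI)
    fix n
    have "coeff (pderiv T) n = of_nat (Suc n) * (if Suc n \<in> {j..p} then crit_coeffs j p x (Suc n) else 0)"
      unfolding T_def coeff_pderiv coeff_add coeffT by simp
    also have "\<dots> = (if Suc n \<in> {j..p} then of_nat p * coeff ?L (Suc n - j) else 0)"
      unfolding crit_coeffs_def by (simp del: of_nat_Suc)
    also have "\<dots> = (if j - 1 \<le> n then of_nat p * coeff ?L (n - (j - 1)) else 0)"
      using j jp degree_prod_linear[of x "{j..<p}"] by (auto intro!: coeff_eq_0 simp: Suc_diff_le)
    also have "\<dots> = coeff (smult (of_nat p) (monom 1 (j - 1) * ?L)) n"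
      by (simp add: coeff_monom_mult)
    finally show "coeff (pderiv T) n = coeff (smult (of_nat p) (monom 1 (j - 1) * ?L)) n" .
  qed
  moreover have "pderiv F = smult (of_nat p) (monom 1 (j - 1) * ?L)"
  proof -
    have "pderiv F = smult (of_nat p) (\<Prod>i\<in>{1..p-1}. [:?v 1 - ?v i, 1:])"
      unfolding F_def pderiv_pcompose pderiv_param_poly[OF two_le_degree v]
      by (simp add: pderiv_pCons pcompose_smult pcompose_prod pcompose_pCons)
    also have "(\<Prod>i\<in>{1..p-1}. [:?v 1 - ?v i, 1:]) = (\<Prod>i\<in>{1..<j} \<union> {j..<p}. if i < j then [:0, 1:] else [:- x i, 1:])"
    proof (rule prod.cong)
      show "{1..p-1} = {1..<j} \<union> {j..<p}" using j jp by auto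
      fix i assume "i \<in> {1..<j} \<union> {j..<p}"
      then show "[:?v 1 - ?v i, 1:] = (if i < j then [:0, 1:] else [:- x i, 1:])"
        using emb_rel[of i x] j jp by (auto simp del: One_nat_def)
    qed
    also have "\<dots> = (\<Prod>i\<in>{1..<j}. [:0, 1:]) * ?L"
      by (subst prod.union_disjoint) auto
    also have "(\<Prod>i\<in>{1..<j}. [:0, 1 :: complex:]) = monom 1 (j - 1)"
      by (simp add: monom_altdef)
    finally show ?thesis .
  qed
  ultimately have "pderiv F = pderiv T" by simp
  moreover have "poly F 0 = poly T 0"
  proof -
    have "(\<Sum>i=j..p. crit_coeffs j p x i * 0 ^ i) = 0" using j by (intro sum.neutral) (auto simp: power_0_left)
    moreover have "poly F 0 = ?v p" using poly_param_poly[OF two_le_degree v] by (simp add: F_def poly_pcompose)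
    ultimately show ?thesis using j jp emb_rel[of p x] by (simp add: T_def poly_sum poly_monom)
  qed
  ultimately have "F = T" by (rule poly_eq_of_pderiv_eq)
  then have "poly F z = poly T z" by simp
  then show ?thesis by (simp add: F_def T_def poly_pcompose poly_sum poly_monom add.assoc add.commute mult.commute)
qed

lemma iterate_param_poly_emb:
  "(poly (param_poly p (emb j p x)) ^^ l) (emb j p x 1)
    = emb j p x 1 + orb j p (crit_coeffs j p x) (x p) l"
  by (induction l) (simp_all add: poly_param_poly_emb del: One_nat_def)

lemma ramification_index_emb:
  "ramification_index (param_poly p (emb j p x)) (emb j p x 1) = j \<longleftrightarrow> (\<forall>l\<in>{j..<p}. x l \<noteq> 0)"
proof -
  have "{i\<in>{1..p-1}. emb j p x i = emb j p x 1} = {1..<j} \<union> {l\<in>{j..<p}. x l = 0}"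
  proof -
    have "emb j p x i = emb j p x 1 \<longleftrightarrow> i < j \<or> x i = 0" if "i \<in> {1..p-1}" for i
    proof -
      have "i \<in> {1..p}" using that by auto
      from emb_rel[OF this, of x] show ?thesis by (simp del: One_nat_def)
    qed
    then show ?thesis using j jp by (auto simp del: One_nat_def)
  qed
  moreover have "card ({1..<j} \<union> {l\<in>{j..<p}. x l = 0}) = (j - 1) + card {l\<in>{j..<p}. x l = 0}"
    by (subst card_Un_disjoint) auto
  ultimately have "ramification_index (param_poly p (emb j p x)) (emb j p x 1) = j + card {l\<in>{j..<p}. x l = 0}"
    using j by (simp add: ramification_index_param_poly[OF two_le_degree emb_in_param_space] del: One_nat_def)
  then show ?thesis by (auto simp: card_eq_0_iff)
qed

lemma emb_strictly_preperiodic_iff: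
  "strictly_preperiodic (poly (param_poly p (emb j p x))) k 1 (emb j p x 1) \<and>
    ramification_index (param_poly p (emb j p x)) (emb j p x 1) = j \<longleftrightarrow> x \<in> stratum j p k"
  using strictly_preperiodic_iff_prep[OF _ iterate_param_poly_emb[where x = x], of k] j
  by (auto simp: stratum_def ramification_index_emb simp del: One_nat_def)

lemma permutation_sorting:
  assumes "S \<subseteq> {2..p-1}" "card S = j - 2"
  shows "\<exists>\<sigma>. \<sigma> permutes {2..p-1} \<and> \<sigma> ` {2..<j} = S"
proof -
  have fin: "finite S" using assms finite_subset by blast
  obtain f where f: "bij_betw f {2..<j} S"
    using finite_same_card_bij[of "{2..<j}" S] fin assms by auto
  have "card ({2..p-1} - S) = card {j..<p}"
    using assms fin j jp by (simp add: card_Diff_subset)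
  then obtain g where g: "bij_betw g {j..<p} ({2..p-1} - S)"
    using finite_same_card_bij[of "{j..<p}" "{2..p-1} - S"] by auto
  define h where "h i = (if i \<in> {2..<j} then f i else if i \<in> {j..<p} then g i else i)" for i
  have "bij_betw h {2..<j} S" using f by (subst bij_betw_cong[of _ _ f]) (auto simp: h_def)
  moreover have "bij_betw h {j..<p} ({2..p-1} - S)"
    using g by (subst bij_betw_cong[of _ _ g]) (auto simp: h_def)
  ultimately have "bij_betw h ({2..<j} \<union> {j..<p}) (S \<union> ({2..p-1} - S))"
    by (rule bij_betw_combine) auto
  moreover have "{2..<j} \<union> {j..<p} = {2..p-1}" using j jp by auto
  moreover have "S \<union> ({2..p-1} - S) = {2..p-1}" using assms by auto
  ultimately have "bij_betw h {2..p-1} {2..p-1}" by simp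
  then have "h permutes {2..p-1}"
    by (rule bij_imp_permutes) (use j jp in \<open>auto simp: h_def\<close>)
  moreover have "h ` {2..<j} = S" using \<open>bij_betw h {2..<j} S\<close> by (rule bij_betw_imp_surj_on)
  ultimately show ?thesis by blast
qed

text \<open>
  The group permutes the unmarked critical points, so those that coincide with the marked one can be moved
  to the front.
\<close>

lemma param_map_eq_emb:
  assumes v: "v \<in> param_space p" and card: "card {i\<in>{1..p-1}. v i = v 1} = j - 1"
  shows "\<exists>x. param_map p v = param_map p (emb j p x)"
proof -
  define S where "S = {i\<in>{2..p-1}. v i = v 1}"
  have "{i\<in>{1..p-1}. v i = v 1} = insert 1 S" using j jp by (force simp: S_def)
  then have cS: "card S = j - 2" using card by (auto simp: S_def)
  obtain \<sigma> where \<sigma>: "\<sigma> permutes {2..p-1}" "\<sigma> ` {2..<j} = S"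
  proof -
    have "S \<subseteq> {2..p-1}" by (auto simp: S_def)
    from permutation_sorting[OF this cS] show ?thesis using that by blast
  qed
  define w where "w = act p (1, \<sigma>) v"
  have \<gamma>: "(1, \<sigma>) \<in> group_elems p" using \<sigma> by (simp add: group_elems_def)
  have w: "w \<in> param_space p" unfolding w_def by (rule act_in_param_space[OF two_le_degree \<gamma> v])
  have pm: "param_map p w = param_map p v" unfolding w_def by (rule param_map_act[OF two_le_degree \<gamma> v])
  have wi: "w i = v (\<sigma> i)" if "i \<in> {1..p}" for i using that by (simp add: w_def act_def)
  have w1: "w 1 = v 1" using wi[of 1] permutes_fixes_ends[OF two_le_degree \<sigma>(1)] j jp by simp
  have low: "w i = w 1" if "i \<in> {1..<j}" for i
  proof (cases "i = 1")
    case False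
    then have "\<sigma> i \<in> S" using that \<sigma>(2) by auto
    then show ?thesis using wi[of i] that jp w1 by (simp add: S_def)
  qed simp
  define x where "x i = w i - w 1" for i
  have "(\<Sum>i=1..p-1. w i) = (\<Sum>i=1..p-1. x i) + of_nat (p - 1) * w 1"
    by (simp add: x_def sum_subtractf)
  moreover have "(\<Sum>i=1..p-1. x i) = (\<Sum>i\<in>{j..<p}. x i)"
  proof (rule sum.mono_neutral_right)
    show "\<forall>i\<in>{1..p-1} - {j..<p}. x i = 0"
    proof
      fix i assume "i \<in> {1..p-1} - {j..<p}"
      then have "i \<in> {1..<j}" by auto
      from low[OF this] show "x i = 0" by (simp add: x_def)
    qed
  qed (use j jp in auto)
  moreover have "(\<Sum>i=1..p-1. w i) = 0" using w by (simp add: param_space_def)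
  ultimately have "(\<Sum>i\<in>{j..<p}. x i) = - (of_nat (p - 1) * w 1)" by (simp add: eq_neg_iff_add_eq_0)
  moreover have "(of_nat (p - 1) :: complex) \<noteq> 0" using two_le_degree by simp
  ultimately have e1: "emb j p x 1 = w 1" unfolding emb_1 by simp
  have "w = emb j p x"
  proof
    fix i show "w i = emb j p x i"
    proof (cases "i \<in> {1..p}")
      case True
      then show ?thesis
        using emb_rel[OF True, of x] low[of i] by (cases "i < j") (simp_all add: e1 x_def del: One_nat_def)
    next
      case False
      then show ?thesis using w by (auto simp: param_space_def emb_def)
    qed
  qed
  with pm show ?thesis by metis
qed

lemma preperiodic_locus_eq: "preperiodic_locus p k 1 j = (\<lambda>x. param_map p (emb j p x)) ` stratum j p k"
proof (intro set_eqI iffI)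
  fix c assume c: "c \<in> preperiodic_locus p k 1 j"
  then have "c \<in> moduli_space p" by (simp add: preperiodic_locus_def)
  then obtain v where v: "v \<in> param_space p" "param_map p v = c" using param_map_surj[OF two_le_degree] by blast
  have "ramification_index (param_poly p v) (v 1) = j"
    using c preperiodic_locus_iff[OF two_le_degree v(1)] v(2) by blast
  then have "card {i\<in>{1..p-1}. v i = v 1} = j - 1"
    using ramification_index_param_poly[OF two_le_degree v(1)] by simp
  then obtain x where x: "param_map p v = param_map p (emb j p x)" using param_map_eq_emb[OF v(1)] by blast
  then have "x \<in> stratum j p k"
    using c v(2) preperiodic_locus_iff[OF two_le_degree emb_in_param_space] emb_strictly_preperiodic_iff by metis
  then show "c \<in> (\<lambda>x. param_map p (emb j p x)) ` stratum j p k" using x v(2) by blast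
next
  fix c assume "c \<in> (\<lambda>x. param_map p (emb j p x)) ` stratum j p k"
  then show "c \<in> preperiodic_locus p k 1 j"
    using preperiodic_locus_iff[OF two_le_degree emb_in_param_space] emb_strictly_preperiodic_iff by blast
qed

definition prep_degree :: "nat \<Rightarrow> nat" where
  "prep_degree k = (if k = 0 then 1 else p ^ k - p ^ (k - 1) - (j - 1))"

lemma prep_poly_monic:
  fixes cs :: "nat \<Rightarrow> 'a::idom" and k :: nat
  assumes "cs p = 1"
  defines "G \<equiv> prep j p (\<lambda>i. [:cs i:]) [:0, 1:] k"
  shows "lead_coeff G = 1" "degree G = prep_degree k" "0 < prep_degree k"
proof -
  have *: "lead_coeff G = 1 \<and> degree G = prep_degree k \<and> 0 < prep_degree k"
  proof (cases "k = 0")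
    case True
    then show ?thesis by (simp add: G_def prep_def prep_degree_def)
  next
    case False
    have k: "1 \<le> k" and jp': "1 \<le> j" "j \<le> p" using False j jp by auto
    note m = prep_monic[where k = k and cs = cs, OF jp' two_le_degree assms(1) k, folded G_def]
    have "p ^ (k - 1) \<ge> 1" using two_le_degree by simp
    then have "(p - 1) * p ^ (k - 1) \<ge> p - 1" by simp
    moreover have "p ^ k = p * p ^ (k - 1)" using k by (simp flip: power_Suc)
    moreover have "p * p ^ (k - 1) = (p - 1) * p ^ (k - 1) + p ^ (k - 1)"
      using two_le_degree by (simp add: algebra_simps flip: Suc_diff_1)
    ultimately have "p ^ k > p ^ (k - 1) + (j - 1)" using jp j by linarith
    with m show ?thesis using False unfolding prep_degree_def by auto
  qed
  then show "lead_coeff G = 1" "degree G = prep_degree k" "0 < prep_degree k" by blast+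
qed

end

lemma orb_cong: "(\<And>i. i \<in> {j..p} \<Longrightarrow> cs i = cs' i) \<Longrightarrow> scaled_orb j p cs b l = scaled_orb j p cs' b l"
  by (induction l) auto

lemma prep_cong: "(\<And>i. i \<in> {j..p} \<Longrightarrow> cs i = cs' i) \<Longrightarrow> prep j p cs b k = prep j p cs' b k"
  unfolding prep_def using orb_cong[of j p cs cs' b] by (auto intro!: sum.cong)

section \<open>The defining equation over the integers\<close>

lemma lower_coeffs_prod_linear_dvd:
  fixes x :: "'i \<Rightarrow> 'a::idom"
  assumes "finite A" "\<And>l. l \<in> A \<Longrightarrow> q dvd x l" "n < card A"
  shows "q dvd coeff (\<Prod>l\<in>A. [:- x l, 1:]) n"
  using assms
proof (induction A arbitrary: n rule: finite_induct)
  case (insert a A)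
  have eq: "coeff (\<Prod>l\<in>insert a A. [:- x l, 1:]) n
      = (case n of 0 \<Rightarrow> 0 | Suc m \<Rightarrow> coeff (\<Prod>l\<in>A. [:- x l, 1:]) m) - x a * coeff (\<Prod>l\<in>A. [:- x l, 1:]) n"
    using insert by (simp add: coeff_pCons)
  have "q dvd (case n of 0 \<Rightarrow> 0 | Suc m \<Rightarrow> coeff (\<Prod>l\<in>A. [:- x l, 1:]) m)"
    using insert by (auto split: nat.split)
  then show ?case unfolding eq using insert by (intro dvd_diff dvd_mult2) auto
qed simp

text \<open>
  The family with one free critical point. The factor \<open>(p - 1)!\<close> makes the coefficients \<open>c\<^sub>i\<close> integral, as it
  cancels the denominators \<open>i < p\<close>, and it is prime to \<open>p\<close>, as are the fixed critical points divided by it.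
\<close>

lemma absolutely_irreducible_prep:
  fixes p j k :: nat
  assumes p: "prime p" and j: "2 \<le> j" "j < p" and k: "1 \<le> k"
  defines "x \<equiv> \<lambda>l. if l = j then [:0, fact (p - 1):] else [:fact (p - 1) * of_nat l :: complex:]"
  defines "cs \<equiv> \<lambda>i. [:of_nat p / of_nat i:] * coeff (\<Prod>l\<in>{j..<p}. [:- x l, 1:]) (i - j)"
  shows "irreducible (prep j p (\<lambda>i. [:cs i:]) [:0, 1:] k)"
proof -
  interpret i: ring_map "of_int :: int \<Rightarrow> complex" by (rule ring_map_of_int)
  interpret ip: ring_map "map_poly (of_int :: int \<Rightarrow> complex)" by (rule i.map_poly_ring_map)
  interpret ipp: ring_map "map_poly (map_poly (of_int :: int \<Rightarrow> complex))" by (rule ip.map_poly_ring_map)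
  define N :: int where "N = fact (p - 1)"
  define y :: "nat \<Rightarrow> int poly" where "y l = (if l = j then [:0, N:] else [:N * int l:])" for l
  define L where "L = (\<Prod>l\<in>{j..<p}. [:- y l, 1:])"
  have xy: "x l = map_poly of_int (y l)" for l
    by (simp add: x_def y_def N_def map_poly_pCons)
  have L: "coeff (\<Prod>l\<in>{j..<p}. [:- x l, 1:]) n = map_poly of_int (coeff L n)" for n
  proof -
    have "(\<Prod>l\<in>{j..<p}. [:- x l, 1:]) = map_poly (map_poly of_int) L"
      unfolding L_def ipp.prod by (intro prod.cong) (auto simp: xy map_poly_pCons)
    then show ?thesis by (simp add: coeff_map_poly)
  qed
  have "\<exists>e. coeff L (i - j) = of_nat i * e" if i: "i \<in> {j..<p}" for i
  proof -
    have "[:N:] dvd y l" for l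
      by (simp add: y_def const_poly_dvd_iff coeff_pCons split: nat.split)
    then have "[:N:] dvd coeff L (i - j)"
      unfolding L_def using i by (intro lower_coeffs_prod_linear_dvd) auto
    moreover have "i dvd fact (p - 1)" using i j by (intro dvd_fact) auto
    then have "int i dvd N" unfolding N_def by (metis of_nat_dvd_iff of_nat_fact)
    then have "[:int i:] dvd [:N:]" by (simp add: const_poly_dvd_const_poly_iff)
    ultimately have "[:int i:] dvd coeff L (i - j)" by (rule dvd_trans[rotated])
    then show ?thesis by (auto simp: of_nat_poly dvd_def)
  qed
  then obtain e where e: "\<And>i. i \<in> {j..<p} \<Longrightarrow> coeff L (i - j) = of_nat i * e i" by metis
  define cz :: "nat \<Rightarrow> int poly" where "cz i = (if i = p then 1 else of_nat p * e i)" for i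
  have cs_cz: "cs i = map_poly of_int (cz i)" if i: "i \<in> {j..p}" for i
  proof (cases "i = p")
    case True
    have "coeff L (p - j) = 1"
      using degree_prod_linear[of y "{j..<p}"] lead_coeff_prod_linear[of y "{j..<p}"] by (simp add: L_def)
    then show ?thesis unfolding True cs_def L using j by (simp add: cz_def pCons_one)
  next
    case False
    then have "cs i = [:of_nat p / of_nat i:] * (of_nat i * map_poly of_int (e i))"
      unfolding cs_def L using e[of i] i by simp
    also have "\<dots> = of_nat p * map_poly of_int (e i)"
      using i j by (simp add: of_nat_poly)
    finally show ?thesis using False by (simp add: cz_def)
  qed
  define m where "m = (\<Prod>l\<in>{j<..<p}. - (N * int l))"
  have "coeff L 0 = (\<Prod>l\<in>{j..<p}. - y l)"
    by (simp add: L_def poly_prod flip: poly_0_coeff_0)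
  also have "{j..<p} = insert j {j<..<p}" using j by auto
  also have "(\<Prod>l\<in>insert j {j<..<p}. - y l) = - [:0, N:] * (\<Prod>l\<in>{j<..<p}. [:- (N * int l):])"
    by (subst prod.insert) (auto simp: y_def)
  also have "(\<Prod>l\<in>{j<..<p}. [:- (N * int l):]) = [:m:]"
    using ring_map.prod[OF ring_map_const] unfolding m_def by metis
  finally have L0: "of_nat j * e j = [:0, - N * m:]"
    using e[of j] j by (simp add: mult.commute)
  define c where "c = coeff (e j) 1"
  have ejn: "int j * coeff (e j) n = coeff [:0, - N * m:] n" for n
    unfolding L0[symmetric] by (simp add: of_nat_poly)
  have ej: "e j = [:0, c:]"
  proof (rule poly_eqI)
    fix n show "coeff (e j) n = coeff [:0, c:] n"
      using ejn[of n] j by (auto simp: c_def coeff_pCons split: nat.splits)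
  qed
  have "\<not> p dvd fact (p - 1)" using p j by (simp add: prime_dvd_fact_iff)
  then have pN: "\<not> int p dvd N" unfolding N_def by (metis of_nat_dvd_iff of_nat_fact)
  have pint: "prime (int p)" using p by simp
  have "\<not> int p dvd m"
  proof
    assume "int p dvd m"
    then obtain l where l: "l \<in> {j<..<p}" "int p dvd - (N * int l)"
      unfolding m_def using pint by (auto simp: prime_dvd_prod_iff)
    then have "int p dvd int l" using pN pint by (auto simp: prime_dvd_mult_iff)
    then have "p dvd l" by simp
    with l(1) show False by (auto dest: dvd_imp_le)
  qed
  moreover have "int j * c = - N * m" using ejn[of 1] by (simp add: c_def)
  ultimately have pc: "\<not> int p dvd c"
    using pN pint by (metis dvd_mult dvd_minus_iff mult_minus_left prime_dvd_mult_iff)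
  define G where "G = prep j p (\<lambda>i. [:cz i:]) [:0, 1:] k"
  have cz: "cz p = 1" "\<And>i. i \<in> {j..<p} \<Longrightarrow> of_nat p dvd cz i" "cz j = [:0, int p * c:]"
    by (simp add: cz_def, simp add: cz_def, use j in \<open>simp add: cz_def ej of_nat_poly\<close>)
  have "\<not> (int p)\<^sup>2 dvd int p * c" using pc p by (simp add: power2_eq_square prime_gt_0_nat)
  note G = prep_irreducible_int[OF p j k cz this, folded G_def]
  have "irreducible (map_poly (map_poly of_int) G :: complex poly poly)"
    using absolutely_irreducible[of G] G irreducible_imp_prime_elem[OF G(1)] by blast
  also have "map_poly (map_poly of_int) G
      = (prep j p (\<lambda>i. [:map_poly of_int (cz i):]) [:0, 1:] k :: complex poly poly)"
    unfolding G_def ipp.prep by (simp add: map_poly_pCons)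
  also have "\<dots> = prep j p (\<lambda>i. [:cs i:]) [:0, 1:] k"
    by (rule prep_cong) (simp add: cs_cz)
  finally show ?thesis .
qed

section \<open>Surfaces over a path of critical points\<close>

definition ev2 :: "complex \<Rightarrow> complex \<Rightarrow> complex poly poly \<Rightarrow> complex" where
  "ev2 r t = heval (\<lambda>s. poly s r) t"

lemma ring_map_ev2: "ring_map (ev2 r t)"
  unfolding ev2_def by (intro ring_map_heval ring_map_poly)

lemma ev2_const [simp]: "ev2 r t [:s:] = poly s r"
  and ev2_linear [simp]: "ev2 r t [:s, s':] = poly s r + t * poly s' r"
  unfolding ev2_def by (simp_all add: ring_map_poly)

lemma ev2_nonzero: "Q \<noteq> 0 \<Longrightarrow> \<exists>r t. ev2 r t Q \<noteq> 0"
proof -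
  assume Q: "Q \<noteq> 0"
  have "\<exists>x. poly q x \<noteq> 0" if "q \<noteq> 0" for q :: "complex poly"
    using that by (metis ext poly_0 poly_eq_poly_eq_iff)
  then obtain r where r: "poly (lead_coeff Q) r \<noteq> 0" using Q by (metis leading_coeff_0_iff)
  then have "coeff (map_poly (\<lambda>s. poly s r) Q) (degree Q) \<noteq> 0" by (simp add: coeff_map_poly)
  then have "map_poly (\<lambda>s. poly s r) Q \<noteq> 0" by auto
  then obtain t where "poly (map_poly (\<lambda>s. poly s r) Q) t \<noteq> 0"
    by (metis ext poly_0 poly_eq_poly_eq_iff)
  then show ?thesis unfolding ev2_def heval_def by blast
qed

text \<open>
  The critical points \<open>x\<^sub>l\<close> with \<open>l > j\<close> move along a polynomial path in \<open>r\<close> that starts at the base point of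
  \<open>absolutely_irreducible_prep\<close>, and \<open>x\<^sub>j\<close> is free, with parameter \<open>t\<close>.
\<close>

locale critical_path =
  fixes j p k :: nat and \<pi> :: "nat \<Rightarrow> complex poly"
  assumes p: "prime p" and j: "2 \<le> j" "j < p"
    and base: "\<And>l. l \<in> {j<..<p} \<Longrightarrow> poly (\<pi> l) 0 = fact (p - 1) * of_nat l"
begin

definition crit :: "nat \<Rightarrow> complex poly poly" where
  "crit l = (if l = j then [:0, [:fact (p - 1):]:] else [:\<pi> l:])"

definition pt :: "complex \<Rightarrow> complex \<Rightarrow> complex \<Rightarrow> nat \<Rightarrow> complex" where
  "pt r t b l = (if l = p then b else if l = j then fact (p - 1) * t else poly (\<pi> l) r)"

definition cs :: "nat \<Rightarrow> complex poly poly" where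
  "cs i = [:[:of_nat p / of_nat i:]:] * coeff (\<Prod>l\<in>{j..<p}. [:- crit l, 1:]) (i - j)"

definition G :: "complex poly poly poly" where
  "G = prep j p (\<lambda>i. [:cs i:]) [:0, 1:] k"

definition D :: "complex poly poly poly" where
  "D = gap j p (\<lambda>i. [:cs i:]) [:0, 1:] k"

lemma ev2_crit: "l \<noteq> p \<Longrightarrow> ev2 r t (crit l) = pt r t b l"
  by (simp add: crit_def pt_def)

lemma ev2_cs: "ev2 r t (cs i) = crit_coeffs j p (pt r t b) i"
proof -
  interpret e: ring_map "ev2 r t" by (rule ring_map_ev2)
  interpret m: ring_map "map_poly (ev2 r t)" by (rule e.map_poly_ring_map)
  have prod: "map_poly (ev2 r t) (\<Prod>l\<in>{j..<p}. [:- crit l, 1:]) = (\<Prod>l\<in>{j..<p}. [:- pt r t b l, 1:])"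
    unfolding m.prod by (intro prod.cong) (auto simp: map_poly_pCons ev2_crit[of _ r t b])
  have "ev2 r t (coeff (\<Prod>l\<in>{j..<p}. [:- crit l, 1:]) n) = coeff (\<Prod>l\<in>{j..<p}. [:- pt r t b l, 1:]) n" for n
    unfolding prod[symmetric] by (rule coeff_map_poly[where f = "ev2 r t", OF e.zero, symmetric])
  then show ?thesis unfolding cs_def e.mult crit_coeffs_def by simp
qed

lemma heval_G: "heval (ev2 r t) b G = prep j p (crit_coeffs j p (pt r t b)) b k"
  and heval_D: "heval (ev2 r t) b D = gap j p (crit_coeffs j p (pt r t b)) b k"
proof -
  interpret e: ring_map "ev2 r t" by (rule ring_map_ev2)
  interpret h: ring_map "heval (ev2 r t) b" by (intro ring_map_heval ring_map_ev2)
  have "heval (ev2 r t) b [:cs i:] = crit_coeffs j p (pt r t b) i" for i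
    using ev2_cs[of r t i b] by (simp add: e.ring_map_axioms)
  moreover have "heval (ev2 r t) b [:0, 1:] = b" by (simp add: e.ring_map_axioms)
  ultimately show "heval (ev2 r t) b G = prep j p (crit_coeffs j p (pt r t b)) b k"
    "heval (ev2 r t) b D = gap j p (crit_coeffs j p (pt r t b)) b k"
    unfolding G_def D_def h.prep h.gap by simp_all
qed

lemma pt_in_stratum_iff:
  "pt r t b \<in> stratum j p k \<longleftrightarrow> heval (ev2 r t) b G = 0 \<and> heval (ev2 r t) b D \<noteq> 0 \<and>
     ev2 r t (\<Prod>l\<in>{j..<p}. crit l) \<noteq> 0"
proof -
  interpret e: ring_map "ev2 r t" by (rule ring_map_ev2)
  have "ev2 r t (\<Prod>l\<in>{j..<p}. crit l) = (\<Prod>l\<in>{j..<p}. pt r t b l)"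
    unfolding e.prod by (intro prod.cong) (auto simp: ev2_crit[of _ r t b])
  moreover have "pt r t b p = b" by (simp add: pt_def)
  ultimately show ?thesis by (auto simp: stratum_def heval_G heval_D)
qed

lemma poly_funs_lift:
  assumes "H \<in> poly_funs {1..p}"
  shows "\<exists>h. \<forall>r t b. heval (ev2 r t) b h = H (emb j p (pt r t b))"
  using assms
proof induction
  case (const c)
  have "heval (ev2 r t) b [:[:[:c:]:]:] = c" for r t b by (simp add: ring_map_ev2)
  then show ?case by blast
next
  case (coord i)
  define x where "x = (\<lambda>i. if i = p then [:0, 1:] else [:crit i:])"
  define h where "h = (if i < j then 0 else x i) - [:[:[:1 / of_nat (p - 1):]:]:] * (\<Sum>l\<in>{j..<p}. [:crit l:])"
  have "heval (ev2 r t) b h = emb j p (pt r t b) i" for r t b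
  proof -
    interpret e: ring_map "ev2 r t" by (rule ring_map_ev2)
    interpret h: ring_map "heval (ev2 r t) b" by (intro ring_map_heval ring_map_ev2)
    have 1: "heval (ev2 r t) b [:crit l:] = pt r t b l" if "l \<noteq> p" for l
      using ev2_crit[OF that, of r t b] by (simp add: e.ring_map_axioms)
    then have 2: "heval (ev2 r t) b (x l) = pt r t b l" for l
      by (simp add: x_def e.ring_map_axioms) (simp add: pt_def)
    have "heval (ev2 r t) b (\<Sum>l\<in>{j..<p}. [:crit l:]) = (\<Sum>l\<in>{j..<p}. pt r t b l)"
      unfolding h.sum by (intro sum.cong) (auto simp: 1)
    moreover have "heval (ev2 r t) b [:[:[:1 / of_nat (p - 1):]:]:] = 1 / of_nat (p - 1)"
      by (simp add: e.ring_map_axioms)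
    ultimately show ?thesis
      using coord 2[of i] unfolding h_def h.diff h.mult by (simp add: emb_def)
  qed
  then show ?case by blast
next
  case (add f g)
  then obtain h h' where "\<forall>r t b. heval (ev2 r t) b h = f (emb j p (pt r t b))"
    "\<forall>r t b. heval (ev2 r t) b h' = g (emb j p (pt r t b))" by blast
  then have "\<forall>r t b. heval (ev2 r t) b (h + h') = f (emb j p (pt r t b)) + g (emb j p (pt r t b))"
    by (simp add: ring_map.add[OF ring_map_heval[OF ring_map_ev2]])
  then show ?case by blast
next
  case (mult f g)
  then obtain h h' where "\<forall>r t b. heval (ev2 r t) b h = f (emb j p (pt r t b))"
    "\<forall>r t b. heval (ev2 r t) b h' = g (emb j p (pt r t b))" by blast
  then have "\<forall>r t b. heval (ev2 r t) b (h * h') = f (emb j p (pt r t b)) * g (emb j p (pt r t b))"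
    by (simp add: ring_map.mult[OF ring_map_heval[OF ring_map_ev2]])
  then show ?case by blast
qed

lemma cs_top: "cs p = 1"
proof -
  have "coeff (\<Prod>l\<in>{j..<p}. [:- crit l, 1:]) (p - j) = 1"
    using degree_prod_linear[of crit "{j..<p}"] lead_coeff_prod_linear[of crit "{j..<p}"] by simp
  then show ?thesis unfolding cs_def using j by (simp add: pCons_one)
qed

lemmas G_monic = prep_poly_monic[OF j, of cs k, OF cs_top, folded G_def]

lemma crit_nonzero: "l \<in> {j..<p} \<Longrightarrow> crit l \<noteq> 0"
proof -
  assume l: "l \<in> {j..<p}"
  show ?thesis
  proof (cases "l = j")
    case False
    then have "poly (\<pi> l) 0 \<noteq> 0" using base[of l] l j by auto
    then have "\<pi> l \<noteq> 0" by auto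
    then show ?thesis using False by (simp add: crit_def)
  qed (simp add: crit_def)
qed

text \<open>
  The specialisation \<open>r = 0\<close> is the irreducible polynomial found over \<open>\<complex>[t]\<close>.
\<close>

lemma prime_G: "prime_elem G"
proof -
  have "irreducible G"
  proof (cases "k = 0")
    case True
    then have "degree G = 1" using G_monic by (simp add: prep_degree_def[OF j])
    show ?thesis
    proof (rule ccontr)
      assume "\<not> irreducible G"
      then obtain A B where "G = A * B" "0 < degree A" "0 < degree B"
        using monic_factors_of_reducible[of G] G_monic by metis
      then have "degree G = degree A + degree B" by (metis degree_mult_eq degree_0 less_irrefl)
      then show False using \<open>degree G = 1\<close> \<open>0 < degree A\<close> \<open>0 < degree B\<close> by simp
    qed
  next
    case False
    define h where "h = map_poly (\<lambda>s. poly s (0::complex))"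
    have hr: "ring_map h" unfolding h_def by (intro ring_map.map_poly_ring_map ring_map_poly)
    interpret h: ring_map h by (rule hr)
    interpret hp: ring_map "map_poly h" by (rule h.map_poly_ring_map)
    define x where "x l = (if l = j then [:0, fact (p - 1):] else [:fact (p - 1) * of_nat l :: complex:])" for l
    have hcrit: "h (crit l) = x l" if "l \<in> {j..<p}" for l
      using base[of l] that by (auto simp: h_def crit_def x_def map_poly_pCons)
    have prod: "map_poly h (\<Prod>l\<in>{j..<p}. [:- crit l, 1:]) = (\<Prod>l\<in>{j..<p}. [:- x l, 1:])"
      unfolding hp.prod by (intro prod.cong) (auto simp: map_poly_pCons hcrit)
    have "h (coeff (\<Prod>l\<in>{j..<p}. [:- crit l, 1:]) n) = coeff (\<Prod>l\<in>{j..<p}. [:- x l, 1:]) n" for n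
      unfolding prod[symmetric] by (rule coeff_map_poly[where f = h, OF h.zero, symmetric])
    then have "h (cs i) = [:of_nat p / of_nat i:] * coeff (\<Prod>l\<in>{j..<p}. [:- x l, 1:]) (i - j)" for i
      unfolding cs_def h.mult by (simp add: h_def map_poly_pCons)
    then have "map_poly h G = prep j p (\<lambda>i. [:[:of_nat p / of_nat i:] * coeff (\<Prod>l\<in>{j..<p}. [:- x l, 1:]) (i - j):]) [:0, 1:] k"
      unfolding G_def hp.prep by (simp add: map_poly_pCons)
    then have "irreducible (map_poly h G)"
      using absolutely_irreducible_prep[OF p j, of k] False unfolding x_def by simp
    then show ?thesis by (intro irreducible_monic_specialise[OF hr G_monic(1)])
  qed
  then show ?thesis by (rule irreducible_imp_prime_elem)
qed

lemma G_dvd_if_vanishing: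
  assumes "\<And>r t b. heval (ev2 r t) b G = 0 \<Longrightarrow> heval (ev2 r t) b P = 0"
  shows "G dvd P"
proof (rule prime_monic_nullstellensatz[OF prime_G G_monic(1), of "{ev2 r t | r t. True}"])
  show "degree G > 0" using G_monic by simp
  show "\<exists>h\<in>{ev2 r t | r t. True}. h q \<noteq> 0" if "q \<noteq> 0" for q using ev2_nonzero[OF that] by blast
qed (use assms ring_map_ev2 in auto)

lemma not_G_dvd_const: "Q \<noteq> 0 \<Longrightarrow> \<not> G dvd [:Q:]"
  using G_monic dvd_imp_degree_le[of G "[:Q:]"] by auto

lemma cs_bottom_nonzero: "cs j \<noteq> 0"
proof -
  have "coeff (\<Prod>l\<in>{j..<p}. [:- crit l, 1:]) 0 = (\<Prod>l\<in>{j..<p}. - crit l)"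
    by (simp add: poly_prod flip: poly_0_coeff_0)
  then have "coeff (\<Prod>l\<in>{j..<p}. [:- crit l, 1:]) 0 \<noteq> 0" using crit_nonzero by simp
  then show ?thesis using j by (simp add: cs_def)
qed

text \<open>
  By degrees in \<open>b\<close> when \<open>k \<ge> 2\<close>. For \<open>k = 1\<close> the degrees can agree; then \<open>D = b\<close>, and \<open>G\<close> does not vanish at
  \<open>b = 0\<close>.
\<close>

lemma not_G_dvd_D: "\<not> G dvd D"
proof (cases "k \<le> 1")
  case True
  show ?thesis
  proof (cases "k = 0")
    case True
    then have D: "D = [:1:]" unfolding D_def gap_def by (simp add: pCons_one)
    show ?thesis unfolding D by (rule not_G_dvd_const) simp
  next
    case False
    then have k: "k = 1" using True by simp
    have "(\<Sum>i=j..p. [:cs i:] * 0 ^ i) = 0" using j by (intro sum.neutral) (auto simp: power_0_left)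
    then have D: "D = [:0, 1:]" unfolding D_def gap_def by (simp add: k)
    have "poly G 0 = prep j p cs 0 k"
      using ring_map.prep[OF ring_map_poly[of "0 :: complex poly poly"], of j p "\<lambda>i. [:cs i:]" "[:0, 1:]" k]
      by (simp add: G_def)
    also have "\<dots> = cs j" using prep_at_0[of j p k cs] j k by simp
    finally have G0: "poly G 0 \<noteq> 0" using cs_bottom_nonzero by simp
    show ?thesis
    proof
      assume "G dvd D"
      then obtain Q where Q: "D = G * Q" by (rule dvdE)
      then have "poly G 0 * poly Q 0 = 0" by (metis D poly_mult poly_pCons add.left_neutral mult_zero_left)
      with G0 have Q0: "poly Q 0 = 0" by simp
      have "G \<noteq> 0" "Q \<noteq> 0" using Q D by auto
      then have "degree D = degree G + degree Q" using Q by (simp add: degree_mult_eq)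
      then have "degree Q = 0" using D G_monic by simp
      then obtain q where "Q = [:q:]" by (metis degree_eq_zeroE)
      with Q0 \<open>Q \<noteq> 0\<close> show False by simp
    qed
  qed
next
  case False
  then have k: "1 \<le> k" and jp: "1 \<le> j" "j \<le> p" "2 \<le> p" using j by auto
  have Dm: "lead_coeff D = 1" "degree D = p ^ (k - 1)"
    unfolding D_def by (rule gap_monic[where cs = cs and k = k, OF jp cs_top k])+
  have "p ^ (k - 1) \<ge> p" using False jp(3) self_le_power[of p "k - 1"] by simp
  moreover have "p ^ k = p * p ^ (k - 1)" using k by (simp flip: power_Suc)
  moreover have "p * p ^ (k - 1) \<ge> 3 * p ^ (k - 1)" using j by (intro mult_le_mono1) simp
  moreover have "degree G + (j - 1) + p ^ (k - 1) = p ^ k"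
    unfolding G_def by (rule prep_monic[where cs = cs and k = k, OF jp cs_top k])
  ultimately have "degree G > degree D" using j Dm by linarith
  moreover have "D \<noteq> 0" using Dm by auto
  ultimately show ?thesis using dvd_imp_degree_le[of G D] by auto
qed

lemma prod_crit_nonzero: "(\<Prod>l\<in>{j..<p}. crit l) \<noteq> 0"
  using crit_nonzero by simp

lemma generic_point:
  assumes "Q \<noteq> 0"
  shows "\<exists>r t b. pt r t b \<in> stratum j p k \<and> ev2 r t Q \<noteq> 0"
proof (rule ccontr)
  assume none: "\<not> ?thesis"
  define C where "C = (\<Prod>l\<in>{j..<p}. crit l)"
  have "G dvd D * [:C * Q:]"
  proof (rule G_dvd_if_vanishing)
    fix r t b assume "heval (ev2 r t) b G = 0"
    then have "heval (ev2 r t) b D = 0 \<or> ev2 r t C = 0 \<or> ev2 r t Q = 0"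
      using none pt_in_stratum_iff unfolding C_def by blast
    then show "heval (ev2 r t) b (D * [:C * Q:]) = 0"
      by (auto simp: ring_map.mult[OF ring_map_heval[OF ring_map_ev2]] ring_map.mult[OF ring_map_ev2] ring_map_ev2
          simp del: mult_pCons_right)
  qed
  then have "G dvd D \<or> G dvd [:C * Q:]" using prime_G by (simp only: prime_elem_dvd_mult_iff)
  then show False
    using not_G_dvd_D not_G_dvd_const[of "C * Q"] prod_crit_nonzero assms by (auto simp: C_def)
qed

lemma vanishing_product:
  assumes P: "P \<in> poly_funs {1..p}" and Q: "Q \<in> poly_funs {1..p}"
    and van: "\<And>r t b. pt r t b \<in> stratum j p k \<Longrightarrow> P (emb j p (pt r t b)) * Q (emb j p (pt r t b)) = 0"
  shows "(\<forall>r t b. pt r t b \<in> stratum j p k \<longrightarrow> P (emb j p (pt r t b)) = 0) \<or>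
    (\<forall>r t b. pt r t b \<in> stratum j p k \<longrightarrow> Q (emb j p (pt r t b)) = 0)"
proof -
  obtain P' Q' where P': "\<And>r t b. heval (ev2 r t) b P' = P (emb j p (pt r t b))"
    and Q': "\<And>r t b. heval (ev2 r t) b Q' = Q (emb j p (pt r t b))"
    using poly_funs_lift[OF P] poly_funs_lift[OF Q] by blast
  define C where "C = (\<Prod>l\<in>{j..<p}. crit l)"
  note hm = ring_map.mult[OF ring_map_heval[OF ring_map_ev2]]
  have "G dvd P' * Q' * (D * [:C:])"
  proof (rule G_dvd_if_vanishing)
    fix r t b assume "heval (ev2 r t) b G = 0"
    then have "heval (ev2 r t) b D = 0 \<or> ev2 r t C = 0 \<or> P (emb j p (pt r t b)) * Q (emb j p (pt r t b)) = 0"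
      using van pt_in_stratum_iff unfolding C_def by blast
    then show "heval (ev2 r t) b (P' * Q' * (D * [:C:])) = 0"
      unfolding hm P' Q' by (auto simp: ring_map_ev2)
  qed
  then have "G dvd P' \<or> G dvd Q' \<or> G dvd D \<or> G dvd [:C:]"
    using prime_G by (auto simp only: prime_elem_dvd_mult_iff)
  then have "G dvd P' \<or> G dvd Q'"
    using not_G_dvd_D not_G_dvd_const prod_crit_nonzero by (auto simp: C_def)
  then show ?thesis
    using pt_in_stratum_iff unfolding P'[symmetric] Q'[symmetric]
    by (metis dvd_def hm mult_zero_left)
qed

end

section \<open>Irreducibility of the slices\<close>

text \<open>
  The fixed values are those of the base point of \<open>absolutely_irreducible_prep\<close>, so for \<open>m \<ge> 1\<close> a path
  inside the slice can start on the curve that is known to be irreducible.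
\<close>

definition slice :: "nat \<Rightarrow> nat \<Rightarrow> nat \<Rightarrow> nat \<Rightarrow> (nat \<Rightarrow> complex) set" where
  "slice j p k m = {x \<in> stratum j p k. \<forall>l\<in>{j+m..<p}. x l = fact (p - 1) * of_nat l}"

context
  fixes j p k :: nat
  assumes p: "prime p" and j: "2 \<le> j" "j < p"
begin

text \<open>
  A quadratic path starting at the base point can be chosen to pass through any two points \<open>y\<close>, \<open>z\<close> of the
  slice, and it stays in the slice because a coordinate with three equal values is constant. If \<open>P\<close> and \<open>Q\<close>
  were nonzero at \<open>y\<close> and \<open>z\<close>, their product could not vanish on the irreducible surface over this path.
\<close>

lemma slice_irreducible:
  assumes m: "1 \<le> m" and P: "P \<in> poly_funs {1..p}" and Q: "Q \<in> poly_funs {1..p}"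
    and van: "\<And>x. x \<in> slice j p k m \<Longrightarrow> P (emb j p x) * Q (emb j p x) = 0"
  shows "(\<forall>x\<in>slice j p k m. P (emb j p x) = 0) \<or> (\<forall>x\<in>slice j p k m. Q (emb j p x) = 0)"
proof (rule ccontr)
  assume "\<not> ?thesis"
  then obtain y z where y: "y \<in> slice j p k m" "P (emb j p y) \<noteq> 0"
    and z: "z \<in> slice j p k m" "Q (emb j p z) \<noteq> 0" by blast
  define N :: complex where "N = fact (p - 1)"
  \<comment> \<open>Lagrange interpolation: base point at \<open>r = 0\<close>, \<open>y\<close> at \<open>r = 1\<close>, \<open>z\<close> at \<open>r = 2\<close>.\<close>
  define \<pi> where "\<pi> l = smult (N * of_nat l / 2) ([:-1, 1:] * [:-2, 1:]) + smult (- y l) ([:0, 1:] * [:-2, 1:])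
      + smult (z l / 2) ([:0, 1:] * [:-1, 1:])" for l
  have \<pi>_poly: "poly (\<pi> l) r = N * of_nat l / 2 * ((r - 1) * (r - 2)) - y l * (r * (r - 2)) + z l / 2 * (r * (r - 1))" for l r
    by (simp add: \<pi>_def field_simps)
  interpret critical_path j p k \<pi>
    by unfold_locales (use p j in \<open>auto simp: \<pi>_poly N_def\<close>)
  have N: "N \<noteq> 0" by (simp add: N_def)
  have pt_slice: "pt r t b \<in> slice j p k m" if "pt r t b \<in> stratum j p k" for r t b
  proof -
    have "pt r t b l = fact (p - 1) * of_nat l" if l: "l \<in> {j+m..<p}" for l
    proof -
      have yz: "y l = N * of_nat l" "z l = N * of_nat l" using y z l by (auto simp: slice_def N_def)
      have "poly (\<pi> l) r = N * of_nat l * ((r - 1) * (r - 2) / 2 - r * (r - 2) + r * (r - 1) / 2)"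
        by (simp only: \<pi>_poly yz) (simp add: field_simps)
      also have "(r - 1) * (r - 2) / 2 - r * (r - 2) + r * (r - 1) / 2 = 1"
        by (simp add: field_simps)
      finally have "poly (\<pi> l) r = N * of_nat l" by simp
      then show ?thesis using l m by (auto simp: pt_def N_def)
    qed
    with that show ?thesis by (auto simp: slice_def)
  qed
  have at: "emb j p (pt r (x j / N) (x p)) = emb j p x" "pt r (x j / N) (x p) \<in> stratum j p k"
    if "x \<in> slice j p k m" "\<And>l. poly (\<pi> l) r = x l" for r x
  proof -
    have eq: "pt r (x j / N) (x p) l = x l" if "l \<in> {j..p}" for l
      using that \<open>\<And>l. poly (\<pi> l) r = x l\<close> N by (simp add: pt_def N_def)
    show "emb j p (pt r (x j / N) (x p)) = emb j p x"
      by (rule cong_on_coordinates[OF eq]) (use j in auto)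
    show "pt r (x j / N) (x p) \<in> stratum j p k"
      using cong_on_coordinates(2)[OF eq] that(1) j by (auto simp: slice_def)
  qed
  have 1: "poly (\<pi> l) 1 = y l" and 2: "poly (\<pi> l) 2 = z l" for l by (simp_all add: \<pi>_poly)
  have "(\<forall>r t b. pt r t b \<in> stratum j p k \<longrightarrow> P (emb j p (pt r t b)) = 0) \<or>
    (\<forall>r t b. pt r t b \<in> stratum j p k \<longrightarrow> Q (emb j p (pt r t b)) = 0)"
    by (rule vanishing_product[OF P Q]) (use van pt_slice in blast)
  then show False
    using at[OF y(1) 1] at[OF z(1) 2] y(2) z(2) by metis
qed

text \<open>
  On a path that moves all free variables, avoiding the finitely many values in \<open>B\<close> is a nonzero
  polynomial condition on \<open>(r, t)\<close>.
\<close>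

lemma slice_generic_point:
  assumes fin: "finite B" and m: "1 \<le> m"
  shows "\<exists>x\<in>slice j p k m. \<forall>l\<in>{j..<p}. l < j + m \<longrightarrow> x l \<notin> B"
proof -
  define \<pi> :: "nat \<Rightarrow> complex poly" where
    "\<pi> l = [:fact (p - 1) * of_nat l, if l < j + m then 1 else 0:]" for l
  interpret critical_path j p k \<pi>
    by unfold_locales (use p j in \<open>auto simp: \<pi>_def\<close>)
  define Q where "Q = (\<Prod>l\<in>{j..<p} \<inter> {..<j+m}. \<Prod>\<beta>\<in>B. crit l - [:[:\<beta>:]:])"
  have "crit l - [:[:\<beta>:]:] \<noteq> 0" if "l < j + m" for l \<beta>
    using that by (simp add: crit_def \<pi>_def)
  then have "Q \<noteq> 0" using fin unfolding Q_def by simp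
  then obtain r t b where x: "pt r t b \<in> stratum j p k" and Q: "ev2 r t Q \<noteq> 0"
    using generic_point by blast
  interpret e: ring_map "ev2 r t" by (rule ring_map_ev2)
  have "pt r t b l \<notin> B" if "l \<in> {j..<p}" "l < j + m" for l
  proof
    assume "pt r t b l \<in> B"
    moreover have "ev2 r t (crit l - [:[:pt r t b l:]:]) = 0"
      using ev2_crit[of l r t b] that by simp
    ultimately have "ev2 r t Q = 0"
      unfolding Q_def e.prod using that fin by (intro prod_zero bexI[of _ l]) auto
    with Q show False by simp
  qed
  moreover have "pt r t b \<in> slice j p k m"
    using x m by (auto simp: slice_def pt_def \<pi>_def)
  ultimately show ?thesis using m by (intro bexI[of _ "pt r t b"]) auto
qed

end

section \<open>Algebraic dependence on the stratum\<close>

lemma poly_funs_sum: "(\<And>i. i \<in> A \<Longrightarrow> f i \<in> poly_funs I) \<Longrightarrow> (\<lambda>x. \<Sum>i\<in>A. f i x) \<in> poly_funs I"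
  by (induction A rule: infinite_finite_induct) (auto intro: poly_funs.intros)

lemma poly_funs_prod: "(\<And>i. i \<in> A \<Longrightarrow> f i \<in> poly_funs I) \<Longrightarrow> (\<lambda>x. \<Prod>i\<in>A. f i x) \<in> poly_funs I"
  by (induction A rule: infinite_finite_induct) (auto intro: poly_funs.intros)

definition coeff_funs :: "'i set \<Rightarrow> (('i \<Rightarrow> complex) \<Rightarrow> complex poly) set" where
  "coeff_funs I = {P. \<forall>n. (\<lambda>x. coeff (P x) n) \<in> poly_funs I}"

lemma coeff_funs_add: "P \<in> coeff_funs I \<Longrightarrow> Q \<in> coeff_funs I \<Longrightarrow> (\<lambda>x. P x + Q x) \<in> coeff_funs I"
  by (auto simp: coeff_funs_def intro: poly_funs.intros)

lemma coeff_funs_mult: "P \<in> coeff_funs I \<Longrightarrow> Q \<in> coeff_funs I \<Longrightarrow> (\<lambda>x. P x * Q x) \<in> coeff_funs I"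
  by (auto simp: coeff_funs_def coeff_mult intro!: poly_funs_sum intro: poly_funs.intros)

lemma coeff_funs_const: "(\<lambda>x. P) \<in> coeff_funs I"
  by (auto simp: coeff_funs_def intro: poly_funs.intros)

lemma coeff_funs_pCons: "f \<in> poly_funs I \<Longrightarrow> P \<in> coeff_funs I \<Longrightarrow> (\<lambda>x. pCons (f x) (P x)) \<in> coeff_funs I"
  unfolding coeff_funs_def
proof (intro CollectI allI)
  fix n assume "f \<in> poly_funs I" "P \<in> {P. \<forall>n. (\<lambda>x. coeff (P x) n) \<in> poly_funs I}"
  then show "(\<lambda>x. coeff (pCons (f x) (P x)) n) \<in> poly_funs I" by (cases n) auto
qed

lemma coeff_funs_sum: "(\<And>i. i \<in> A \<Longrightarrow> f i \<in> coeff_funs I) \<Longrightarrow> (\<lambda>x. \<Sum>i\<in>A. f i x) \<in> coeff_funs I"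
  by (induction A rule: infinite_finite_induct) (auto intro: coeff_funs_const coeff_funs_add)

lemma coeff_funs_prod: "(\<And>i. i \<in> A \<Longrightarrow> f i \<in> coeff_funs I) \<Longrightarrow> (\<lambda>x. \<Prod>i\<in>A. f i x) \<in> coeff_funs I"
  by (induction A rule: infinite_finite_induct) (auto intro: coeff_funs_const coeff_funs_mult)

lemma coeff_funs_power: "P \<in> coeff_funs I \<Longrightarrow> (\<lambda>x. P x ^ n) \<in> coeff_funs I"
  by (induction n) (auto intro: coeff_funs_const coeff_funs_mult)

lemma crit_coeffs_poly_funs: "(\<lambda>x. crit_coeffs j p x i) \<in> poly_funs {j..<p}"
proof -
  have "(\<lambda>x. \<Prod>l\<in>{j..<p}. [:- 1 * x l, 1:]) \<in> coeff_funs {j..<p}"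
    by (intro coeff_funs_prod coeff_funs_pCons coeff_funs_const poly_funs.mult poly_funs.const poly_funs.coord)
  then have "\<forall>n. (\<lambda>x :: nat \<Rightarrow> complex. coeff (\<Prod>l\<in>{j..<p}. [:- x l, 1:]) n) \<in> poly_funs {j..<p}"
    by (simp add: coeff_funs_def)
  then have "(\<lambda>x :: nat \<Rightarrow> complex. coeff (\<Prod>l\<in>{j..<p}. [:- x l, 1:]) (i - j)) \<in> poly_funs {j..<p}"
    by (rule spec)
  then show ?thesis unfolding crit_coeffs_def by (intro poly_funs.mult poly_funs.const)
qed

lemma prep_coeff_funs:
  "(\<lambda>x. prep j p (\<lambda>i. [:crit_coeffs j p x i:]) [:0, 1:] k) \<in> coeff_funs {j..<p}"
proof -
  have c: "(\<lambda>x. [:crit_coeffs j p x i:]) \<in> coeff_funs {j..<p}" for i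
    by (intro coeff_funs_pCons crit_coeffs_poly_funs coeff_funs_const)
  have s: "(\<lambda>x. scaled_orb j p (\<lambda>i. [:crit_coeffs j p x i:]) [:0, 1:] l) \<in> coeff_funs {j..<p}" for l
  proof (induction l)
    case (Suc l)
    then show ?case unfolding scaled_orb.simps
      by (intro coeff_funs_add coeff_funs_sum coeff_funs_mult coeff_funs_power c coeff_funs_const)
  qed (simp add: coeff_funs_const)
  show ?thesis
  proof (cases "k = 0")
    case False
    then show ?thesis unfolding prep_def
      by (simp only: if_False)
        (intro coeff_funs_sum coeff_funs_mult coeff_funs_power c s coeff_funs_const)
  qed (simp add: prep_def coeff_funs_const)
qed

lemma stratum_alg_dependent:
  assumes j: "2 \<le> j" "j < p" and hs: "set hs \<subseteq> poly_funs {j..p}" "length hs = Suc (p - j)"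
  shows "alg_dependent hs (stratum j p k)"
proof -
  define G where "G x = prep j p (\<lambda>i. [:crit_coeffs j p x i:]) [:0, 1:] k" for x
  define M where "M = prep_degree j p k"
  have lc: "coeff (G x) M = 1" and deg: "degree (G x) = M" and M0: "0 < M" for x
  proof -
    have "crit_coeffs j p x p = 1" using j by (intro crit_coeffs_top) auto
    from prep_poly_monic[OF j, of "crit_coeffs j p x" k, OF this]
    show "coeff (G x) M = 1" "degree (G x) = M" "0 < M" unfolding G_def M_def by auto
  qed
  interpret monic_extension "stratum j p k" "{j..<p}" p M by unfold_locales (use M0 in auto)
  have box_pf: "\<exists>D. f \<in> box D" if "f \<in> poly_funs {j..<p}" for f
    using that
  proof induction
    case (add f g)
    then obtain D E where "f \<in> box D" "g \<in> box E" by blast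
    then have "f \<in> box (D + E)" "g \<in> box (D + E)" by (auto intro: box_mono)
    then show ?case using box_add by blast
  qed (use box_const box_coord box_mult in blast)+
  define g where "g i x = - 1 * coeff (G x) i" for i x
  have "\<exists>D. g i \<in> box D" for i
    unfolding g_def using prep_coeff_funs[of j p k]
    by (intro box_pf poly_funs.mult poly_funs.const) (simp add: coeff_funs_def G_def)
  then obtain d where d: "\<And>i. g i \<in> box (d i)" by metis
  have gD: "g i \<in> box (\<Sum>i<M. d i)" if "i < M" for i
    using d[of i] by (rule box_mono) (use that in \<open>auto intro: member_le_sum\<close>)
  have rel: "x p ^ M = (\<Sum>i<M. g i x * x p ^ i)" if x: "x \<in> stratum j p k" for x
  proof -
    have "0 = prep j p (crit_coeffs j p x) (x p) k" using x by (simp add: stratum_def)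
    also have "\<dots> = poly (G x) (x p)"
      using ring_map.prep[OF ring_map_poly[of "x p"], of j p "\<lambda>i. [:crit_coeffs j p x i:]" "[:0, 1:]" k]
      by (simp add: G_def)
    also have "\<dots> = (\<Sum>i<M. coeff (G x) i * x p ^ i) + x p ^ M"
      unfolding poly_altdef deg using lc[of x] by (simp flip: lessThan_Suc_atMost)
    finally show ?thesis by (simp add: g_def sum_negf eq_neg_iff_add_eq_0 add.commute)
  qed
  have "insert p {j..<p} = {j..p}" using j by auto
  then show ?thesis
    using poly_funs_alg_dependent[OF gD rel, of hs] hs by simp
qed

section \<open>The topology of the moduli space\<close>

abbreviation param_topology :: "nat \<Rightarrow> (nat \<Rightarrow> complex) topology" where
  "param_topology d \<equiv> subtopology (zariski {1..d}) (param_space d)"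

lemma topspace_param_topology [simp]: "topspace (param_topology d) = param_space d"
  by (auto simp: topspace_zariski param_space_def)

lemma closedin_param_topology:
  "closedin (param_topology d) S \<longleftrightarrow> (\<exists>F\<subseteq>poly_funs {1..d}. S = {v \<in> param_space d. \<forall>f\<in>F. f v = 0})"
proof -
  have "zero_locus {1..d} F \<inter> param_space d = {v \<in> param_space d. \<forall>f\<in>F. f v = 0}" for F
    by (auto simp: zero_locus_def param_space_def)
  then show ?thesis unfolding closedin_subtopology closedin_zariski by metis
qed

lemma closedin_poly_zeros:
  "h \<in> poly_funs {1..d} \<Longrightarrow> closedin (param_topology d) {v \<in> param_space d. h v = 0}"
  unfolding closedin_param_topology by (intro exI[of _ "{h}"]) auto

lemma topspace_moduli: "2 \<le> d \<Longrightarrow> topspace (moduli_topology d) = moduli_space d"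
  unfolding moduli_topology_def by (rule topspace_quotient_topology) (auto intro: param_map_in)

lemma closedin_moduli:
  assumes "2 \<le> d"
  shows "closedin (moduli_topology d) A \<longleftrightarrow>
    A \<subseteq> moduli_space d \<and> closedin (param_topology d) {v \<in> param_space d. param_map d v \<in> A}"
proof -
  have "param_space d - {v \<in> param_space d. param_map d v \<in> A}
      = {v \<in> param_space d. param_map d v \<in> moduli_space d - A}"
    using param_map_in[OF assms] by auto
  moreover have "openin (moduli_topology d) U \<longleftrightarrow> U \<subseteq> moduli_space d \<and>
      openin (param_topology d) {v \<in> param_space d. param_map d v \<in> U}" for U
    unfolding moduli_topology_def openin_quotient_topology topspace_param_topology ..
  ultimately show ?thesis
    unfolding closedin_def topspace_moduli[OF assms] topspace_param_topology by auto
qed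

section \<open>Invariant polynomials\<close>

lemma poly_funs_diff: "f \<in> poly_funs I \<Longrightarrow> g \<in> poly_funs I \<Longrightarrow> (\<lambda>x. f x - g x) \<in> poly_funs I"
  using poly_funs.add[of f I "\<lambda>x. - 1 * g x"] poly_funs.mult[OF poly_funs.const[of "- 1"], of g I] by simp

lemma poly_funs_power: "f \<in> poly_funs I \<Longrightarrow> (\<lambda>x. f x ^ n) \<in> poly_funs I"
  by (induction n) (auto intro: poly_funs.intros)

lemma poly_funs_compose:
  assumes "h \<in> poly_funs I" "\<And>i. i \<in> I \<Longrightarrow> (\<lambda>x. g x i) \<in> poly_funs J"
  shows "(\<lambda>x. h (g x)) \<in> poly_funs J"
  using assms(1) by induction (auto intro: poly_funs.intros assms(2))

lemma finite_group_elems: "2 \<le> d \<Longrightarrow> finite (group_elems d)"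
  unfolding group_elems_def using finite_roots_unity[of "d - 1", where 'a = complex] finite_permutations[of "{2..d-1}"]
  by (auto simp: Collect_conj_eq)

lemma poly_funs_act:
  assumes "2 \<le> d" "\<gamma> \<in> group_elems d" "h \<in> poly_funs {1..d}"
  shows "(\<lambda>v. h (act d \<gamma> v)) \<in> poly_funs {1..d}"
proof (rule poly_funs_compose[OF assms(3)])
  fix i assume i: "i \<in> {1..d}"
  have "snd \<gamma> permutes {1..d}"
    using assms(1,2) permutes_fixes_ends(4) by (auto simp: group_elems_def)
  then have "snd \<gamma> i \<in> {1..d}" using i by (metis permutes_in_image)
  then show "(\<lambda>v. act d \<gamma> v i) \<in> poly_funs {1..d}"
    using i unfolding act_def by (simp add: poly_funs.intros)
qed

text \<open>
  The product over the group is invariant because composition with a fixed element permutes the group.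
\<close>

lemma prod_group_elems_act:
  fixes h :: "(nat \<Rightarrow> complex) \<Rightarrow> complex"
  assumes d: "2 \<le> d" and \<gamma>0: "\<gamma>0 \<in> group_elems d"
  shows "(\<Prod>\<gamma>\<in>group_elems d. h (act d \<gamma> (act d \<gamma>0 v))) = (\<Prod>\<gamma>\<in>group_elems d. h (act d \<gamma> v))"
proof -
  define m where "m \<gamma> = (fst \<gamma> * fst \<gamma>0, snd \<gamma>0 \<circ> snd \<gamma>)" for \<gamma> :: "complex \<times> (nat \<Rightarrow> nat)"
  have g0: "fst \<gamma>0 ^ (d - 1) = 1" "snd \<gamma>0 permutes {2..d-1}" using \<gamma>0 by (auto simp: group_elems_def)
  then have f0: "fst \<gamma>0 \<noteq> 0" using d by (auto simp: power_0_left)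
  have sub: "m ` group_elems d \<subseteq> group_elems d"
    using g0 by (auto simp: m_def group_elems_def power_mult_distrib intro: permutes_compose)
  have inj: "inj_on m (group_elems d)"
  proof (rule inj_onI)
    fix \<gamma> \<gamma>' assume eq: "m \<gamma> = m \<gamma>'"
    then have "fst \<gamma> = fst \<gamma>'" using f0 by (simp add: m_def)
    moreover have "snd \<gamma> = snd \<gamma>'"
      using eq permutes_inj[OF g0(2)] by (auto simp: m_def fun_eq_iff inj_eq)
    ultimately show "\<gamma> = \<gamma>'" by (rule prod_eqI)
  qed
  have "bij_betw m (group_elems d) (group_elems d)"
    using endo_inj_surj[OF finite_group_elems[OF d] sub inj] inj by (simp add: bij_betw_def)
  then have "(\<Prod>\<gamma>\<in>group_elems d. h (act d \<gamma> v)) = (\<Prod>\<gamma>\<in>group_elems d. h (act d (m \<gamma>) v))"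
    by (rule prod.reindex_bij_betw[symmetric])
  also have "\<dots> = (\<Prod>\<gamma>\<in>group_elems d. h (act d \<gamma> (act d \<gamma>0 v)))"
  proof (rule prod.cong[OF refl])
    fix \<gamma> assume \<gamma>: "\<gamma> \<in> group_elems d"
    then have "snd \<gamma> permutes {1..d}"
      using d permutes_fixes_ends(4) by (auto simp: group_elems_def)
    then have "snd \<gamma> i \<in> {1..d}" if "i \<in> {1..d}" for i using that by (metis permutes_in_image)
    then have "act d (m \<gamma>) v = act d \<gamma> (act d \<gamma>0 v)"
      unfolding act_def m_def by (intro restrict_ext) (simp add: mult.assoc)
    then show "h (act d (m \<gamma>) v) = h (act d \<gamma> (act d \<gamma>0 v))" by simp
  qed
  finally show ?thesis by simp
qed

text \<open>
  On the moduli space this is the coordinate ring of \<open>V / G\<close>: the polynomial \<open>h\<close> is constant on the orbits in \<open>V\<close>.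
\<close>

definition regular_funs :: "nat \<Rightarrow> ((complex poly \<times> complex) set \<Rightarrow> complex) set" where
  "regular_funs d = {g. \<exists>h\<in>poly_funs {1..d}. \<forall>v\<in>param_space d. g (param_map d v) = h v}"

text \<open>
  The norm of a polynomial over the group is invariant, and so it descends to the moduli space.
\<close>

lemma regular_norm:
  assumes d: "2 \<le> d" and h: "h \<in> poly_funs {1..d}"
  shows "\<exists>g\<in>regular_funs d. \<forall>v\<in>param_space d. g (param_map d v) = (\<Prod>\<gamma>\<in>group_elems d. h (act d \<gamma> v))"
proof -
  define n where "n v = (\<Prod>\<gamma>\<in>group_elems d. h (act d \<gamma> v))" for v
  define g where "g c = n (SOME v. v \<in> param_space d \<and> param_map d v = c)" for c
  have gn: "g (param_map d v) = n v" if v: "v \<in> param_space d" for v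
  proof -
    let ?w = "SOME w. w \<in> param_space d \<and> param_map d w = param_map d v"
    have w: "?w \<in> param_space d" "param_map d ?w = param_map d v"
      using someI[of "\<lambda>w. w \<in> param_space d \<and> param_map d w = param_map d v" v] v by auto
    then obtain \<gamma>0 where "\<gamma>0 \<in> group_elems d" "?w = act d \<gamma>0 v"
      using param_map_eq_imp_act[OF d v w(1)] by auto
    then show ?thesis using prod_group_elems_act[OF d, of \<gamma>0 h v] by (simp add: g_def n_def)
  qed
  have "n \<in> poly_funs {1..d}" unfolding n_def by (intro poly_funs_prod poly_funs_act d h)
  with gn have "g \<in> regular_funs d" unfolding regular_funs_def by blast
  with gn show ?thesis unfolding n_def by (intro bexI[of _ g]) auto
qed

lemma id_in_group_elems: "(1, id) \<in> group_elems d"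
  by (simp add: group_elems_def permutes_id)

lemma act_id: "v \<in> param_space d \<Longrightarrow> act d (1, id) v = v"
  by (auto simp: act_def param_space_def fun_eq_iff PiE_def extensional_def)

text \<open>
  Let \<open>h\<close> vanish on the preimage of a closed set \<open>Z\<close>, but not at a point over \<open>x\<close>, where it has the value \<open>c\<close>.
  The norm of \<open>h - c\<close> is constant on \<open>Z\<close>, equal to the power \<open>(- c) ^ card\<close> for the order of the group,
  and it vanishes at \<open>x\<close>. Subtracting that power gives an invariant function that separates \<open>x\<close> from \<open>Z\<close>.
\<close>

lemma separating_functions_moduli:
  assumes d: "2 \<le> d" and L: "L \<subseteq> moduli_space d"
  shows "separating_functions (subtopology (moduli_topology d) L) (regular_funs d)"
proof
  show "(\<lambda>x. c) \<in> regular_funs d" for c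
    unfolding regular_funs_def by (auto intro!: bexI[of _ "\<lambda>_. c"] poly_funs.const)
  show "(\<lambda>x. f x + g x) \<in> regular_funs d" if fg: "f \<in> regular_funs d" "g \<in> regular_funs d" for f g
  proof -
    obtain h h' where "h \<in> poly_funs {1..d}" "h' \<in> poly_funs {1..d}" "\<forall>v\<in>param_space d. f (param_map d v) = h v"
      "\<forall>v\<in>param_space d. g (param_map d v) = h' v"
      using fg unfolding regular_funs_def by blast
    then show ?thesis unfolding regular_funs_def by (auto intro!: bexI[of _ "\<lambda>v. h v + h' v"] poly_funs.add)
  qed
  show "(\<lambda>x. f x * g x) \<in> regular_funs d" if fg: "f \<in> regular_funs d" "g \<in> regular_funs d" for f g
  proof -
    obtain h h' where "h \<in> poly_funs {1..d}" "h' \<in> poly_funs {1..d}" "\<forall>v\<in>param_space d. f (param_map d v) = h v"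
      "\<forall>v\<in>param_space d. g (param_map d v) = h' v"
      using fg unfolding regular_funs_def by blast
    then show ?thesis unfolding regular_funs_def by (auto intro!: bexI[of _ "\<lambda>v. h v * h' v"] poly_funs.mult)
  qed
  have top: "topspace (subtopology (moduli_topology d) L) = L"
    using L by (auto simp: topspace_moduli[OF d])
  show "closedin (subtopology (moduli_topology d) L) {x \<in> topspace (subtopology (moduli_topology d) L). f x = 0}"
    if f: "f \<in> regular_funs d" for f
  proof -
    obtain h where h: "h \<in> poly_funs {1..d}" "\<forall>v\<in>param_space d. f (param_map d v) = h v"
      using f unfolding regular_funs_def by blast
    have "{v \<in> param_space d. param_map d v \<in> {c \<in> moduli_space d. f c = 0}} = {v \<in> param_space d. h v = 0}"
      using h(2) param_map_in[OF d] by auto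
    then have "closedin (moduli_topology d) {c \<in> moduli_space d. f c = 0}"
      unfolding closedin_moduli[OF d] using closedin_poly_zeros[OF h(1)] by auto
    moreover have "{x \<in> L. f x = 0} = {c \<in> moduli_space d. f c = 0} \<inter> L" using L by auto
    ultimately show ?thesis unfolding top closedin_subtopology by blast
  qed
  show "\<exists>f\<in>regular_funs d. (\<forall>z\<in>Z. f z = 0) \<and> f x \<noteq> 0"
    if Z: "closedin (subtopology (moduli_topology d) L) Z" and x: "x \<in> topspace (subtopology (moduli_topology d) L)" "x \<notin> Z"
    for Z x
  proof -
    obtain T where T: "closedin (moduli_topology d) T" "Z = T \<inter> L"
      using Z unfolding closedin_subtopology by blast
    have xT: "x \<notin> T" and xM: "x \<in> moduli_space d" using x T L unfolding top by auto
    obtain v0 where v0: "v0 \<in> param_space d" "param_map d v0 = x" using param_map_surj[OF d xM] by blast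
    obtain F where F: "F \<subseteq> poly_funs {1..d}"
      "{v \<in> param_space d. param_map d v \<in> T} = {v \<in> param_space d. \<forall>f\<in>F. f v = 0}"
      using T(1) unfolding closedin_moduli[OF d] closedin_param_topology by blast
    then obtain h where h: "h \<in> F" "h v0 \<noteq> 0" using v0 xT by auto
    have hT: "h v = 0" if "v \<in> param_space d" "param_map d v \<in> T" for v
      using F(2) h(1) that by blast
    define c where "c = h v0"
    have "(\<lambda>v. h v - c) \<in> poly_funs {1..d}"
      using F(1) h(1) by (intro poly_funs_diff poly_funs.const) auto
    from regular_norm[OF d this] obtain g where g: "g \<in> regular_funs d"
      "\<And>v. v \<in> param_space d \<Longrightarrow> g (param_map d v) = (\<Prod>\<gamma>\<in>group_elems d. h (act d \<gamma> v) - c)" by blast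
    define f where "f y = g y - (- c) ^ card (group_elems d)" for y
    have "f \<in> regular_funs d"
    proof -
      obtain u where "u \<in> poly_funs {1..d}" "\<forall>v\<in>param_space d. g (param_map d v) = u v"
        using g(1) unfolding regular_funs_def by blast
      then show ?thesis unfolding regular_funs_def f_def
        by (auto intro!: bexI[of _ "\<lambda>v. u v - (- c) ^ card (group_elems d)"] poly_funs_diff poly_funs.const)
    qed
    moreover have "f z = 0" if z: "z \<in> Z" for z
    proof -
      have "z \<in> T" "z \<in> moduli_space d" using z T(2) L by auto
      then obtain v where v: "v \<in> param_space d" "param_map d v = z" using param_map_surj[OF d] by blast
      have "h (act d \<gamma> v) = 0" if "\<gamma> \<in> group_elems d" for \<gamma>
        by (rule hT) (use act_in_param_space[OF d that v(1)] param_map_act[OF d that v(1)] v(2) \<open>z \<in> T\<close> in auto)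
      then have "g z = (\<Prod>\<gamma>\<in>group_elems d. - c)" using g(2)[OF v(1)] v(2) by simp
      then show ?thesis by (simp add: f_def)
    qed
    moreover have "f x \<noteq> 0"
    proof -
      have "(\<Prod>\<gamma>\<in>group_elems d. h (act d \<gamma> v0) - c) = 0"
        using finite_group_elems[OF d] id_in_group_elems act_id[OF v0(1)]
        by (intro prod_zero bexI[of _ "(1, id)"]) (auto simp: c_def)
      then have "g x = 0" using g(2)[OF v0(1)] v0(2) by simp
      then show ?thesis using h(2) by (simp add: f_def c_def)
    qed
    ultimately show ?thesis by blast
  qed
qed

section \<open>Irreducible subsets\<close>

lemma irreduciblein_closure:
  assumes "irreduciblein X S"
  shows "irreduciblein X (X closure_of S)"
proof -
  have S: "S \<subseteq> topspace X" and ne: "S \<noteq> {}"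
    using assms by (auto simp: irreduciblein_def irreducible_space_def)
  have "topspace (subtopology X S) = S" using S by auto
  then have irr: "\<And>A B. closedin (subtopology X S) A \<Longrightarrow> closedin (subtopology X S) B \<Longrightarrow> A \<union> B = S \<Longrightarrow> A = S \<or> B = S"
    using assms unfolding irreduciblein_def irreducible_space_def by metis
  let ?C = "X closure_of S"
  have sub: "S \<subseteq> ?C" using S by (rule closure_of_subset)
  have top: "topspace (subtopology X ?C) = ?C"
    using closure_of_subset_topspace[of X S] by auto
  have "A = ?C \<or> B = ?C"
    if "closedin (subtopology X ?C) A" "closedin (subtopology X ?C) B" "A \<union> B = ?C" for A B
  proof -
    have A: "closedin X A" and B: "closedin X B"
      using that(1,2) closedin_closed_subtopology[OF closedin_closure_of[of X S]] by blast+
    have "closedin (subtopology X S) (A \<inter> S)" "closedin (subtopology X S) (B \<inter> S)"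
      using A B unfolding closedin_subtopology by blast+
    moreover have "(A \<inter> S) \<union> (B \<inter> S) = S" using that(3) sub by auto
    ultimately have "A \<inter> S = S \<or> B \<inter> S = S" by (rule irr)
    then have "?C \<subseteq> A \<or> ?C \<subseteq> B"
      using closure_of_minimal[OF _ A, of S] closure_of_minimal[OF _ B, of S] by blast
    then show ?thesis using that(3) by auto
  qed
  then show ?thesis
    unfolding irreduciblein_def irreducible_space_def top
    using ne sub closure_of_subset_topspace[of X S] by blast
qed

lemma (in separating_functions) irreduciblein_if_prime:
  assumes S: "S \<subseteq> topspace X" "S \<noteq> {}"
    and prime: "\<And>f g. f \<in> R \<Longrightarrow> g \<in> R \<Longrightarrow> (\<forall>x\<in>S. f x * g x = 0) \<Longrightarrow> (\<forall>x\<in>S. f x = 0) \<or> (\<forall>x\<in>S. g x = 0)"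
  shows "irreduciblein X S"
proof -
  have top: "topspace (subtopology X S) = S" using S by auto
  have "A = S \<or> B = S"
    if A: "closedin (subtopology X S) A" and B: "closedin (subtopology X S) B" and AB: "A \<union> B = S" for A B
  proof (rule ccontr)
    assume ne: "\<not> (A = S \<or> B = S)"
    obtain A' B' where A': "closedin X A'" "A = A' \<inter> S" and B': "closedin X B'" "B = B' \<inter> S"
      using A B unfolding closedin_subtopology by blast
    obtain x y where x: "x \<in> S" "x \<notin> A'" and y: "y \<in> S" "y \<notin> B'" using ne A'(2) B'(2) by auto
    obtain f where f: "f \<in> R" "\<forall>z\<in>A'. f z = 0" "f x \<noteq> 0" using separate[OF A'(1) _ x(2)] x(1) S by blast
    obtain g where g: "g \<in> R" "\<forall>z\<in>B'. g z = 0" "g y \<noteq> 0" using separate[OF B'(1) _ y(2)] y(1) S by blast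
    have "\<forall>z\<in>S. f z * g z = 0" using f(2) g(2) AB A'(2) B'(2) by auto
    then show False using prime[OF f(1) g(1)] f(3) g(3) x(1) y(1) by blast
  qed
  then show ?thesis unfolding irreduciblein_def irreducible_space_def top using S by blast
qed

section \<open>Closed conditions on the moduli space\<close>

lemma iterate_poly_funs:
  assumes "2 \<le> d"
  shows "(\<lambda>v. (poly (param_poly d v) ^^ l) (v 1)) \<in> poly_funs {1..d}"
proof (induction l)
  case 0
  show ?case using assms by (auto intro: poly_funs.coord)
next
  case (Suc l)
  define h where "h = (\<lambda>v. (poly (param_poly d v) ^^ l) (v 1))"
  define c where "c i v = (-1) ^ i * (of_nat d / of_nat (d - i)) * elem_sym {1..d-1} i v" for i and v :: "nat \<Rightarrow> complex"
  have c: "c i \<in> poly_funs {1..d}" for i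
  proof -
    have "l \<in> {1..d}" if "S \<in> {S. S \<subseteq> {1..d-1} \<and> card S = i}" "l \<in> S" for S l
    proof -
      have "l \<in> {1..d-1}" using that by blast
      then show ?thesis unfolding atLeastAtMost_iff by linarith
    qed
    then show ?thesis
      unfolding c_def elem_sym_def
      by (intro poly_funs.mult poly_funs.const poly_funs_sum poly_funs_prod poly_funs.coord)
  qed
  have v1: "(\<lambda>v. v 1) \<in> poly_funs {1..d}" "(\<lambda>v. v d) \<in> poly_funs {1..d}"
    using assms by (auto intro: poly_funs.coord)
  have eq: "(\<lambda>v. (poly (param_poly d v) ^^ Suc l) (v 1)) = (\<lambda>v. h v ^ d + (\<Sum>i=2..d-1. c i v * h v ^ (d - i))
      + ((\<lambda>v. 0) v - v 1 ^ d - (\<Sum>i=2..d-1. c i v * v 1 ^ (d - i)) + v d))"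
    by (simp add: h_def c_def param_poly_def Let_def poly_sum poly_monom fun_eq_iff)
  show ?case
    unfolding eq
    by (intro poly_funs.add poly_funs_diff poly_funs_power poly_funs_sum poly_funs.mult c v1 poly_funs.const)
      (use Suc in \<open>simp_all add: h_def\<close>)
qed

text \<open>
  The bound is shifted by one: the ramification index exceeds by one the number of critical points equal
  to the marked one.
\<close>

definition ramified_locus :: "nat \<Rightarrow> nat \<Rightarrow> (complex poly \<times> complex) set set" where
  "ramified_locus d r = {c \<in> moduli_space d. \<exists>(f, \<alpha>)\<in>c. Suc r \<le> ramification_index f \<alpha>}"

definition fixed_locus :: "nat \<Rightarrow> nat \<Rightarrow> (complex poly \<times> complex) set set" where
  "fixed_locus d l = {c \<in> moduli_space d. \<exists>(f, \<alpha>)\<in>c. (poly f ^^ Suc l) \<alpha> = (poly f ^^ l) \<alpha>}"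

lemma param_map_in_ramified_locus:
  assumes "2 \<le> d" "v \<in> param_space d"
  shows "param_map d v \<in> ramified_locus d r \<longleftrightarrow> r \<le> card {i\<in>{1..d-1}. v i = v 1}"
  unfolding ramified_locus_def
  using class_predicate_iff[OF assms, of "\<lambda>f \<alpha>. Suc r \<le> ramification_index f \<alpha>"]
    ramification_index_affine_conj[OF assms(1)] param_map_in[OF assms]
  by (simp add: ramification_index_param_poly[OF assms] del: One_nat_def)

lemma param_map_in_fixed_locus:
  assumes "2 \<le> d" "v \<in> param_space d"
  shows "param_map d v \<in> fixed_locus d l \<longleftrightarrow>
    (poly (param_poly d v) ^^ Suc l) (v 1) = (poly (param_poly d v) ^^ l) (v 1)"
  unfolding fixed_locus_def
  using class_predicate_iff[OF assms, of "\<lambda>f \<alpha>. (poly f ^^ Suc l) \<alpha> = (poly f ^^ l) \<alpha>"]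
    iterate_eq_affine_conj[OF assms(1), where l = "Suc l" and m = l] param_map_in[OF assms]
  by (simp del: One_nat_def funpow.simps)

lemma closedin_ramified_locus:
  assumes d: "2 \<le> d"
  shows "closedin (moduli_topology d) (ramified_locus d r)"
proof -
  have "{v \<in> param_space d. param_map d v \<in> ramified_locus d r}
      = \<Union>((\<lambda>S. {v \<in> param_space d. \<forall>i\<in>S. v i = v 1}) ` {S. S \<subseteq> {1..d-1} \<and> card S = r})"
  proof (intro set_eqI iffI)
    fix v assume "v \<in> {v \<in> param_space d. param_map d v \<in> ramified_locus d r}"
    then have v: "v \<in> param_space d" "r \<le> card {i\<in>{1..d-1}. v i = v 1}"
      using param_map_in_ramified_locus[OF d] by auto
    obtain S where "S \<subseteq> {i\<in>{1..d-1}. v i = v 1}" "card S = r"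
      using obtain_subset_with_card_n[OF v(2)] by blast
    with v(1) show "v \<in> \<Union>((\<lambda>S. {v \<in> param_space d. \<forall>i\<in>S. v i = v 1}) ` {S. S \<subseteq> {1..d-1} \<and> card S = r})"
      by blast
  next
    fix v assume "v \<in> \<Union>((\<lambda>S. {v \<in> param_space d. \<forall>i\<in>S. v i = v 1}) ` {S. S \<subseteq> {1..d-1} \<and> card S = r})"
    then obtain S where S: "v \<in> param_space d" "S \<subseteq> {i\<in>{1..d-1}. v i = v 1}" "card S = r" by blast
    have "card S \<le> card {i\<in>{1..d-1}. v i = v 1}" by (rule card_mono[OF _ S(2)]) simp
    then have "r \<le> card {i\<in>{1..d-1}. v i = v 1}" using S(3) by simp
    with S(1) show "v \<in> {v \<in> param_space d. param_map d v \<in> ramified_locus d r}"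
      using param_map_in_ramified_locus[OF d S(1)] by auto
  qed
  moreover have "closedin (param_topology d) {v \<in> param_space d. \<forall>i\<in>S. v i = v 1}" if S: "S \<subseteq> {1..d-1}" for S
  proof -
    have "(\<lambda>v. v i - v 1) \<in> poly_funs {1..d}" if "i \<in> S" for i :: nat
    proof -
      have "i \<in> {1..d-1}" using S that by blast
      then have "i \<in> {1..d}" "1 \<in> {1..d}" using d unfolding atLeastAtMost_iff by linarith+
      then show ?thesis by (intro poly_funs_diff poly_funs.coord)
    qed
    then show ?thesis unfolding closedin_param_topology
      by (intro exI[of _ "(\<lambda>i v. v i - v 1) ` S"]) auto
  qed
  then have "closedin (param_topology d)
      (\<Union>((\<lambda>S. {v \<in> param_space d. \<forall>i\<in>S. v i = v 1}) ` {S. S \<subseteq> {1..d-1} \<and> card S = r}))"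
    by (intro closedin_Union finite_imageI) auto
  ultimately show ?thesis unfolding closedin_moduli[OF d] by (auto simp: ramified_locus_def)
qed

lemma closedin_fixed_locus:
  assumes d: "2 \<le> d"
  shows "closedin (moduli_topology d) (fixed_locus d l)"
proof -
  have "{v \<in> param_space d. param_map d v \<in> fixed_locus d l}
      = {v \<in> param_space d. (poly (param_poly d v) ^^ Suc l) (v 1) - (poly (param_poly d v) ^^ l) (v 1) = 0}"
    using param_map_in_fixed_locus[OF d] by (auto simp del: funpow.simps One_nat_def)
  then show ?thesis
    unfolding closedin_moduli[OF d]
    using closedin_poly_zeros[OF poly_funs_diff[OF iterate_poly_funs[OF d, of "Suc l"] iterate_poly_funs[OF d, of l]]]
    by (auto simp: fixed_locus_def simp del: funpow.simps One_nat_def)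
qed

text \<open>
  A high ramification index at the marked point and being fixed after a given number of steps are closed
  conditions. The locus is a difference of sets defined by such conditions.
\<close>

lemma locally_closedin_preperiodic_locus:
  assumes d: "2 \<le> d" and i: "1 \<le> i"
  shows "locally_closedin (moduli_topology d) (preperiodic_locus d k 1 i)"
proof -
  let ?M = "moduli_topology d"
  define C where "C = ramified_locus d (i - 1) \<inter> fixed_locus d k"
  define E where "E = ramified_locus d i \<union> \<Union>(fixed_locus d ` {..<k})"
  have C: "closedin ?M C" unfolding C_def
    by (intro closedin_Int closedin_ramified_locus closedin_fixed_locus d)
  have "closedin ?M (\<Union>(fixed_locus d ` {..<k}))"
    by (intro closedin_Union finite_imageI) (auto intro: closedin_fixed_locus[OF d])
  then have E: "closedin ?M E" unfolding E_def
    by (intro closedin_Un closedin_ramified_locus d)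
  have "c \<in> preperiodic_locus d k 1 i \<longleftrightarrow> c \<in> C - E" for c
  proof (cases "c \<in> moduli_space d")
    case True
    then obtain v where v: "v \<in> param_space d" "param_map d v = c" using param_map_surj[OF d] by blast
    let ?f = "poly (param_poly d v)"
    have "c \<in> preperiodic_locus d k 1 i \<longleftrightarrow>
        strictly_preperiodic ?f k 1 (v 1) \<and> ramification_index (param_poly d v) (v 1) = i"
      using preperiodic_locus_iff[OF d v(1)] unfolding v(2) .
    also have "ramification_index (param_poly d v) (v 1) = i \<longleftrightarrow>
        c \<in> ramified_locus d (i - 1) \<and> c \<notin> ramified_locus d i"
      using i unfolding v(2)[symmetric] param_map_in_ramified_locus[OF d v(1)]
      by (auto simp: ramification_index_param_poly[OF d v(1)] simp del: One_nat_def)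
    also have "strictly_preperiodic ?f k 1 (v 1) \<longleftrightarrow> c \<in> fixed_locus d k \<and> (\<forall>l<k. c \<notin> fixed_locus d l)"
    proof -
      have "(\<forall>l\<in>{0..k}. \<forall>m\<in>{1..1}. (l, m) \<noteq> (k, 1) \<longrightarrow> (?f ^^ (l + m)) (v 1) \<noteq> (?f ^^ l) (v 1))
          \<longleftrightarrow> (\<forall>l<k. (?f ^^ (l + 1)) (v 1) \<noteq> (?f ^^ l) (v 1))"
        by (auto simp del: funpow.simps)
      then show ?thesis
        unfolding strictly_preperiodic_def v(2)[symmetric] param_map_in_fixed_locus[OF d v(1)]
        by (simp del: funpow.simps)
    qed
    finally show ?thesis unfolding C_def E_def by blast
  qed (auto simp: preperiodic_locus_def C_def fixed_locus_def)
  then have "preperiodic_locus d k 1 i = (topspace ?M - E) \<inter> C"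
    using closedin_subset[OF C] by auto
  moreover have "openin ?M (topspace ?M - E)" using E by (rule openin_diff[OF openin_topspace])
  ultimately show ?thesis unfolding locally_closedin_def using C by blast
qed

section \<open>The locus of marked polynomials\<close>

lemma alg_dependent_image:
  assumes "alg_dependent (map (\<lambda>g x. g (\<psi> x)) hs) W"
  shows "alg_dependent hs (\<psi> ` W)"
proof -
  have "monom_fun (map (\<lambda>g x. g (\<psi> x)) hs) es x = monom_fun hs es (\<psi> x)" for es x
    by (induction hs arbitrary: es) auto
  then show ?thesis using assms unfolding alg_dependent_def by auto
qed

context
  fixes j p k :: nat
  assumes p: "prime p" and j: "2 \<le> j" "j < p"
begin

abbreviation "locus \<equiv> preperiodic_locus p k 1 j"
abbreviation "locus_topology \<equiv> subtopology (moduli_topology p) locus"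
abbreviation "cls x \<equiv> param_map p (emb j p x)"

lemma locus_subset: "locus \<subseteq> moduli_space p"
  by (auto simp: preperiodic_locus_def)

lemma topspace_locus: "topspace locus_topology = locus"
  using locus_subset by (auto simp: topspace_moduli[OF two_le_degree[OF j]])

interpretation separating_functions locus_topology "regular_funs p"
  by (rule separating_functions_moduli[OF two_le_degree[OF j] locus_subset])

lemma regular_fun_cls:
  assumes "g \<in> regular_funs p"
  shows "\<exists>h\<in>poly_funs {1..p}. \<forall>x. g (cls x) = h (emb j p x)"
  using assms emb_in_param_space[OF j] unfolding regular_funs_def by blast

lemma emb_poly_funs:
  assumes "h \<in> poly_funs {1..p}"
  shows "(\<lambda>x. h (emb j p x)) \<in> poly_funs {j..p}"
proof (rule poly_funs_compose[OF assms])
  fix i assume i: "i \<in> {1..p}"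
  have "(\<lambda>x. (if i < j then (\<lambda>x. 0) else (\<lambda>x. x i)) x - 1 / of_nat (p - 1) * (\<Sum>l\<in>{j..<p}. x l)) \<in> poly_funs {j..p}"
    using i by (intro poly_funs_diff poly_funs.mult poly_funs.const poly_funs_sum poly_funs.coord)
      (auto intro: poly_funs.const poly_funs.coord)
  also have "(\<lambda>x. (if i < j then (\<lambda>x. 0) else (\<lambda>x. x i)) x - 1 / of_nat (p - 1) * (\<Sum>l\<in>{j..<p}. x l))
      = (\<lambda>x. emb j p x i)"
    using i by (auto simp: emb_def fun_eq_iff)
  finally show "(\<lambda>x. emb j p x i) \<in> poly_funs {j..p}" .
qed

lemma krull_dim_locus_le: "krull_dim locus_topology \<le> enat (p - j)"
proof (rule krull_dim_le)
  fix hs assume len: "length hs = Suc (p - j)" and hs: "set hs \<subseteq> regular_funs p"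
  have "(\<lambda>x. g (cls x)) \<in> poly_funs {j..p}" if g: "g \<in> set hs" for g
  proof -
    obtain h where "h \<in> poly_funs {1..p}" "\<forall>x. g (cls x) = h (emb j p x)"
      using regular_fun_cls g hs by blast
    then show ?thesis using emb_poly_funs[of h] by simp
  qed
  then have "alg_dependent (map (\<lambda>g x. g (cls x)) hs) (stratum j p k)"
    by (intro stratum_alg_dependent[OF j]) (auto simp: len)
  then have "alg_dependent hs ((\<lambda>x. cls x) ` stratum j p k)" by (rule alg_dependent_image)
  then show "alg_dependent hs (topspace locus_topology)"
    unfolding topspace_locus unfolding preperiodic_locus_eq[OF j] .
qed

lemma cls_in_locus: "x \<in> stratum j p k \<Longrightarrow> cls x \<in> locus"
  unfolding preperiodic_locus_eq[OF j] by (rule imageI)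

lemma irreduciblein_cls_image:
  assumes Y: "Y \<subseteq> stratum j p k" "Y \<noteq> {}"
    and prime: "\<And>P Q. P \<in> poly_funs {1..p} \<Longrightarrow> Q \<in> poly_funs {1..p} \<Longrightarrow>
      (\<And>x. x \<in> Y \<Longrightarrow> P (emb j p x) * Q (emb j p x) = 0) \<Longrightarrow>
      (\<forall>x\<in>Y. P (emb j p x) = 0) \<or> (\<forall>x\<in>Y. Q (emb j p x) = 0)"
  shows "irreduciblein locus_topology ((\<lambda>x. cls x) ` Y)"
proof (rule irreduciblein_if_prime)
  show "(\<lambda>x. cls x) ` Y \<subseteq> topspace locus_topology"
    unfolding topspace_locus using Y(1) cls_in_locus by blast
  show "(\<lambda>x. cls x) ` Y \<noteq> {}" using Y(2) by simp
  fix f g assume f: "f \<in> regular_funs p" and g: "g \<in> regular_funs p"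
    and 0: "\<forall>c\<in>(\<lambda>x. cls x) ` Y. f c * g c = 0"
  obtain P where P: "P \<in> poly_funs {1..p}" "\<And>x. f (cls x) = P (emb j p x)" using regular_fun_cls[OF f] by blast
  obtain Q where Q: "Q \<in> poly_funs {1..p}" "\<And>x. g (cls x) = Q (emb j p x)" using regular_fun_cls[OF g] by blast
  have "(\<forall>x\<in>Y. P (emb j p x) = 0) \<or> (\<forall>x\<in>Y. Q (emb j p x) = 0)"
  proof (rule prime[OF P(1) Q(1)])
    fix x assume "x \<in> Y"
    then have "f (cls x) * g (cls x) = 0" using 0 by blast
    then show "P (emb j p x) * Q (emb j p x) = 0" by (simp only: P(2) Q(2))
  qed
  then show "(\<forall>c\<in>(\<lambda>x. cls x) ` Y. f c = 0) \<or> (\<forall>c\<in>(\<lambda>x. cls x) ` Y. g c = 0)"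
    by (simp add: P(2) Q(2))
qed

lemma slice_nonempty: "1 \<le> m \<Longrightarrow> slice j p k m \<noteq> {}"
  using slice_generic_point[OF p j, of "{}" m k] by auto

lemma irreduciblein_slice: "1 \<le> m \<Longrightarrow> irreduciblein locus_topology ((\<lambda>x. cls x) ` slice j p k m)"
  by (rule irreduciblein_cls_image[OF _ slice_nonempty slice_irreducible[OF p j]]) (auto simp: slice_def)

lemma slice_all: "slice j p k (p - j) = stratum j p k"
  using j by (auto simp: slice_def)

lemma irreduciblein_locus: "irreduciblein (moduli_topology p) locus"
proof -
  have "irreduciblein locus_topology ((\<lambda>x. cls x) ` slice j p k (p - j))"
    using j by (intro irreduciblein_slice) simp
  then have "irreduciblein locus_topology locus"
    unfolding slice_all preperiodic_locus_eq[OF j, symmetric] .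
  then show ?thesis
    using locus_subset by (simp add: irreduciblein_def topspace_moduli[OF two_le_degree[OF j]] subtopology_subtopology)
qed

text \<open>
  The norm of \<open>x\<^sub>i - \<kappa>\<close> over the group is a function on the moduli space that vanishes on the classes from
  \<open>Y\<close>. Its value at the class of \<open>y\<close> is a product of factors \<open>\<zeta> * y\<^sub>l - \<kappa>\<close> and \<open>- \<kappa>\<close>, none of which is zero.
\<close>

lemma strict_closure_step:
  assumes Y: "Y \<subseteq> stratum j p k" and i: "i \<in> {j..<p}" and \<kappa>: "\<kappa> \<noteq> 0"
    and const: "\<And>x. x \<in> Y \<Longrightarrow> x i = \<kappa>"
    and y: "y \<in> stratum j p k" "\<And>\<zeta> l. \<zeta> ^ (p - 1) = 1 \<Longrightarrow> l \<in> {j..<p} \<Longrightarrow> \<zeta> * y l \<noteq> \<kappa>"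
  shows "cls y \<notin> locus_topology closure_of ((\<lambda>x. cls x) ` Y)"
proof -
  define h where "h v = v i - v 1 - \<kappa>" for v :: "nat \<Rightarrow> complex"
  have "h \<in> poly_funs {1..p}"
    unfolding h_def using i j by (intro poly_funs_diff poly_funs.coord poly_funs.const) auto
  from regular_norm[OF two_le_degree[OF j] this] obtain g where g: "g \<in> regular_funs p"
    "\<And>v. v \<in> param_space p \<Longrightarrow> g (param_map p v) = (\<Prod>\<gamma>\<in>group_elems p. h (act p \<gamma> v))" by blast
  note V = emb_in_param_space[OF j]
  have rel: "emb j p x l - emb j p x 1 = (if l < j then 0 else x l)" if "l \<in> {1..p}" for x l
    using emb_rel[OF j that, of x] by (simp del: One_nat_def)
  have "g (cls x) = 0" if x: "x \<in> Y" for x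
  proof -
    have "h (emb j p x) = 0" using rel[of i x] const[OF x] i j by (simp add: h_def del: One_nat_def)
    then have "(\<Prod>\<gamma>\<in>group_elems p. h (act p \<gamma> (emb j p x))) = 0"
      using finite_group_elems[OF two_le_degree[OF j]] id_in_group_elems[of p] act_id[OF V]
      by (intro prod_zero bexI[of _ "(1, id)"]) auto
    then show ?thesis using g(2)[OF V] by simp
  qed
  then have "(\<lambda>x. cls x) ` Y \<subseteq> {c \<in> topspace locus_topology. g c = 0}"
    unfolding topspace_locus using Y cls_in_locus by auto
  then have "locus_topology closure_of ((\<lambda>x. cls x) ` Y) \<subseteq> {c \<in> topspace locus_topology. g c = 0}"
    by (rule closure_of_minimal[OF _ closed_zeros[OF g(1)]])
  moreover have "g (cls y) \<noteq> 0"
  proof -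
    have "h (act p \<gamma> (emb j p y)) \<noteq> 0" if \<gamma>: "\<gamma> \<in> group_elems p" for \<gamma>
    proof -
      obtain \<zeta> \<sigma> where \<gamma>eq: "\<gamma> = (\<zeta>, \<sigma>)" and \<zeta>: "\<zeta> ^ (p - 1) = 1" and \<sigma>: "\<sigma> permutes {2..p-1}"
        using \<gamma> by (auto simp: group_elems_def)
      have "i \<in> {2..p-1}" using i j by auto
      then have \<sigma>i: "\<sigma> i \<in> {2..p-1}" using \<sigma> by (metis permutes_in_image)
      have "act p \<gamma> (emb j p y) i = \<zeta> * emb j p y (\<sigma> i)" "act p \<gamma> (emb j p y) 1 = \<zeta> * emb j p y 1"
        using i j permutes_fixes_ends(1)[OF two_le_degree[OF j] \<sigma>] by (auto simp: act_def \<gamma>eq)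
      then have "h (act p \<gamma> (emb j p y)) = \<zeta> * (emb j p y (\<sigma> i) - emb j p y 1) - \<kappa>"
        by (simp add: h_def right_diff_distrib)
      also have "emb j p y (\<sigma> i) - emb j p y 1 = (if \<sigma> i < j then 0 else y (\<sigma> i))"
        using \<sigma>i by (intro rel) auto
      finally show ?thesis using y(2)[OF \<zeta>, of "\<sigma> i"] \<sigma>i \<kappa> by (auto split: if_splits)
    qed
    then show ?thesis using g(2)[OF V] finite_group_elems[OF two_le_degree[OF j]] by simp
  qed
  ultimately show ?thesis by blast
qed

text \<open>
  The chain consists of the closures of the images of a point and of the slices with \<open>1, \<dots>, p - j\<close> free variables.
  It is strict because the fixed values of the variables are not related by roots of unity: those at the
  base point have different absolute values, and the value of \<open>x\<^sub>j\<close> at the initial point is chosen to differ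
  from all their rotations.
\<close>

lemma krull_dim_locus_ge: "enat (p - j) \<le> krull_dim locus_topology"
proof -
  define N :: complex where "N = fact (p - 1)"
  define U where "U = {\<zeta> :: complex. \<zeta> ^ (p - 1) = 1}"
  have finU: "finite U" unfolding U_def using j by (intro finite_roots_unity) simp
  have normU: "norm \<zeta> = 1" if "\<zeta> \<in> U" for \<zeta>
    using that j power_eq_1_iff[of \<zeta> "p - 1"] by (auto simp: U_def)
  have inv: "inverse \<zeta> \<in> U" "\<zeta> \<noteq> 0" if "\<zeta> \<in> U" for \<zeta>
    using that normU[OF that] by (auto simp: U_def power_inverse)
  \<comment> \<open>The rotations of the base point values, to be avoided by \<open>x\<^sub>j\<close> at the initial point.\<close>
  define B0 where "B0 = (\<lambda>(\<zeta>, l). \<zeta> * (N * of_nat l)) ` (U \<times> {j<..<p})"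
  have "finite B0" using finU by (simp add: B0_def)
  then obtain x0 where x0: "x0 \<in> slice j p k 1" "x0 j \<notin> B0"
    using slice_generic_point[OF p j, of B0 1 k] j by auto
  define \<kappa> where "\<kappa> l = (if l = j then x0 j else N * of_nat l)" for l
  define Y where "Y m = (if m = 0 then {x0} else slice j p k m)" for m
  have Y_sub: "Y m \<subseteq> stratum j p k" for m using x0 by (auto simp: Y_def slice_def)
  have Y_mono: "Y m \<subseteq> Y (Suc m)" for m using x0 by (auto simp: Y_def slice_def)
  have \<kappa>0: "\<kappa> l \<noteq> 0" if "l \<in> {j..<p}" for l
    using that x0(1) j by (auto simp: \<kappa>_def N_def slice_def stratum_def)
  have \<kappa>_other: "\<zeta> * (N * of_nat l) \<noteq> \<kappa> i" if "\<zeta> \<in> U" "i \<in> {j..<p}" "l \<in> {i<..<p}" for \<zeta> i l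
  proof (cases "i = j")
    case True
    show ?thesis
    proof
      assume "\<zeta> * (N * of_nat l) = \<kappa> i"
      then have "x0 j \<in> B0"
        unfolding B0_def using that True by (intro image_eqI[of _ _ "(\<zeta>, l)"]) (auto simp: \<kappa>_def)
      with x0(2) show False ..
    qed
  next
    case False
    show ?thesis
    proof
      assume "\<zeta> * (N * of_nat l) = \<kappa> i"
      then have "\<zeta> * (N * of_nat l) = N * of_nat i" using False by (simp add: \<kappa>_def)
      then have "norm (\<zeta> * (N * of_nat l)) = norm (N * of_nat i)" by (rule arg_cong)
      then have "real l = real i" using normU[OF that(1)] by (simp add: norm_mult N_def)
      then show False using that(3) by simp
    qed
  qed
  define Z where "Z m = locus_topology closure_of ((\<lambda>x. cls x) ` Y m)" for m
  have "irreduciblein locus_topology ((\<lambda>x. cls x) ` Y m)" for m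
  proof (cases "m = 0")
    case True
    have "irreduciblein locus_topology ((\<lambda>x. cls x) ` {x0})"
      by (rule irreduciblein_cls_image) (use Y_sub[of 0] in \<open>auto simp: Y_def\<close>)
    then show ?thesis using True by (simp add: Y_def)
  next
    case False
    then show ?thesis using irreduciblein_slice[of m] by (simp add: Y_def)
  qed
  then have Z: "closedin locus_topology (Z m) \<and> irreduciblein locus_topology (Z m)" for m
    unfolding Z_def using irreduciblein_closure closedin_closure_of by blast
  have strict: "Z m \<subset> Z (Suc m)" if m: "m < p - j" for m
  proof
    show "Z m \<subseteq> Z (Suc m)" unfolding Z_def by (intro closure_of_mono image_mono Y_mono)
    define i where "i = j + m"
    have i: "i \<in> {j..<p}" using m by (simp add: i_def)
    obtain y where y: "y \<in> slice j p k (Suc m)" "\<forall>l\<in>{j..<p}. l < j + Suc m \<longrightarrow> y l \<notin> (\<lambda>\<zeta>. \<zeta> * \<kappa> i) ` U"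
      using slice_generic_point[OF p j, of "(\<lambda>\<zeta>. \<zeta> * \<kappa> i) ` U" "Suc m" k] finU by auto
    have "cls y \<notin> Z m"
      unfolding Z_def
    proof (rule strict_closure_step[OF Y_sub i \<kappa>0[OF i]])
      show "x i = \<kappa> i" if "x \<in> Y m" for x
        using that i by (auto simp: Y_def slice_def \<kappa>_def i_def N_def split: if_splits)
      show "y \<in> stratum j p k" using y(1) by (simp add: slice_def)
      fix \<zeta> :: complex and l assume \<zeta>: "\<zeta> ^ (p - 1) = 1" and l: "l \<in> {j..<p}"
      have \<zeta>U: "\<zeta> \<in> U" using \<zeta> by (simp add: U_def)
      show "\<zeta> * y l \<noteq> \<kappa> i"
      proof (cases "l < j + Suc m")
        case True
        show ?thesis
        proof
          assume "\<zeta> * y l = \<kappa> i"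
          then have "inverse \<zeta> * \<kappa> i = (inverse \<zeta> * \<zeta>) * y l" by (simp only: mult.assoc)
          then have "y l = inverse \<zeta> * \<kappa> i" using inv(2)[OF \<zeta>U] by simp
          then show False using y(2) l True inv(1)[OF \<zeta>U] by blast
        qed
      next
        case False
        then have "y l = N * of_nat l" using y(1) l by (auto simp: slice_def N_def)
        then show ?thesis using \<kappa>_other[OF \<zeta>U i, of l] l False by (auto simp: i_def)
      qed
    qed
    moreover have "cls y \<in> Z (Suc m)"
    proof -
      have "(\<lambda>x. cls x) ` Y (Suc m) \<subseteq> topspace locus_topology"
        unfolding topspace_locus using Y_sub cls_in_locus by blast
      moreover have "y \<in> Y (Suc m)" using y(1) by (simp add: Y_def)
      ultimately show ?thesis unfolding Z_def using closure_of_subset by blast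
    qed
    ultimately show "Z m \<noteq> Z (Suc m)" by blast
  qed
  show ?thesis
    unfolding krull_dim_def by (intro Sup_upper) (use Z strict in blast)
qed

end

theorem corollary1p6:
  fixes k p j :: nat
  assumes "prime p" and "odd p" and "2 \<le> j" and "j \<le> p - 1"
  shows "locally_closedin (moduli_topology p) (preperiodic_locus p k 1 j)
       \<and> irreduciblein (moduli_topology p) (preperiodic_locus p k 1 j)
       \<and> krull_dim (subtopology (moduli_topology p) (preperiodic_locus p k 1 j)) = enat (p - j)"
proof -
  have j: "2 \<le> j" "j < p" using assms(3,4) by auto
  show ?thesis
    using locally_closedin_preperiodic_locus[of p j k] irreduciblein_locus[OF assms(1) j, of k]
      krull_dim_locus_le[OF assms(1) j, of k] krull_dim_locus_ge[OF assms(1) j, of k] j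
    by (simp add: antisym)
qed

end
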